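(* Let $n\in\mathbb{N}$ and let $\psi\in C^1(\mathbb{R}^n)$ be a (complex-valued) function for which there is $C\in(0,\infty)$ such that $$|\psi(x)|\le\frac{C}{(1+|x|)^{n+1}}\ \text{ and }\ |(\nabla\psi)(x)|\le\frac{C}{(1+|x|)^{n+2}}\ \text{ for every }x\in\mathbb{R}^n,\qquad\int_{\mathbb{R}^n}\psi(x)\,dx=0.$$ For $x\in\mathbb{R}^n$ and $t>0$ set $\psi_t(x):=t^{-n}\psi(x/t)$. Then for each $f\in\mathrm{BMO}(\mathbb{R}^n)$, $$\mu_f(x,t):=|(\psi_t*f)(x)|^2\,\frac{dx\,dt}{t}$$ is a Carleson measure in $\mathbb{R}^{n+1}_+$, and there is a constant $C'\in(0,\infty)$, independent of $f$, such that $$\lim_{r\to0^+}\Bigg\{\sup_{Q\subset\mathbb{R}^n,\ \ell(Q)\le r}\frac1{|Q|}\int_0^{\ell(Q)}\int_Q|(\psi_t*f)(x)|^2\,\frac{dx\,dt}{t}\Bigg\}\le C'\,\mathrm{dist}\big(f,\mathrm{VMO}(\mathbb{R}^n)\big)^2,$$ where $\mathrm{dist}(f,\mathrm{VMO}(\mathbb{R}^n)):=\inf\{\|f-g\|_{\mathrm{BMO}(\mathbb{R}^n)}:g\in\mathrm{VMO}(\mathbb{R}^n)\}$. As a corollary, if $f\in\mathrm{VMO}(\mathbb{R}^n)$ then $\mu_f$ is a vanishing Carleson measure in $\mathbb{R}^{n+1}_+$.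
   Context: $\mathbb{R}^{n+1}_+:=\mathbb{R}^n\times(0,\infty)$. Cubes $Q\subset\mathbb{R}^n$ have sides parallel to the axes, side-length $\ell(Q)$, volume $|Q|$; $f_Q:=|Q|^{-1}\int_Qf$. $\mathrm{BMO}(\mathbb{R}^n)$ is the space of complex-valued $f\in L^1_{\rm loc}(\mathbb{R}^n)$ with $\|f\|_{\mathrm{BMO}(\mathbb{R}^n)}:=\sup_Q|Q|^{-1}\int_Q|f-f_Q|\,dx<\infty$. $\mathrm{VMO}(\mathbb{R}^n)$ is the space of $f\in\mathrm{BMO}(\mathbb{R}^n)$ with $\lim_{r\to0^+}\sup_{\ell(Q)\le r}|Q|^{-1}\int_Q|f-f_Q|\,dx=0$. A Borel measure $\mu$ in $\mathbb{R}^{n+1}_+$ is a Carleson measure if $\sup_Q|Q|^{-1}\mu(Q\times(0,\ell(Q)))<\infty$; it is a vanishing Carleson measure if it is a Carleson measure and $\lim_{r\to0^+}\sup_{\ell(Q)\le r}|Q|^{-1}\mu(Q\times(0,\ell(Q)))=0$. *)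

theory Defs
  imports "HOL-Analysis.Analysis"
begin

(* Cubes are closed; the suprema below are taken over the corner a and the side-length l > 0. *)
definition cube :: "real ^ 'n \<Rightarrow> real \<Rightarrow> (real ^ 'n) set" where
  "cube a l = cbox a (\<chi> i. a $ i + l)"

definition locally_integrable :: "(real ^ 'n \<Rightarrow> complex) \<Rightarrow> bool" where
  "locally_integrable f \<longleftrightarrow> (\<forall>K. compact K \<longrightarrow> f absolutely_integrable_on K)"

definition average :: "(real ^ 'n) set \<Rightarrow> (real ^ 'n \<Rightarrow> complex) \<Rightarrow> complex" where
  "average Q f = (LINT x:Q|lebesgue. f x) /\<^sub>R measure lebesgue Q"

definition mean_osc :: "(real ^ 'n) set \<Rightarrow> (real ^ 'n \<Rightarrow> complex) \<Rightarrow> ennreal" where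
  "mean_osc Q f =
     (\<integral>\<^sup>+x\<in>Q. ennreal (norm (f x - average Q f)) \<partial>lebesgue) / emeasure lebesgue Q"

definition bmo_norm :: "(real ^ 'n \<Rightarrow> complex) \<Rightarrow> ennreal" where
  "bmo_norm f = (SUP (a, l) \<in> UNIV \<times> {0<..}. mean_osc (cube a l) f)"

definition BMO :: "(real ^ 'n \<Rightarrow> complex) set" where
  "BMO = {f. locally_integrable f \<and> bmo_norm f < \<infinity>}"

definition VMO :: "(real ^ 'n \<Rightarrow> complex) set" where
  "VMO = {f \<in> BMO.
     ((\<lambda>r. SUP (a, l) \<in> UNIV \<times> {0<..r}. mean_osc (cube a l) f) \<longlongrightarrow> 0) (at_right 0)}"

definition dist_VMO :: "(real ^ 'n \<Rightarrow> complex) \<Rightarrow> ennreal" where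
  "dist_VMO f = (INF g \<in> VMO. bmo_norm (\<lambda>x. f x - g x))"

definition upper_half_space :: "((real ^ 'n) \<times> real) set" where
  "upper_half_space = UNIV \<times> {0<..}"

definition carleson_measure :: "((real ^ 'n) \<times> real) measure \<Rightarrow> bool" where
  "carleson_measure \<mu> \<longleftrightarrow>
     sets \<mu> = sets (restrict_space borel upper_half_space) \<and>
     (SUP (a, l) \<in> UNIV \<times> {0<..}.
        emeasure \<mu> (cube a l \<times> {0<..<l}) / emeasure lebesgue (cube a l)) < \<infinity>"

definition vanishing_carleson_measure :: "((real ^ 'n) \<times> real) measure \<Rightarrow> bool" where
  "vanishing_carleson_measure \<mu> \<longleftrightarrow>
     carleson_measure \<mu> \<and>
     ((\<lambda>r. SUP (a, l) \<in> UNIV \<times> {0<..r}.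
        emeasure \<mu> (cube a l \<times> {0<..<l}) / emeasure lebesgue (cube a l)) \<longlongrightarrow> 0) (at_right 0)"

(* The norm of complex ^ 'n is the Euclidean one, so norm (grad \<psi> x) is the square root of
   the sum of the squared moduli of the partial derivatives. *)
definition grad :: "(real ^ 'n \<Rightarrow> complex) \<Rightarrow> real ^ 'n \<Rightarrow> complex ^ 'n" where
  "grad \<psi> x = (\<chi> i. frechet_derivative \<psi> (at x) (axis i 1))"

definition C1 :: "(real ^ 'n \<Rightarrow> complex) \<Rightarrow> bool" where
  "C1 \<psi> \<longleftrightarrow> (\<forall>x. \<psi> differentiable (at x)) \<and> continuous_on UNIV (grad \<psi>)"

definition dilate :: "(real ^ 'n \<Rightarrow> complex) \<Rightarrow> real \<Rightarrow> real ^ 'n \<Rightarrow> complex" where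
  "dilate \<psi> t x = \<psi> (x /\<^sub>R t) /\<^sub>R t ^ CARD('n)"

definition convolution ::
    "(real ^ 'n \<Rightarrow> complex) \<Rightarrow> (real ^ 'n \<Rightarrow> complex) \<Rightarrow> real ^ 'n \<Rightarrow> complex" where
  "convolution g f x = (LINT y|lebesgue. g (x - y) * f y)"

definition square_density ::
    "(real ^ 'n \<Rightarrow> complex) \<Rightarrow> (real ^ 'n \<Rightarrow> complex) \<Rightarrow> real ^ 'n \<Rightarrow> real \<Rightarrow> ennreal" where
  "square_density \<psi> f x t = ennreal ((norm (convolution (dilate \<psi> t) f x))\<^sup>2 / t)"

(* If the density is not Borel measurable, the library's density has value 0 on every set. *)
definition square_measure ::
    "(real ^ 'n \<Rightarrow> complex) \<Rightarrow> (real ^ 'n \<Rightarrow> complex) \<Rightarrow> ((real ^ 'n) \<times> real) measure" where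
  "square_measure \<psi> f =
     density (restrict_space lborel upper_half_space) (\<lambda>(x, t). square_density \<psi> f x t)"

end

theory Submission
  imports Defs
begin

text \<open>
  Fix a cube \<open>Q\<close> of side \<open>l\<close>, let \<open>c\<close> be the average of \<open>f\<close> over \<open>3Q\<close>, and write
  \<open>\<psi>\<^sub>t * f = \<psi>\<^sub>t * ((f - c) 1\<^sub>3\<^sub>Q) + \<psi>\<^sub>t * ((f - c) 1\<^sub>\<complement>\<^sub>3\<^sub>Q)\<close>, which is legitimate since \<open>\<psi>\<close> has mean zero.
  On \<open>Q \<times> (0, l)\<close> the second term is at most \<open>t / l\<close> times \<open>\<Sum>k. 2\<^sup>-\<^sup>k k \<omega>(2\<^sup>k l)\<close>, where \<open>\<omega>(r)\<close> is the
  largest mean oscillation over cubes of side at most \<open>r\<close>. The first term is handled without the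
  Fourier transform: the kernel of \<open>T T\<^sup>*\<close>, for \<open>T f (x, t) = \<psi>\<^sub>t * f (x)\<close>, satisfies Schur's test with
  respect to \<open>dx dt / t\<close> because of the almost orthogonality bound \<open>(min (s / t) (t / s))\<^sup>1\<^sup>/\<^sup>2\<close>, and the
  \<open>L\<^sup>2\<close> form of the John--Nirenberg inequality bounds \<open>f - c\<close> on \<open>3Q\<close> by \<open>\<omega>(3l)\<close>.
  The Carleson ratio of \<open>Q\<close> is therefore at most a constant times \<open>(\<omega>(3 2\<^sup>m l) + \<epsilon>\<^sub>m \<parallel>f\<parallel>)\<^sup>2\<close> with
  \<open>\<epsilon>\<^sub>m \<longlonglongrightarrow> 0\<close>. As \<open>l \<longlonglongrightarrow> 0\<close> only \<open>\<omega>(0+)\<close> survives, and \<open>\<omega>(0+) \<le> \<parallel>f - g\<parallel>\<close> for every \<open>g\<close> in VMO.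
\<close>

section \<open>Averages over cubes\<close>

text \<open>The local part calls for an \<open>L^2\<close> bound on \<open>f - c\<close>, yet
  \<open>f\<close> is only known to be locally integrable. Duality resolves this: the local part is
  paired with its own conjugate, the adjoint of T turns the latter into a continuous function h, and
  only the pairing of \<open>f - c\<close> with h has to be bounded. For that pairing averages over
  fine dyadic cubes suffice. The bound has the form of a weighted Young inequality, so that the term
  in h, controlled by Schur's test, is half of the quantity being estimated and can be subtracted.
  Subtraction requires finiteness, which is why heights below \<epsilon> stay cut off until the very
  end. The exponent 1/2 reflects the decay of order n + 1: the function |x| |psi(x)| may fail to be
  integrable, a smaller power of |x| is affordable, and any positive power makes the integral over
  ds / s converge. Centring on \<open>3Q\<close> keeps Q at distance at least l from the far region,
  where one power of t / l survives; this is enough against dt / t.\<close>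

definition cube_average :: "(real ^ 'n \<Rightarrow> 'b::{banach, second_countable_topology}) \<Rightarrow> real ^ 'n \<Rightarrow> real \<Rightarrow> 'b" where
  "cube_average F a l = (LINT x:cube a l|lborel. F x) /\<^sub>R l ^ CARD('n)"

definition cube_integrable :: "(real ^ 'n \<Rightarrow> 'b::{banach, second_countable_topology}) \<Rightarrow> bool" where
  "cube_integrable F \<longleftrightarrow> (\<forall>a l. set_integrable lborel (cube a l) F)"

lemma mem_cube: "x \<in> cube a l \<longleftrightarrow> (\<forall>i. a $ i \<le> x $ i \<and> x $ i \<le> a $ i + l)"
  by (simp add: cube_def mem_box_cart)

lemma cube_sets [measurable, simp]: "cube a l \<in> sets borel"
  by (simp add: cube_def)

lemma compact_cube [simp]: "compact (cube a l)"
  by (simp add: cube_def)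

lemma emeasure_cube:
  fixes a :: "real ^ 'n"
  assumes "l \<ge> 0"
  shows "emeasure lborel (cube a l) = ennreal (l ^ CARD('n))"
proof -
  have "emeasure lborel (cube a l) = ennreal (prod ((\<bullet>) ((\<chi> i. a $ i + l) - a)) Basis)"
    unfolding cube_def using assms
    by (intro emeasure_lborel_cbox) (auto simp: Basis_vec_def inner_axis)
  also have "(\<chi> i. a $ i + l) - a = (\<chi> i. l)" by (simp add: vec_eq_iff)
  also have "prod ((\<bullet>) (\<chi> i. l)) (Basis :: (real ^ 'n) set) = (\<Prod>b\<in>(Basis :: (real ^ 'n) set). l)"
    by (intro prod.cong) (auto simp: Basis_vec_def inner_axis)
  finally show ?thesis by simp
qed

lemma measure_cube:
  fixes a :: "real ^ 'n"
  shows "l \<ge> 0 \<Longrightarrow> measure lborel (cube a l) = l ^ CARD('n)"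
  by (simp add: measure_def emeasure_cube)

lemma emeasure_cube_finite: "emeasure lborel (cube a l) < \<infinity>"
  using emeasure_lborel_cbox_finite by (simp add: cube_def)

text \<open>The dyadic children of a cube are indexed by the sets \<open>S\<close> of coordinates in
  which the upper half is chosen, so that a sum over children is a sum over all subsets of the index
  type.\<close>

definition subcube_corner :: "real ^ 'n \<Rightarrow> real \<Rightarrow> 'n set \<Rightarrow> real ^ 'n" where
  "subcube_corner a l S = (\<chi> i. a $ i + (if i \<in> S then l / 2 else 0))"

lemma subcube_subset:
  assumes "l \<ge> 0"
  shows "cube (subcube_corner a l S) (l / 2) \<subseteq> cube a l"
proof
  fix x assume x: "x \<in> cube (subcube_corner a l S) (l / 2)"
  have "a $ i \<le> x $ i \<and> x $ i \<le> a $ i + l" for i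
    using x[unfolded mem_cube, rule_format, of i] assms
    by (auto simp: subcube_corner_def split: if_splits)
  then show "x \<in> cube a l" by (simp add: mem_cube)
qed

lemma AE_lborel_coordinate_neq: "AE x in lborel. \<forall>i. (x :: real ^ 'n) $ i \<noteq> c i"
proof -
  have "AE x in lborel. (x :: real ^ 'n) $ i \<noteq> c i" for i
  proof -
    have "negligible {x :: real ^ 'n. x \<bullet> axis i 1 = c i}"
      by (rule negligible_standard_hyperplane) (auto simp: Basis_vec_def)
    then have "AE x in lebesgue. x \<notin> {x :: real ^ 'n. x \<bullet> axis i 1 = c i}"
      using AE_not_in negligible_iff_null_sets by blast
    then have "AE x in lborel. x \<notin> {x :: real ^ 'n. x \<bullet> axis i 1 = c i}"
      by (simp add: AE_completion_iff)
    then show ?thesis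
      by (simp add: inner_axis)
  qed
  then show ?thesis by (simp add: AE_all_countable)
qed

text \<open>Closed children overlap only along the bisecting hyperplanes, which are null. Off them a
  point of the cube lies in exactly one child, the one indexed by the coordinates that exceed the
  midpoint.\<close>

lemma AE_indicator_cube_split:
  fixes a :: "real ^ 'n"
  assumes "l > 0"
  shows "AE x in lborel. indicator (cube a l) x =
    (\<Sum>S\<in>UNIV. indicator (cube (subcube_corner a l S) (l / 2)) x :: real)"
  using AE_lborel_coordinate_neq[of "\<lambda>i. a $ i + l / 2"]
proof eventually_elim
  case (elim x)
  define T where "T = {i. x $ i > a $ i + l / 2}"
  show ?case
  proof (cases "x \<in> cube a l")
    case True
    have "x \<in> cube (subcube_corner a l S) (l / 2) \<longleftrightarrow> S = T" for S
    proof
      assume S: "x \<in> cube (subcube_corner a l S) (l / 2)"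
      have "i \<in> S \<longleftrightarrow> i \<in> T" for i
      proof (cases "i \<in> S")
        case True
        then have "a $ i + l / 2 \<le> x $ i" using S by (auto simp: mem_cube subcube_corner_def dest: spec[of _ i])
        then show ?thesis using elim[rule_format, of i] True by (simp add: T_def)
      next
        case False
        then have "x $ i \<le> a $ i + l / 2" using S by (auto simp: mem_cube subcube_corner_def dest: spec[of _ i])
        then show ?thesis using False by (simp add: T_def)
      qed
      then show "S = T" by blast
    next
      assume "S = T"
      then show "x \<in> cube (subcube_corner a l S) (l / 2)"
        using True by (auto simp: mem_cube subcube_corner_def T_def add.commute)
    qed
    then have "(\<Sum>S\<in>UNIV. indicator (cube (subcube_corner a l S) (l / 2)) x :: real)
      = (\<Sum>S\<in>UNIV. if S = T then 1 else 0)"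
      by (intro sum.cong) (auto simp: indicator_def)
    then show ?thesis using True by simp
  next
    case False
    then have "x \<notin> cube (subcube_corner a l S) (l / 2)" for S
      using subcube_subset[of l a S] assms by auto
    then show ?thesis using False by simp
  qed
qed

lemma cube_average_split:
  fixes F :: "real ^ 'n \<Rightarrow> 'b::{banach, second_countable_topology}"
  assumes F: "cube_integrable F" and l: "l > 0"
  shows "cube_average F a l = (\<Sum>S\<in>UNIV. cube_average F (subcube_corner a l S) (l / 2)) /\<^sub>R 2 ^ CARD('n)"
proof -
  have int: "integrable lborel (\<lambda>x. indicator (cube a l) x *\<^sub>R F x)" for a l
    using F by (auto simp: cube_integrable_def set_integrable_def)
  have "(LINT x:cube a l|lborel. F x) =
    (\<integral>x. (\<Sum>S\<in>UNIV. indicator (cube (subcube_corner a l S) (l / 2)) x *\<^sub>R F x) \<partial>lborel)"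
    unfolding set_lebesgue_integral_def
  proof (rule integral_cong_AE)
    show "AE x in lborel. indicat_real (cube a l) x *\<^sub>R F x =
        (\<Sum>S\<in>UNIV. indicat_real (cube (subcube_corner a l S) (l / 2)) x *\<^sub>R F x)"
      using AE_indicator_cube_split[OF l, of a]
      by eventually_elim (simp add: scaleR_sum_left)
    show "(\<lambda>x. indicat_real (cube a l) x *\<^sub>R F x) \<in> borel_measurable lborel"
      by (rule borel_measurable_integrable[OF int])
    show "(\<lambda>x. \<Sum>S\<in>UNIV. indicat_real (cube (subcube_corner a l S) (l / 2)) x *\<^sub>R F x) \<in> borel_measurable lborel"
      by (intro borel_measurable_sum borel_measurable_integrable[OF int])
  qed
  also have "\<dots> = (\<Sum>S\<in>UNIV. (LINT x:cube (subcube_corner a l S) (l / 2)|lborel. F x))"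
    unfolding set_lebesgue_integral_def using int by (intro Bochner_Integration.integral_sum)
  finally show ?thesis
    using l by (simp add: cube_average_def scaleR_sum_right power_divide inverse_eq_divide)
qed

lemma cube_average_mono:
  fixes F G :: "real ^ 'n \<Rightarrow> real"
  assumes "cube_integrable F" "cube_integrable G" "l > 0" "\<And>x. x \<in> cube a l \<Longrightarrow> F x \<le> G x"
  shows "cube_average F a l \<le> cube_average G a l"
  unfolding cube_average_def using assms
  by (intro scaleR_left_mono set_integral_mono) (auto simp: cube_integrable_def)

lemma cube_integrable_const [simp]: "cube_integrable (\<lambda>_. c)"
  unfolding cube_integrable_def set_integrable_def
  by (auto intro!: integrable_real_indicator integrable_scaleR_left emeasure_cube_finite)

lemma cube_average_const [simp]:
  fixes a :: "real ^ 'n"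
  shows "l > 0 \<Longrightarrow> cube_average (\<lambda>_. c) a l = c"
  unfolding cube_average_def set_lebesgue_integral_def
  by (subst integral_scaleR_left)
    (auto intro: integrable_real_indicator simp: emeasure_cube_finite[unfolded infinity_ennreal_def] measure_cube)

lemma cube_integrable_add: "cube_integrable F \<Longrightarrow> cube_integrable G \<Longrightarrow> cube_integrable (\<lambda>x. F x + G x)"
  and cube_integrable_diff: "cube_integrable F \<Longrightarrow> cube_integrable G \<Longrightarrow> cube_integrable (\<lambda>x. F x - G x)"
  by (auto simp: cube_integrable_def)

lemma cube_integrable_norm: "cube_integrable F \<Longrightarrow> cube_integrable (\<lambda>x. norm (F x))"
  by (auto simp: cube_integrable_def set_integrable_norm)

lemma cube_average_add: "cube_integrable F \<Longrightarrow> cube_integrable G \<Longrightarrow>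
    cube_average (\<lambda>x. F x + G x) a l = cube_average F a l + cube_average G a l"
  and cube_average_diff: "cube_integrable F \<Longrightarrow> cube_integrable G \<Longrightarrow>
    cube_average (\<lambda>x. F x - G x) a l = cube_average F a l - cube_average G a l"
  by (auto simp: cube_integrable_def cube_average_def scaleR_right_distrib scaleR_right_diff_distrib)

lemma norm_cube_average_le:
  assumes "cube_integrable F" "l > 0"
  shows "norm (cube_average F a l) \<le> cube_average (\<lambda>x. norm (F x)) a l"
  unfolding cube_average_def set_lebesgue_integral_def
  using assms integral_norm_bound[of lborel "\<lambda>x. indicator (cube a l) x *\<^sub>R F x"]
  by (auto simp: divide_inverse intro!: mult_left_mono)

lemma cube_average_subcube_le:
  fixes F :: "real ^ 'n \<Rightarrow> real"
  assumes "cube_integrable F" "0 < l'" "0 < l" "cube a' l' \<subseteq> cube a l" "\<And>x. F x \<ge> 0"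
  shows "cube_average F a' l' \<le> (l / l') ^ CARD('n) * cube_average F a l"
proof -
  have "(LINT x:cube a' l'|lborel. F x) \<le> (LINT x:cube a l|lborel. F x)"
    unfolding set_lebesgue_integral_def using assms
    by (intro integral_mono) (auto simp: cube_integrable_def set_integrable_def indicator_def)
  then show ?thesis using assms
    by (simp add: cube_average_def field_simps)
qed

text \<open>Cubes are compact, so the continuous factor is bounded on each of them.\<close>

lemma cube_integrable_mult_continuous:
  fixes F h :: "real ^ 'n \<Rightarrow> complex"
  assumes F: "cube_integrable F" and h: "continuous_on UNIV h"
  shows "cube_integrable (\<lambda>x. F x * h x)"
  unfolding cube_integrable_def set_integrable_def
proof safe
  fix a :: "real ^ 'n" and l :: real
  have "bounded (h ` cube a l)"
    by (intro compact_imp_bounded compact_continuous_image continuous_on_subset[OF h]) auto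
  then obtain B where B: "\<And>x. x \<in> cube a l \<Longrightarrow> norm (h x) \<le> B"
    by (auto simp: bounded_iff)
  have int: "integrable lborel (\<lambda>x. indicator (cube a l) x *\<^sub>R F x)"
    using F by (auto simp: cube_integrable_def set_integrable_def)
  have [measurable]: "h \<in> borel_measurable borel"
    using h by (rule borel_measurable_continuous_onI)
  show "integrable lborel (\<lambda>x. indicat_real (cube a l) x *\<^sub>R (F x * h x))"
  proof (rule Bochner_Integration.integrable_bound[OF integrable_mult_right[OF int, of "of_real B"]])
    have "(\<lambda>x. (indicator (cube a l) x *\<^sub>R F x) * h x) \<in> borel_measurable lborel"
      using int by measurable
    then show "(\<lambda>x. indicator (cube a l) x *\<^sub>R (F x * h x)) \<in> borel_measurable lborel" by simp
    show "AE x in lborel. norm (indicat_real (cube a l) x *\<^sub>R (F x * h x)) \<le> norm (complex_of_real B * (indicat_real (cube a l) x *\<^sub>R F x))"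
    proof (intro AE_I2)
      fix x
      have "norm (h x) \<le> \<bar>B\<bar>" if "x \<in> cube a l" using B[OF that] by auto
      then show "norm (indicat_real (cube a l) x *\<^sub>R (F x * h x)) \<le> norm (complex_of_real B * (indicat_real (cube a l) x *\<^sub>R F x))"
        by (auto simp: indicator_def norm_mult mult.commute[of "norm (F x)"] intro!: mult_right_mono)
    qed
  qed
qed

lemma cube_integrable_continuous:
  fixes h :: "real ^ 'n \<Rightarrow> 'b::euclidean_space"
  assumes "continuous_on UNIV h"
  shows "cube_integrable h"
  unfolding cube_integrable_def set_integrable_def
  by (auto intro!: borel_integrable_compact continuous_on_subset[OF assms])

section \<open>A dual John--Nirenberg inequality\<close>

text \<open>The mean of \<open>G\<close> over the descendants of generation \<open>m\<close>.
  Recursion from the root lets inductions treat the children as new roots, and admitting any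
  function \<open>G\<close> of cubes covers nonlinear quantities such as squared deviations.\<close>

primrec tree_average :: "(real ^ 'n \<Rightarrow> real \<Rightarrow> 'b::real_vector) \<Rightarrow> nat \<Rightarrow> real ^ 'n \<Rightarrow> real \<Rightarrow> 'b" where
  "tree_average G 0 a l = G a l"
| "tree_average G (Suc m) a l =
     (\<Sum>S\<in>UNIV. tree_average G m (subcube_corner a l S) (l / 2)) /\<^sub>R 2 ^ CARD('n)"

lemma sum_UNIV_set_const: "(\<Sum>S\<in>(UNIV :: ('n::finite) set set). c) /\<^sub>R 2 ^ CARD('n) = (c :: 'b::real_vector)"
  by (simp add: card_UNIV_set sum_constant_scaleR)

text \<open>The martingale property of dyadic averages.\<close>

lemma tree_average_cube_average:
  "cube_integrable F \<Longrightarrow> l > 0 \<Longrightarrow> tree_average (cube_average F) m a l = cube_average F a l"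
proof (induction m arbitrary: a l)
  case (Suc m)
  then show ?case by (simp flip: cube_average_split)
qed simp

text \<open>Only cubes of the final side inside the root are compared, which admits estimates that
  hold just on small cubes, where a test function is nearly constant.\<close>

lemma tree_average_mono:
  fixes G H :: "real ^ 'n \<Rightarrow> real \<Rightarrow> real"
  assumes "l > 0" "\<And>a'. cube a' (l / 2 ^ m) \<subseteq> cube a l \<Longrightarrow> G a' (l / 2 ^ m) \<le> H a' (l / 2 ^ m)"
  shows "tree_average G m a l \<le> tree_average H m a l"
  using assms
proof (induction m arbitrary: a l)
  case (Suc m)
  have "tree_average G m (subcube_corner a l S) (l / 2) \<le> tree_average H m (subcube_corner a l S) (l / 2)" for S
    using Suc.prems subcube_subset[of l a S] by (intro Suc.IH) (auto simp: field_simps)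
  then show ?case by (auto intro!: mult_left_mono sum_mono)
qed auto

lemma tree_average_add: "tree_average (\<lambda>a l. G a l + H a l) m a l = tree_average G m a l + tree_average H m a l"
  by (induction m arbitrary: a l) (simp_all add: sum.distrib scaleR_right_distrib)

lemma tree_average_scaleR: "tree_average (\<lambda>a l. c *\<^sub>R G a l) m a l = c *\<^sub>R tree_average G m a l"
  by (induction m arbitrary: a l) (simp_all add: scaleR_sum_right mult.commute)

lemma tree_average_const: "tree_average (\<lambda>_ _. c) m a l = c"
  by (induction m arbitrary: a l) (simp_all add: card_UNIV_set sum_constant_scaleR)

lemma norm_tree_average_le:
  fixes G :: "real ^ 'n \<Rightarrow> real \<Rightarrow> 'b::real_normed_vector"
  shows "norm (tree_average G m a l) \<le> tree_average (\<lambda>a l. norm (G a l)) m a l"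
proof (induction m arbitrary: a l)
  case (Suc m)
  have "norm (\<Sum>S\<in>UNIV. tree_average G m (subcube_corner a l S) (l / 2))
      \<le> (\<Sum>S\<in>UNIV. tree_average (\<lambda>a l. norm (G a l)) m (subcube_corner a l S) (l / 2))"
    by (rule order_trans[OF norm_sum sum_mono[OF Suc]])
  then show ?case by (auto intro!: mult_left_mono)
qed auto

section \<open>Stopping cubes and the variance of dyadic averages\<close>

definition cube_oscillation :: "(real ^ 'n \<Rightarrow> complex) \<Rightarrow> real ^ 'n \<Rightarrow> real \<Rightarrow> real" where
  "cube_oscillation f a l = cube_average (\<lambda>x. norm (f x - cube_average f a l)) a l"

text \<open>The fraction of the cube covered by the maximal dyadic subcubes, of generation at most \<open>m\<close>, on
  which the average of \<open>f\<close> is further than \<open>\<rho>\<close> from \<open>c\<close>.\<close>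

primrec stopped_fraction :: "(real ^ 'n \<Rightarrow> complex) \<Rightarrow> complex \<Rightarrow> real \<Rightarrow> nat \<Rightarrow> real ^ 'n \<Rightarrow> real \<Rightarrow> real" where
  "stopped_fraction f c \<rho> 0 a l = (if norm (cube_average f a l - c) > \<rho> then 1 else 0)"
| "stopped_fraction f c \<rho> (Suc m) a l = (if norm (cube_average f a l - c) > \<rho> then 1
     else (\<Sum>S\<in>UNIV. stopped_fraction f c \<rho> m (subcube_corner a l S) (l / 2)) /\<^sub>R 2 ^ CARD('n))"

text \<open>Chebyshev's inequality: on a stopped cube \<open>\<rho>\<close> is below the norm of the
  average of \<open>f - c\<close>, hence below the average of the norm, and stopped cubes overlap
  only in null sets.\<close>

lemma stopped_fraction_le:
  fixes a :: "real ^ 'n"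
  assumes f: "cube_integrable f" and "l > 0"
  shows "\<rho> * stopped_fraction f c \<rho> m a l \<le> cube_average (\<lambda>x. norm (f x - c)) a l"
  using \<open>l > 0\<close>
proof (induction m arbitrary: a l)
  have int: "cube_integrable (\<lambda>x. norm (f x - c))"
    by (intro cube_integrable_norm cube_integrable_diff f cube_integrable_const)
  have stop: "\<rho> \<le> cube_average (\<lambda>x. norm (f x - c)) a l"
    if "norm (cube_average f a l - c) > \<rho>" "l > 0" for a l
  proof -
    have "norm (cube_average (\<lambda>x. f x - c) a l) \<le> cube_average (\<lambda>x. norm (f x - c)) a l"
      using f that by (intro norm_cube_average_le cube_integrable_diff) auto
    then show ?thesis using that f by (simp add: cube_average_diff)
  qed
  have nonneg: "0 \<le> cube_average (\<lambda>x. norm (f x - c)) a l" if "l > 0" for a l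
    using cube_average_mono[of "\<lambda>_. 0" "\<lambda>x. norm (f x - c)" l a] int that by simp
  {
    case 0
    then show ?case using stop nonneg by auto
  next
    case (Suc m)
    have "\<rho> * ((\<Sum>S\<in>UNIV. stopped_fraction f c \<rho> m (subcube_corner a l S) (l / 2)) /\<^sub>R 2 ^ CARD('n))
      = (\<Sum>S\<in>UNIV. \<rho> * stopped_fraction f c \<rho> m (subcube_corner a l S) (l / 2)) /\<^sub>R 2 ^ CARD('n)"
      by (simp add: sum_distrib_left mult.left_commute)
    also have "\<dots> \<le> (\<Sum>S\<in>UNIV. cube_average (\<lambda>x. norm (f x - c)) (subcube_corner a l S) (l / 2)) /\<^sub>R 2 ^ CARD('n)"
      using Suc by (intro scaleR_left_mono sum_mono) auto
    also have "\<dots> = cube_average (\<lambda>x. norm (f x - c)) a l"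
      using cube_average_split[OF int] Suc.prems by simp
    finally show ?case using stop Suc.prems by auto
  }
qed

text \<open>The mean square of the conditional expectation of \<open>f - c\<close> at generation
  \<open>m\<close>. It is finite for merely integrable \<open>f\<close>, which is why it stands in
  for the mean square of \<open>f - c\<close> itself.\<close>

abbreviation dyadic_variance :: "(real ^ 'n \<Rightarrow> complex) \<Rightarrow> complex \<Rightarrow> nat \<Rightarrow> real ^ 'n \<Rightarrow> real \<Rightarrow> real" where
  "dyadic_variance f c \<equiv> tree_average (\<lambda>a l. (norm (cube_average f a l - c))\<^sup>2)"

lemma norm_diff_square_le: "(norm (x - c))\<^sup>2 \<le> 2 * (norm (x - d))\<^sup>2 + 2 * (norm (d - c))\<^sup>2"
  for x :: "'a::real_normed_vector"
proof -
  have "norm (x - c) \<le> norm (x - d) + norm (d - c)"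
    using norm_triangle_ineq[of "x - d" "d - c"] by simp
  then have "(norm (x - c))\<^sup>2 \<le> (norm (x - d) + norm (d - c))\<^sup>2"
    by (intro power_mono) auto
  also have "\<dots> \<le> 2 * (norm (x - d))\<^sup>2 + 2 * (norm (d - c))\<^sup>2"
    using zero_le_power2[of "norm (x - d) - norm (d - c)"] by (simp add: power2_eq_square algebra_simps)
  finally show ?thesis .
qed

lemma dyadic_variance_change_center:
  assumes "l > 0"
  shows "dyadic_variance f c m a l \<le> 2 * dyadic_variance f d m a l + 2 * (norm (d - c))\<^sup>2"
proof -
  have "dyadic_variance f c m a l
      \<le> tree_average (\<lambda>a l. 2 *\<^sub>R (norm (cube_average f a l - d))\<^sup>2 + 2 * (norm (d - c))\<^sup>2) m a l"
    using norm_diff_square_le assms by (intro tree_average_mono) auto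
  then show ?thesis
    by (simp add: tree_average_add tree_average_const tree_average_scaleR del: real_scaleR_def)
       (simp add: tree_average_add tree_average_const)
qed

lemma norm_subcube_average_diff_le:
  fixes f :: "real ^ 'n \<Rightarrow> complex"
  assumes f: "cube_integrable f" and l: "0 < l'" "0 < l" "cube a' l' \<subseteq> cube a l"
  shows "norm (cube_average f a' l' - cube_average f a l) \<le> (l / l') ^ CARD('n) * cube_oscillation f a l"
proof -
  let ?c = "cube_average f a l"
  have "norm (cube_average f a' l' - ?c) = norm (cube_average (\<lambda>x. f x - ?c) a' l')"
    using f l by (simp add: cube_average_diff)
  also have "\<dots> \<le> cube_average (\<lambda>x. norm (f x - ?c)) a' l'"
    using f l by (intro norm_cube_average_le cube_integrable_diff) auto
  also have "\<dots> \<le> (l / l') ^ CARD('n) * cube_oscillation f a l"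
    unfolding cube_oscillation_def using f l
    by (intro cube_average_subcube_le cube_integrable_norm cube_integrable_diff) auto
  finally show ?thesis .
qed

text \<open>A Calderon--Zygmund stopping argument. Cubes that are never stopped contribute at most
  \<open>\<rho>\<^sup>2\<close>. A stopped cube has average within
  \<open>\<rho> + 2 ^ CARD('n) * \<Omega>\<close> of \<open>c\<close>, since its parent was not
  stopped and passing to a child moves the average by at most
  \<open>2 ^ CARD('n) * \<Omega>\<close>; recentring there costs the factors 2 and leaves a variance
  of at most \<open>m\<close> generations, bounded by \<open>M\<close>. The last hypothesis lets the
  root itself be stopped.\<close>

lemma dyadic_variance_stopping:
  fixes f :: "real ^ 'n \<Rightarrow> complex"
  assumes f: "cube_integrable f"
    and osc: "\<And>a' l'. 0 < l' \<Longrightarrow> l' \<le> l0 \<Longrightarrow> cube_oscillation f a' l' \<le> \<Omega>"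
    and M: "\<And>m' a' l'. m' \<le> m \<Longrightarrow> 0 < l' \<Longrightarrow> l' \<le> l0 \<Longrightarrow>
        dyadic_variance f (cube_average f a' l') m' a' l' \<le> M"
    and l: "0 < l" "l \<le> l0"
    and c: "norm (cube_average f a l - c) \<le> \<rho> + 2 ^ CARD('n) * \<Omega>"
  shows "dyadic_variance f c m a l \<le> \<rho>\<^sup>2 + stopped_fraction f c \<rho> m a l * (2 * M + 2 * (\<rho> + 2 ^ CARD('n) * \<Omega>)\<^sup>2)"
  using M l c
proof (induction m arbitrary: a l)
  \<comment> \<open>The estimate at a stopped cube; \<open>\<rho>\<^sup>2\<close> is added to match
    the shape of the conclusion.\<close>
  have stop: "dyadic_variance f c m a l \<le> \<rho>\<^sup>2 + (2 * M + 2 * (\<rho> + 2 ^ CARD('n) * \<Omega>)\<^sup>2)"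
    if "dyadic_variance f (cube_average f a l) m a l \<le> M" "l > 0"
      "norm (cube_average f a l - c) \<le> \<rho> + 2 ^ CARD('n) * \<Omega>" for m a l
  proof -
    have "(norm (cube_average f a l - c))\<^sup>2 \<le> (\<rho> + 2 ^ CARD('n) * \<Omega>)\<^sup>2"
      using that by (intro power_mono) auto
    then show ?thesis
      using dyadic_variance_change_center[of l f c m a "cube_average f a l"] that
        zero_le_power2[of \<rho>] by linarith
  qed
  {
    case 0
    show ?case
    proof (cases "norm (cube_average f a l - c) > \<rho>")
      case True
      then show ?thesis using stop[of a l 0] 0 by simp
    next
      case False
      then have "(norm (cube_average f a l - c))\<^sup>2 \<le> \<rho>\<^sup>2" by (intro power_mono) auto
      then show ?thesis using False by simp
    qed
  next
    case (Suc m)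
    show ?case
    proof (cases "norm (cube_average f a l - c) > \<rho>")
      case True
      have "stopped_fraction f c \<rho> (Suc m) a l = 1" using True by simp
      moreover have "dyadic_variance f (cube_average f a l) (Suc m) a l \<le> M"
        using Suc.prems by blast
      ultimately show ?thesis using stop[of a l "Suc m"] Suc.prems by simp
    next
      case False
      define K where "K = 2 * M + 2 * (\<rho> + 2 ^ CARD('n) * \<Omega>)\<^sup>2"
      have child: "dyadic_variance f c m (subcube_corner a l S) (l / 2)
          \<le> \<rho>\<^sup>2 + stopped_fraction f c \<rho> m (subcube_corner a l S) (l / 2) * K" for S
        unfolding K_def
      proof (rule Suc.IH)
        let ?b = "cube_average f (subcube_corner a l S) (l / 2)"
        have "norm (?b - cube_average f a l) \<le> (l / (l / 2)) ^ CARD('n) * cube_oscillation f a l"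
          using Suc.prems by (intro norm_subcube_average_diff_le f subcube_subset) auto
        also have "\<dots> \<le> 2 ^ CARD('n) * \<Omega>"
          using Suc.prems osc[of l a] by (auto intro!: mult_left_mono)
        finally have "norm (?b - cube_average f a l) \<le> 2 ^ CARD('n) * \<Omega>" .
        moreover have "norm (?b - c) \<le> norm (?b - cube_average f a l) + norm (cube_average f a l - c)"
          using norm_triangle_ineq[of "?b - cube_average f a l" "cube_average f a l - c"] by simp
        ultimately show "norm (?b - c) \<le> \<rho> + 2 ^ CARD('n) * \<Omega>" using False by linarith
      qed (use Suc.prems in auto)
      have "dyadic_variance f c (Suc m) a l
          \<le> (\<Sum>S\<in>UNIV. \<rho>\<^sup>2 + stopped_fraction f c \<rho> m (subcube_corner a l S) (l / 2) * K) /\<^sub>R 2 ^ CARD('n)"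
        unfolding tree_average.simps by (intro scaleR_left_mono sum_mono child) auto
      also have "\<dots> = \<rho>\<^sup>2 + stopped_fraction f c \<rho> (Suc m) a l * K"
        using False sum_UNIV_set_const[of "\<rho>\<^sup>2", where 'n='n]
        by (simp add: sum.distrib sum_distrib_left algebra_simps)
      finally show ?thesis by (simp add: K_def)
    qed
  }
qed

text \<open>With \<open>\<rho> = 4 \<Omega>\<close> at most a quarter of the cube is stopped, so a bound \<open>M\<close> for the variance reproduces
  itself if \<open>16 \<Omega>\<^sup>2 + (2 M + 2 (4 + 2\<^sup>n)\<^sup>2 \<Omega>\<^sup>2) / 4 \<le> M\<close>.\<close>

definition jn_const :: "nat \<Rightarrow> real" where
  "jn_const n = 32 + (4 + 2 ^ n)\<^sup>2"

text \<open>Strong induction on the number of generations replaces an a priori bound. The root is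
  centred at its own average and so is not stopped; hence every stopped cube has fewer than
  \<open>m\<close> generations below it, and the bound is already known there.\<close>

lemma dyadic_variance_le:
  fixes f :: "real ^ 'n \<Rightarrow> complex"
  assumes f: "cube_integrable f" and \<Omega>: "\<Omega> > 0"
    and osc: "\<And>a' l'. 0 < l' \<Longrightarrow> l' \<le> l0 \<Longrightarrow> cube_oscillation f a' l' \<le> \<Omega>"
    and l: "0 < l" "l \<le> l0"
  shows "dyadic_variance f (cube_average f a l) m a l \<le> jn_const CARD('n) * \<Omega>\<^sup>2"
  using l
proof (induction m arbitrary: a l rule: less_induct)
  case (less m)
  define c where "c = cube_average f a l"
  define \<rho> where "\<rho> = 4 * \<Omega>"
  define M where "M = jn_const CARD('n) * \<Omega>\<^sup>2"
  define K where "K = 2 * M + 2 * (\<rho> + 2 ^ CARD('n) * \<Omega>)\<^sup>2"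
  have "K \<ge> 0" by (simp add: K_def M_def jn_const_def)
  show ?case
  proof (cases m)
    case 0
    then show ?thesis by (simp add: jn_const_def)
  next
    case (Suc m')
    have "\<rho> * stopped_fraction f c \<rho> m a l \<le> \<Omega>"
      using stopped_fraction_le[OF f, of l \<rho> c m a] osc[of l a] less.prems
      by (simp add: c_def cube_oscillation_def)
    then have s: "stopped_fraction f c \<rho> m a l \<le> 1 / 4"
      using \<Omega> by (simp add: \<rho>_def field_simps)
    have child: "dyadic_variance f c m' (subcube_corner a l S) (l / 2)
        \<le> \<rho>\<^sup>2 + stopped_fraction f c \<rho> m' (subcube_corner a l S) (l / 2) * K" for S
      unfolding K_def
    proof (rule dyadic_variance_stopping[OF f osc])
      show "dyadic_variance f (cube_average f a' l') m'' a' l' \<le> M"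
        if "m'' \<le> m'" "0 < l'" "l' \<le> l0" for m'' a' l'
        unfolding M_def using that Suc by (intro less.IH) auto
      let ?b = "cube_average f (subcube_corner a l S) (l / 2)"
      have "norm (?b - cube_average f a l) \<le> (l / (l / 2)) ^ CARD('n) * cube_oscillation f a l"
        using less.prems by (intro norm_subcube_average_diff_le f subcube_subset) auto
      also have "\<dots> \<le> 2 ^ CARD('n) * \<Omega>"
        using less.prems osc[of l a] by (auto intro!: mult_left_mono)
      finally show "norm (?b - c) \<le> \<rho> + 2 ^ CARD('n) * \<Omega>" using \<Omega> by (simp add: c_def \<rho>_def)
    qed (use less.prems in auto)
    have "dyadic_variance f c m a l
        \<le> (\<Sum>S\<in>UNIV. \<rho>\<^sup>2 + stopped_fraction f c \<rho> m' (subcube_corner a l S) (l / 2) * K) /\<^sub>R 2 ^ CARD('n)"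
      unfolding Suc tree_average.simps by (intro scaleR_left_mono sum_mono child) auto
    also have "\<dots> = \<rho>\<^sup>2 + stopped_fraction f c \<rho> m a l * K"
      using \<Omega> sum_UNIV_set_const[of "\<rho>\<^sup>2", where 'n='n] unfolding Suc
      by (simp add: c_def \<rho>_def sum.distrib sum_distrib_left algebra_simps)
    also have "\<dots> \<le> \<rho>\<^sup>2 + 1 / 4 * K"
      using s \<open>K \<ge> 0\<close> by (intro add_left_mono mult_right_mono)
    \<comment> \<open>\<open>jn_const\<close> is chosen so that
      \<open>\<rho>\<^sup>2 + K / 4\<close> equals \<open>M\<close> exactly.\<close>
    also have "\<dots> = jn_const CARD('n) * \<Omega>\<^sup>2"
      by (simp add: K_def M_def \<rho>_def jn_const_def power2_eq_square algebra_simps)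
    finally show ?thesis by (simp add: c_def)
  qed
qed

text \<open>Factor the difference of squares. This exchanges the value of a test function at a
  corner for its value elsewhere on a small cube.\<close>

lemma norm_diff_of_square_le:
  fixes x y :: complex
  assumes "norm (x - y) \<le> \<delta>" "norm x \<le> B" "norm y \<le> B"
  shows "(norm x)\<^sup>2 \<le> (norm y)\<^sup>2 + 2 * B * \<delta>"
proof -
  have "norm x - norm y \<le> \<delta>" using norm_triangle_ineq2[of x y] assms by linarith
  moreover have "\<delta> \<ge> 0" using assms(1) norm_ge_zero order_trans by blast
  ultimately have "(norm x - norm y) * (norm x + norm y) \<le> \<delta> * (2 * B)"
    using assms(2,3) by (intro mult_mono) auto
  then show ?thesis by (simp add: power2_eq_square algebra_simps)
qed

text \<open>Testing against a continuous \<open>h\<close> lets one pass from dyadic averages to \<open>f\<close> itself without the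
  Lebesgue differentiation theorem.\<close>

lemma john_nirenberg_dual:
  fixes f h :: "real ^ 'n \<Rightarrow> complex"
  assumes f: "cube_integrable f" and \<Omega>: "\<Omega> > 0"
    and osc: "\<And>a' l'. 0 < l' \<Longrightarrow> l' \<le> l \<Longrightarrow> cube_oscillation f a' l' \<le> \<Omega>"
    and l: "0 < l" and h: "continuous_on UNIV h" and \<kappa>: "\<kappa> > 0"
  shows "norm (cube_average (\<lambda>x. (f x - cube_average f a l) * h x) a l)
    \<le> (\<kappa> * (jn_const CARD('n) * \<Omega>\<^sup>2) + cube_average (\<lambda>x. (norm (h x))\<^sup>2) a l / \<kappa>) / 2"
proof (rule field_le_epsilon)
  fix e :: real assume "e > 0"
  let ?c = "cube_average f a l"
  let ?L = "cube_average (\<lambda>x. (f x - ?c) * h x) a l"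
  have int: "cube_integrable (\<lambda>x. f x - ?c)" using f by (intro cube_integrable_diff) auto
  have int_h: "cube_integrable (\<lambda>x. (f x - ?c) * h x)"
    by (rule cube_integrable_mult_continuous[OF int h])
  have int_h2: "cube_integrable (\<lambda>x. (norm (h x))\<^sup>2)"
    by (rule cube_integrable_continuous) (intro continuous_intros h)
  have "bounded (h ` cube a l)"
    by (intro compact_imp_bounded compact_continuous_image continuous_on_subset[OF h]) auto
  then obtain B where B: "\<And>x. x \<in> cube a l \<Longrightarrow> norm (h x) \<le> B" "B > 0"
    by (force simp: bounded_pos)
  \<comment> \<open>All errors caused by \<open>\<delta>\<close> add up to
    \<open>\<delta> * (B / \<kappa> + \<Omega>)\<close>; since \<open>D\<close> dominates this
    coefficient, \<open>\<delta> = e / D\<close> keeps them at most \<open>e\<close>.\<close>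
  define D where "D = 1 + \<Omega> + B / \<kappa>"
  have D: "D > 0" unfolding D_def using \<Omega> B(2) \<kappa> by (intro add_pos_pos divide_pos_pos) auto
  define \<delta> where "\<delta> = e / D"
  have \<delta>: "\<delta> > 0" using D \<open>e > 0\<close> by (simp add: \<delta>_def)
  have "uniformly_continuous_on (cube a l) h"
    by (intro compact_uniformly_continuous continuous_on_subset[OF h]) auto
  then obtain \<eta> where \<eta>: "\<eta> > 0"
    "\<And>x y. x \<in> cube a l \<Longrightarrow> y \<in> cube a l \<Longrightarrow> dist y x < \<eta> \<Longrightarrow> dist (h y) (h x) < \<delta>"
    unfolding uniformly_continuous_on_def using \<delta> by metis
  \<comment> \<open>At generation \<open>m\<close> the sum of the side lengths of a descendant is
    below \<open>\<eta>\<close>, so \<open>h\<close> stays within \<open>\<delta>\<close> of its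
    value at the corner.\<close>
  obtain m where m: "CARD('n) * l / \<eta> < 2 ^ m"
    using real_arch_pow[of 2 "CARD('n) * l / \<eta>"] by auto
  define s where "s = l / 2 ^ m"
  have s: "s > 0" using l by (simp add: s_def)
  have s\<eta>: "CARD('n) * s < \<eta>" using m \<eta>(1) l by (simp add: s_def field_simps)
  have close: "norm (h x - h b) \<le> \<delta>" if "cube b s \<subseteq> cube a l" "x \<in> cube b s" for x b
  proof -
    have "norm (x - b) \<le> (\<Sum>i\<in>UNIV. \<bar>(x - b) $ i\<bar>)" by (rule norm_le_l1_cart)
    also have "\<dots> \<le> (\<Sum>i\<in>(UNIV :: 'n set). s)"
      using that(2) by (intro sum_mono) (auto simp: mem_cube abs_le_iff algebra_simps add.commute intro: order_trans)
    finally have "dist x b < \<eta>" using s\<eta> by (simp add: dist_norm)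
    moreover have "b \<in> cube b s" using s by (simp add: mem_cube)
    ultimately show ?thesis using \<eta>(2)[of b x] that by (force simp: dist_norm)
  qed
  \<comment> \<open>With \<open>h\<close> frozen at the corner \<open>b\<close>, Young's inequality
    gives the first terms, \<open>B * \<delta> / \<kappa>\<close> being the price of unfreezing the
    square of \<open>h\<close>; the last term is the error of freezing \<open>h\<close> in the
    product. In this shape \<open>tree_average\<close> passes through \<open>G\<close> by
    linearity.\<close>
  define G where "G = (\<lambda>b r. (\<kappa> / 2) *\<^sub>R (norm (cube_average f b r - ?c))\<^sup>2
      + ((1 / (2 * \<kappa>)) *\<^sub>R cube_average (\<lambda>x. (norm (h x))\<^sup>2) b r + B * \<delta> / \<kappa>)
      + \<delta> *\<^sub>R cube_average (\<lambda>x. norm (f x - ?c)) b r)"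
  have local: "norm (cube_average (\<lambda>x. (f x - ?c) * h x) b s) \<le> G b s" if b: "cube b s \<subseteq> cube a l" for b
  proof -
    let ?f = "cube_average f b s - ?c"
    have bs: "b \<in> cube b s" using s by (simp add: mem_cube)
    have "cube_average (\<lambda>x. (f x - ?c) * h x) b s
        = cube_average (\<lambda>x. (f x - ?c) * (h x - h b)) b s + cube_average (\<lambda>x. (f x - ?c) * h b) b s"
    proof (subst cube_average_add[symmetric])
      show "cube_integrable (\<lambda>x. (f x - ?c) * (h x - h b))" "cube_integrable (\<lambda>x. (f x - ?c) * h b)"
        by (intro cube_integrable_mult_continuous int continuous_intros h)+
    qed (simp add: algebra_simps)
    also have "cube_average (\<lambda>x. (f x - ?c) * h b) b s = ?f * h b"
    proof -
      have "cube_average (\<lambda>x. (f x - ?c) * h b) b s = cube_average (\<lambda>x. f x - ?c) b s * h b"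
        by (simp add: cube_average_def)
      then show ?thesis using f s by (simp add: cube_average_diff)
    qed
    finally have eq: "cube_average (\<lambda>x. (f x - ?c) * h x) b s
        = cube_average (\<lambda>x. (f x - ?c) * (h x - h b)) b s + ?f * h b" .
    have "norm (cube_average (\<lambda>x. (f x - ?c) * (h x - h b)) b s)
        \<le> cube_average (\<lambda>x. norm ((f x - ?c) * (h x - h b))) b s"
      by (intro norm_cube_average_le cube_integrable_mult_continuous int continuous_intros h s)
    also have "\<dots> \<le> cube_average (\<lambda>x. \<delta> * norm (f x - ?c)) b s"
    proof (rule cube_average_mono)
      show "cube_integrable (\<lambda>x. norm ((f x - ?c) * (h x - h b)))"
        by (intro cube_integrable_norm cube_integrable_mult_continuous int continuous_intros h)
      show "cube_integrable (\<lambda>x. \<delta> * norm (f x - ?c))"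
        using cube_integrable_norm[OF int] by (simp add: cube_integrable_def)
      show "norm ((f x - ?c) * (h x - h b)) \<le> \<delta> * norm (f x - ?c)" if "x \<in> cube b s" for x
        using close[OF b that] by (simp add: norm_mult mult.commute[of _ "norm (h x - h b)"] mult_right_mono)
    qed (rule s)
    also have "\<dots> = \<delta> * cube_average (\<lambda>x. norm (f x - ?c)) b s"
      by (simp add: cube_average_def)
    finally have 1: "norm (cube_average (\<lambda>x. (f x - ?c) * (h x - h b)) b s)
        \<le> \<delta> * cube_average (\<lambda>x. norm (f x - ?c)) b s" .
    have "(norm (h b))\<^sup>2 = cube_average (\<lambda>x. (norm (h b))\<^sup>2) b s" using s by simp
    also have "\<dots> \<le> cube_average (\<lambda>x. (norm (h x))\<^sup>2 + 2 * B * \<delta>) b s"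
    proof (rule cube_average_mono)
      show "(norm (h b))\<^sup>2 \<le> (norm (h x))\<^sup>2 + 2 * B * \<delta>" if "x \<in> cube b s" for x
        using close[OF b that] b bs that
        by (intro norm_diff_of_square_le) (auto simp: norm_minus_commute intro!: B)
    qed (use s in \<open>auto intro!: cube_integrable_add int_h2\<close>)
    also have "\<dots> = cube_average (\<lambda>x. (norm (h x))\<^sup>2) b s + 2 * B * \<delta>"
      using s by (simp add: cube_average_add[OF int_h2])
    finally have 2: "(norm (h b))\<^sup>2 \<le> cube_average (\<lambda>x. (norm (h x))\<^sup>2) b s + 2 * B * \<delta>" .
    have "0 \<le> (\<kappa> * norm ?f - norm (h b))\<^sup>2 / (2 * \<kappa>)" using \<kappa> by simp
    also have "\<dots> = \<kappa> / 2 * (norm ?f)\<^sup>2 + (norm (h b))\<^sup>2 / (2 * \<kappa>) - norm ?f * norm (h b)"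
      using \<kappa> by (simp add: field_simps power2_eq_square)
    finally have "norm ?f * norm (h b) \<le> \<kappa> / 2 * (norm ?f)\<^sup>2 + (norm (h b))\<^sup>2 / (2 * \<kappa>)" by simp
    also have "\<dots> \<le> \<kappa> / 2 * (norm ?f)\<^sup>2 + (cube_average (\<lambda>x. (norm (h x))\<^sup>2) b s + 2 * B * \<delta>) / (2 * \<kappa>)"
      using 2 \<kappa> by (intro add_left_mono divide_right_mono) auto
    finally have "norm (?f * h b) \<le> \<kappa> / 2 * (norm ?f)\<^sup>2 + (cube_average (\<lambda>x. (norm (h x))\<^sup>2) b s + 2 * B * \<delta>) / (2 * \<kappa>)"
      by (simp add: norm_mult)
    moreover have "(cube_average (\<lambda>x. (norm (h x))\<^sup>2) b s + 2 * B * \<delta>) / (2 * \<kappa>)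
        = 1 / (2 * \<kappa>) * cube_average (\<lambda>x. (norm (h x))\<^sup>2) b s + B * \<delta> / \<kappa>"
      using \<kappa> by (simp add: field_simps)
    ultimately show ?thesis
      unfolding eq G_def real_scaleR_def using 1
        norm_triangle_ineq[of "cube_average (\<lambda>x. (f x - ?c) * (h x - h b)) b s" "?f * h b"] by linarith
  qed
  have "norm ?L = norm (tree_average (cube_average (\<lambda>x. (f x - ?c) * h x)) m a l)"
    using tree_average_cube_average[OF int_h l] by simp
  also have "\<dots> \<le> tree_average (\<lambda>b r. norm (cube_average (\<lambda>x. (f x - ?c) * h x) b r)) m a l"
    by (rule norm_tree_average_le)
  also have "\<dots> \<le> tree_average G m a l"
    using local l unfolding s_def by (intro tree_average_mono) auto
  also have "\<dots> = \<kappa> / 2 * dyadic_variance f ?c m a l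
      + (cube_average (\<lambda>x. (norm (h x))\<^sup>2) a l / (2 * \<kappa>) + B * \<delta> / \<kappa>)
      + \<delta> * cube_oscillation f a l"
    unfolding G_def tree_average_add tree_average_scaleR tree_average_const
      tree_average_cube_average[OF int_h2 l] tree_average_cube_average[OF cube_integrable_norm[OF int] l]
    by (simp add: cube_oscillation_def)
  also have "\<dots> \<le> \<kappa> / 2 * (jn_const CARD('n) * \<Omega>\<^sup>2)
      + (cube_average (\<lambda>x. (norm (h x))\<^sup>2) a l / (2 * \<kappa>) + B * \<delta> / \<kappa>) + \<delta> * \<Omega>"
    using dyadic_variance_le[OF f \<Omega> osc l order_refl] osc[OF l order_refl] \<kappa> \<delta>
    by (intro add_mono mult_left_mono) auto
  also have "\<dots> = (\<kappa> * (jn_const CARD('n) * \<Omega>\<^sup>2) + cube_average (\<lambda>x. (norm (h x))\<^sup>2) a l / \<kappa>) / 2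
      + \<delta> * (B / \<kappa> + \<Omega>)"
    using \<kappa> by (simp add: field_simps)
  also have "\<delta> * (B / \<kappa> + \<Omega>) \<le> \<delta> * D" using \<delta> by (intro mult_left_mono) (auto simp: D_def)
  also have "\<delta> * D = e" using D by (simp add: \<delta>_def)
  finally show "norm ?L \<le> (\<kappa> * (jn_const CARD('n) * \<Omega>\<^sup>2) + cube_average (\<lambda>x. (norm (h x))\<^sup>2) a l / \<kappa>) / 2 + e"
    by simp
qed

section \<open>Schur's test\<close>

text \<open>No integrability is asked: the Bochner integral of a non-integrable function is
  0.\<close>

lemma norm_integral_le_nn_integral:
  fixes F :: "'a \<Rightarrow> 'b::{banach, second_countable_topology}"
  shows "ennreal (norm (\<integral>x. F x \<partial>M)) \<le> (\<integral>\<^sup>+x. norm (F x) \<partial>M)"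
  by (cases "integrable M F") (auto intro: integral_norm_bound_ennreal simp: not_integrable_integral_eq)

lemma borel_measurable_cnj [measurable (raw)]:
  "f \<in> borel_measurable M \<Longrightarrow> (\<lambda>x. cnj (f x)) \<in> borel_measurable M"
  by (rule borel_measurable_continuous_on[OF continuous_on_cnj[OF continuous_on_id]])

text \<open>An operator composed with its adjoint has a Hermitian kernel. This turns row bounds into
  column bounds in Schur's test and later interchanges the two scales of
  \<open>pair_kernel\<close>.\<close>

lemma norm_cnj_kernel_commute:
  fixes u v :: "'a \<Rightarrow> complex"
  shows "norm (\<integral>y. u y * cnj (v y) \<partial>N) = norm (\<integral>y. v y * cnj (u y) \<partial>N)"
proof -
  have "(\<integral>y. v y * cnj (u y) \<partial>N) = (\<integral>y. cnj (u y * cnj (v y)) \<partial>N)"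
    by (simp add: mult.commute)
  also have "\<dots> = cnj (\<integral>y. u y * cnj (v y) \<partial>N)" by (rule Bochner_Integration.integral_cnj)
  finally show ?thesis by simp
qed

text \<open>Writing \<open>h\<close> for the inner integral, the square integral of \<open>h\<close>
  is a quadratic form in \<open>g\<close> whose kernel is bounded by row integrals, and symmetry
  makes rows enough. The bounds \<open>B\<close> and \<open>G\<close> and the finiteness of
  \<open>M\<close> justify the exchanges of integrals; the estimate itself depends on
  \<open>A\<close> alone.\<close>

lemma schur_test_square:
  fixes k :: "'a \<Rightarrow> 'b \<Rightarrow> complex" and g :: "'a \<Rightarrow> complex" and A B G :: real
  assumes "finite_measure M" "sigma_finite_measure N"
    and k [measurable]: "case_prod k \<in> borel_measurable (M \<Otimes>\<^sub>M N)"
    and g [measurable]: "g \<in> borel_measurable M"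
    and kb: "\<And>X y. norm (k X y) \<le> B" and k1: "\<And>X. (\<integral>\<^sup>+y. norm (k X y) \<partial>N) \<le> ennreal B"
    and gb: "\<And>X. norm (g X) \<le> G"
    and "A \<ge> 0"
    and schur: "\<And>X. (\<integral>\<^sup>+X'. norm (\<integral>y. k X y * cnj (k X' y) \<partial>N) \<partial>M) \<le> ennreal A"
  shows "integrable N (\<lambda>y. (norm (\<integral>X. k X y * g X \<partial>M))\<^sup>2)"
    and "(\<integral>y. (norm (\<integral>X. k X y * g X \<partial>M))\<^sup>2 \<partial>N) \<le> A * (\<integral>X. (norm (g X))\<^sup>2 \<partial>M)"
proof -
  interpret M: finite_measure M by fact
  interpret N: sigma_finite_measure N by fact
  interpret P: pair_sigma_finite M N ..
  interpret MM: pair_sigma_finite M M ..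
  have B: "B \<ge> 0" using kb norm_ge_zero order_trans by blast
  have G: "G \<ge> 0" using gb norm_ge_zero order_trans by blast
  define h where "h y = (\<integral>X. k X y * g X \<partial>M)" for y
  define H where "H = B * G * measure M (space M)"
  have kg_le: "norm (k X y * g X) \<le> B * G" for X y
    unfolding norm_mult using kb gb B by (intro mult_mono) auto
  have h_le: "norm (h y) \<le> H" for y
  proof -
    have "ennreal (norm (h y)) \<le> (\<integral>\<^sup>+X. norm (k X y * g X) \<partial>M)"
      unfolding h_def by (rule norm_integral_le_nn_integral)
    also have "\<dots> \<le> (\<integral>\<^sup>+X. ennreal (B * G) \<partial>M)"
      using kg_le by (intro nn_integral_mono ennreal_leI)
    also have "\<dots> = ennreal H"
      using B G by (simp add: H_def M.emeasure_eq_measure ennreal_mult)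
    finally show ?thesis using B G by (simp add: H_def)
  qed
  have H: "H \<ge> 0" using B G by (simp add: H_def)
  have h_meas [measurable]: "h \<in> borel_measurable N"
    unfolding h_def by measurable
  \<comment> \<open>Every use of \<open>P.Fubini_integral\<close> rests on this: \<open>k X\<close>
    has integral norm at most \<open>B\<close> uniformly in \<open>X\<close>, and \<open>M\<close>
    is finite.\<close>
  have bounded_integrable: "integrable (M \<Otimes>\<^sub>M N) (\<lambda>(X, y). k X y * v X y)"
    if [measurable]: "case_prod v \<in> borel_measurable (M \<Otimes>\<^sub>M N)" and v: "\<And>X y. norm (v X y) \<le> V" for v V
  proof (rule integrableI_bounded)
    have V: "V \<ge> 0" using v norm_ge_zero order_trans by blast
    have "(\<integral>\<^sup>+z. ennreal (norm (case z of (X, y) \<Rightarrow> k X y * v X y)) \<partial>(M \<Otimes>\<^sub>M N))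
      = (\<integral>\<^sup>+X. \<integral>\<^sup>+y. ennreal (norm (k X y * v X y)) \<partial>N \<partial>M)"
      by (subst N.nn_integral_fst[symmetric]) simp_all
    also have "\<dots> \<le> (\<integral>\<^sup>+X. \<integral>\<^sup>+y. ennreal V * ennreal (norm (k X y)) \<partial>N \<partial>M)"
      using v V by (intro nn_integral_mono)
        (auto simp: norm_mult ennreal_mult[symmetric] mult.commute[of _ "norm (k _ _)"] intro!: mult_left_mono ennreal_leI)
    also have "\<dots> = (\<integral>\<^sup>+X. ennreal V * (\<integral>\<^sup>+y. ennreal (norm (k X y)) \<partial>N) \<partial>M)"
      by (intro nn_integral_cong nn_integral_cmult) measurable
    also have "\<dots> \<le> (\<integral>\<^sup>+X. ennreal V * ennreal B \<partial>M)"
      using k1 by (intro nn_integral_mono mult_left_mono) auto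
    also have "\<dots> < \<infinity>" using M.emeasure_finite[of "space M"]
      by (simp add: M.emeasure_eq_measure ennreal_mult[symmetric] V B)
    finally show "(\<integral>\<^sup>+z. ennreal (norm (case z of (X, y) \<Rightarrow> k X y * v X y)) \<partial>(M \<Otimes>\<^sub>M N)) < \<infinity>" .
  qed measurable
  have int_h: "integrable N h"
    unfolding h_def
    by (rule P.integrable_snd[OF bounded_integrable[where v = "\<lambda>X y. g X" and V = G]]) (use gb in auto)
  show "integrable N (\<lambda>y. (norm (\<integral>X. k X y * g X \<partial>M))\<^sup>2)"
    unfolding h_def[symmetric]
  proof (rule Bochner_Integration.integrable_bound[OF integrable_mult_right[OF int_h, of "of_real H"]])
    show "AE y in N. norm ((norm (h y))\<^sup>2) \<le> norm (complex_of_real H * h y)"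
      using h_le H by (auto simp: norm_mult power2_eq_square intro!: mult_right_mono)
  qed measurable
  define K where "K X X' = norm (\<integral>y. k X y * cnj (k X' y) \<partial>N)" for X X'
  have K [measurable]: "case_prod K \<in> borel_measurable (M \<Otimes>\<^sub>M M)"
  proof -
    have [measurable]: "(\<lambda>z. k (fst (fst z)) (snd z)) \<in> borel_measurable ((M \<Otimes>\<^sub>M M) \<Otimes>\<^sub>M N)"
      "(\<lambda>z. k (snd (fst z)) (snd z)) \<in> borel_measurable ((M \<Otimes>\<^sub>M M) \<Otimes>\<^sub>M N)"
      by (rule measurable_compose[OF _ k, of "\<lambda>z. (_ z, snd z)", unfolded prod.case]; measurable)+
    have "(\<lambda>z. \<integral>y. k (fst z) y * cnj (k (snd z) y) \<partial>N) \<in> borel_measurable (M \<Otimes>\<^sub>M M)"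
      by (rule N.borel_measurable_lebesgue_integral) (unfold case_prod_unfold, measurable)
    then show ?thesis
      unfolding K_def case_prod_unfold by (rule measurable_compose) simp
  qed
  \<comment> \<open>Integrating \<open>g X * J X\<close> recovers the square integral of
    \<open>h\<close>, while inserting the formula for \<open>h\<close> into \<open>J\<close> exposes
    the kernel \<open>K\<close>.\<close>
  define J where "J X = (\<integral>y. k X y * cnj (h y) \<partial>N)" for X
  have J_le: "ennreal (norm (J X)) \<le> (\<integral>\<^sup>+X'. ennreal (norm (g X')) * ennreal (K X X') \<partial>M)" if X: "X \<in> space M" for X
  proof -
    have kX [measurable]: "k X \<in> borel_measurable N" using X by measurable
    have "cnj (J X) = (\<integral>y. cnj (k X y) * h y \<partial>N)"
      unfolding J_def by (subst Bochner_Integration.integral_cnj[symmetric]) simp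
    also have "\<dots> = (\<integral>y. (\<integral>X'. k X' y * (g X' * cnj (k X y)) \<partial>M) \<partial>N)"
    proof (intro Bochner_Integration.integral_cong refl)
      fix y
      show "cnj (k X y) * h y = (\<integral>X'. k X' y * (g X' * cnj (k X y)) \<partial>M)"
        unfolding h_def by (subst integral_mult_right_zero[symmetric]) (simp add: algebra_simps)
    qed
    also have "\<dots> = (\<integral>X'. (\<integral>y. k X' y * (g X' * cnj (k X y)) \<partial>N) \<partial>M)"
    proof (rule P.Fubini_integral[OF bounded_integrable])
      show "norm (g X' * cnj (k X y)) \<le> G * B" for X' y
        using gb kb G by (auto simp: norm_mult intro!: mult_mono)
    qed measurable
    also have "\<dots> = (\<integral>X'. g X' * (\<integral>y. k X' y * cnj (k X y) \<partial>N) \<partial>M)"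
      by (intro Bochner_Integration.integral_cong refl, subst integral_mult_right_zero[symmetric])
        (simp add: algebra_simps)
    finally have "norm (J X) = norm (\<integral>X'. g X' * (\<integral>y. k X' y * cnj (k X y) \<partial>N) \<partial>M)"
      by (metis complex_mod_cnj)
    also have "ennreal \<dots> \<le> (\<integral>\<^sup>+X'. norm (g X' * (\<integral>y. k X' y * cnj (k X y) \<partial>N)) \<partial>M)"
      by (rule norm_integral_le_nn_integral)
    also have "\<dots> = (\<integral>\<^sup>+X'. ennreal (norm (g X')) * ennreal (K X X') \<partial>M)"
      using norm_cnj_kernel_commute[of N "k X"] by (simp add: K_def norm_mult ennreal_mult)
    finally show ?thesis .
  qed
  have "complex_of_real (\<integral>y. (norm (h y))\<^sup>2 \<partial>N) = (\<integral>y. complex_of_real ((norm (h y))\<^sup>2) \<partial>N)"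
    by (rule integral_complex_of_real[symmetric])
  also have "\<dots> = (\<integral>y. (\<integral>X. k X y * (g X * cnj (h y)) \<partial>M) \<partial>N)"
  proof (intro Bochner_Integration.integral_cong refl)
    fix y
    have "complex_of_real ((norm (h y))\<^sup>2) = cnj (h y) * h y"
      using complex_norm_square[of "h y"] by (simp add: mult.commute)
    also have "\<dots> = (\<integral>X. cnj (h y) * (k X y * g X) \<partial>M)" unfolding h_def by simp
    finally show "complex_of_real ((norm (h y))\<^sup>2) = (\<integral>X. k X y * (g X * cnj (h y)) \<partial>M)"
      by (simp add: algebra_simps)
  qed
  also have "\<dots> = (\<integral>X. (\<integral>y. k X y * (g X * cnj (h y)) \<partial>N) \<partial>M)"
  proof (rule P.Fubini_integral[OF bounded_integrable])
    show "norm (g X * cnj (h y)) \<le> G * H" for X y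
      using gb h_le G by (auto simp: norm_mult intro!: mult_mono)
  qed measurable
  also have "\<dots> = (\<integral>X. g X * J X \<partial>M)"
    unfolding J_def
    by (intro Bochner_Integration.integral_cong refl, subst integral_mult_right_zero[symmetric])
      (simp add: algebra_simps)
  finally have eq: "complex_of_real (\<integral>y. (norm (h y))\<^sup>2 \<partial>N) = (\<integral>X. g X * J X \<partial>M)" .
  have g2: "integrable M (\<lambda>X. (norm (g X))\<^sup>2)"
    using gb by (intro M.integrable_const_bound[where B = "G\<^sup>2"]) (auto intro!: power_mono)
  define I where "I = (\<integral>\<^sup>+X. ennreal ((norm (g X))\<^sup>2) \<partial>M)"
  have row: "(\<integral>\<^sup>+X. ennreal ((norm (g X))\<^sup>2) * (\<integral>\<^sup>+X'. ennreal (K X X') \<partial>M) \<partial>M) \<le> ennreal A * I"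
  proof -
    have "(\<integral>\<^sup>+X. ennreal ((norm (g X))\<^sup>2) * (\<integral>\<^sup>+X'. ennreal (K X X') \<partial>M) \<partial>M)
        \<le> (\<integral>\<^sup>+X. ennreal A * ennreal ((norm (g X))\<^sup>2) \<partial>M)"
      using schur by (intro nn_integral_mono) (auto simp: K_def mult.commute[of "ennreal A"] intro!: mult_left_mono)
    then show ?thesis by (simp add: I_def nn_integral_cmult)
  qed
  have "(\<integral>y. (norm (h y))\<^sup>2 \<partial>N) = norm (complex_of_real (\<integral>y. (norm (h y))\<^sup>2 \<partial>N))" by simp
  also have "ennreal \<dots> \<le> (\<integral>\<^sup>+X. norm (g X * J X) \<partial>M)"
    unfolding eq by (rule norm_integral_le_nn_integral)
  also have "\<dots> \<le> (\<integral>\<^sup>+X. (\<integral>\<^sup>+X'. ennreal (norm (g X)) * (ennreal (norm (g X')) * ennreal (K X X')) \<partial>M) \<partial>M)"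
  proof (rule nn_integral_mono)
    fix X assume X: "X \<in> space M"
    have [measurable]: "K X \<in> borel_measurable M" using X by measurable
    show "ennreal (norm (g X * J X)) \<le> (\<integral>\<^sup>+X'. ennreal (norm (g X)) * (ennreal (norm (g X')) * ennreal (K X X')) \<partial>M)"
      using J_le[OF X] by (subst nn_integral_cmult) (auto simp: norm_mult ennreal_mult intro!: mult_left_mono)
  qed
  \<comment> \<open>The arithmetic-geometric mean inequality splits the form into two halves, which
    the symmetry of \<open>K\<close> makes equal.\<close>
  also have "\<dots> \<le> (\<integral>\<^sup>+X. (\<integral>\<^sup>+X'. ennreal (1/2) * (ennreal ((norm (g X))\<^sup>2) * ennreal (K X X'))
       + ennreal (1/2) * (ennreal ((norm (g X'))\<^sup>2) * ennreal (K X X')) \<partial>M) \<partial>M)"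
  proof (intro nn_integral_mono)
    fix X X'
    have "norm (g X) * norm (g X') \<le> ((norm (g X))\<^sup>2 + (norm (g X'))\<^sup>2) / 2"
      using zero_le_power2[of "norm (g X) - norm (g X')"] by (simp add: power2_eq_square algebra_simps)
    then have "norm (g X) * norm (g X') * K X X' \<le> ((norm (g X))\<^sup>2 + (norm (g X'))\<^sup>2) / 2 * K X X'"
      by (rule mult_right_mono) (simp add: K_def)
    then have "norm (g X) * (norm (g X') * K X X')
        \<le> 1/2 * ((norm (g X))\<^sup>2 * K X X') + 1/2 * ((norm (g X'))\<^sup>2 * K X X')"
      by (simp add: algebra_simps)
    moreover have "K X X' \<ge> 0" by (simp add: K_def)
    ultimately show "ennreal (norm (g X)) * (ennreal (norm (g X')) * ennreal (K X X'))
      \<le> ennreal (1/2) * (ennreal ((norm (g X))\<^sup>2) * ennreal (K X X'))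
       + ennreal (1/2) * (ennreal ((norm (g X'))\<^sup>2) * ennreal (K X X'))"
      by (simp only: ennreal_mult[symmetric] ennreal_plus[symmetric] norm_ge_zero zero_le_power2
          mult_nonneg_nonneg add_nonneg_nonneg zero_le_divide_1_iff zero_le_numeral ennreal_leI)
  qed
  also have "\<dots> = ennreal (1/2) * (\<integral>\<^sup>+X. ennreal ((norm (g X))\<^sup>2) * (\<integral>\<^sup>+X'. ennreal (K X X') \<partial>M) \<partial>M)
      + ennreal (1/2) * (\<integral>\<^sup>+X. (\<integral>\<^sup>+X'. ennreal ((norm (g X'))\<^sup>2) * ennreal (K X X') \<partial>M) \<partial>M)"
  proof -
    have "(\<integral>\<^sup>+X'. ennreal (1/2) * (ennreal ((norm (g X))\<^sup>2) * ennreal (K X X'))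
       + ennreal (1/2) * (ennreal ((norm (g X'))\<^sup>2) * ennreal (K X X')) \<partial>M)
      = ennreal (1/2) * (ennreal ((norm (g X))\<^sup>2) * (\<integral>\<^sup>+X'. ennreal (K X X') \<partial>M))
       + ennreal (1/2) * (\<integral>\<^sup>+X'. ennreal ((norm (g X'))\<^sup>2) * ennreal (K X X') \<partial>M)" if X: "X \<in> space M" for X
    proof -
      have [measurable]: "K X \<in> borel_measurable M" using X by measurable
      show ?thesis by (simp add: nn_integral_add nn_integral_cmult)
    qed
    then show ?thesis by (simp add: nn_integral_add nn_integral_cmult cong: nn_integral_cong)
  qed
  also have "(\<integral>\<^sup>+X. (\<integral>\<^sup>+X'. ennreal ((norm (g X'))\<^sup>2) * ennreal (K X X') \<partial>M) \<partial>M)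
    = (\<integral>\<^sup>+X'. (\<integral>\<^sup>+X. ennreal ((norm (g X'))\<^sup>2) * ennreal (K X X') \<partial>M) \<partial>M)"
    by (rule MM.Fubini') measurable
  also have "\<dots> = (\<integral>\<^sup>+X'. ennreal ((norm (g X'))\<^sup>2) * (\<integral>\<^sup>+X. ennreal (K X' X) \<partial>M) \<partial>M)"
  proof (intro nn_integral_cong)
    fix X' assume X: "X' \<in> space M"
    have [measurable]: "K X' \<in> borel_measurable M" using X by measurable
    have "K X X' = K X' X" for X unfolding K_def by (rule norm_cnj_kernel_commute)
    then show "(\<integral>\<^sup>+X. ennreal ((norm (g X'))\<^sup>2) * ennreal (K X X') \<partial>M)
      = ennreal ((norm (g X'))\<^sup>2) * (\<integral>\<^sup>+X. ennreal (K X' X) \<partial>M)"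
      by (simp add: nn_integral_cmult)
  qed
  also have "ennreal (1/2) * (\<integral>\<^sup>+X. ennreal ((norm (g X))\<^sup>2) * (\<integral>\<^sup>+X'. ennreal (K X X') \<partial>M) \<partial>M)
      + ennreal (1/2) * (\<integral>\<^sup>+X. ennreal ((norm (g X))\<^sup>2) * (\<integral>\<^sup>+X'. ennreal (K X X') \<partial>M) \<partial>M)
     \<le> ennreal (1/2) * (ennreal A * I) + ennreal (1/2) * (ennreal A * I)"
    by (intro add_mono mult_left_mono row) auto
  also have "\<dots> = ennreal (1/2 + 1/2) * (ennreal A * I)"
    by (subst ennreal_plus) (auto simp only: distrib_right)
  also have "\<dots> = ennreal A * I" by simp
  also have "I = ennreal (\<integral>X. (norm (g X))\<^sup>2 \<partial>M)"
    unfolding I_def using g2 by (intro nn_integral_eq_integral) auto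
  also have "ennreal A * \<dots> = ennreal (A * (\<integral>X. (norm (g X))\<^sup>2 \<partial>M))"
    using \<open>A \<ge> 0\<close> by (simp add: ennreal_mult)
  finally have "ennreal (\<integral>y. (norm (h y))\<^sup>2 \<partial>N) \<le> ennreal (A * (\<integral>X. (norm (g X))\<^sup>2 \<partial>M))" .
  moreover have "A * (\<integral>X. (norm (g X))\<^sup>2 \<partial>M) \<ge> 0" using \<open>A \<ge> 0\<close> by simp
  ultimately show "(\<integral>y. (norm (\<integral>X. k X y * g X \<partial>M))\<^sup>2 \<partial>N) \<le> A * (\<integral>X. (norm (g X))\<^sup>2 \<partial>M)"
    by (simp add: h_def)
qed

section \<open>Almost orthogonality of the dilated kernels\<close>

lemma nn_integral_lborel_affine:
  fixes f :: "'a::euclidean_space \<Rightarrow> ennreal"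
  assumes [measurable]: "f \<in> borel_measurable borel" and c: "c \<noteq> 0"
  shows "(\<integral>\<^sup>+x. f x \<partial>lborel) = ennreal (\<bar>c\<bar> ^ DIM('a)) * (\<integral>\<^sup>+x. f (a + c *\<^sub>R x) \<partial>lborel)"
  by (subst lborel_affine[OF c, of a]) (simp add: nn_integral_density nn_integral_distr nn_integral_cmult)

lemma nn_integral_lborel_shift:
  fixes f :: "'a::euclidean_space \<Rightarrow> ennreal"
  assumes "f \<in> borel_measurable borel"
  shows "(\<integral>\<^sup>+x. f (a + x) \<partial>lborel) = (\<integral>\<^sup>+x. f x \<partial>lborel)"
    and "(\<integral>\<^sup>+x. f (a - x) \<partial>lborel) = (\<integral>\<^sup>+x. f x \<partial>lborel)"
  using nn_integral_lborel_affine[OF assms, of 1 a] nn_integral_lborel_affine[OF assms, of "-1" a] by auto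

lemma integral_lborel_affine:
  fixes f :: "'a::euclidean_space \<Rightarrow> 'b::{banach, second_countable_topology}"
  assumes [measurable]: "f \<in> borel_measurable borel" and c: "c \<noteq> 0"
  shows "(\<integral>x. f x \<partial>lborel) = \<bar>c\<bar> ^ DIM('a) *\<^sub>R (\<integral>x. f (a + c *\<^sub>R x) \<partial>lborel)"
  by (subst lborel_affine[OF c, of a]) (simp add: integral_density integral_distr)

text \<open>The exponent \<open>n + 1/2\<close> is large enough for integrability and small enough for
  \<open>C * decay_weight x\<close> to dominate \<open>norm (\<psi> x) * sqrt (norm x)\<close>.\<close>

definition decay_weight :: "real ^ 'n \<Rightarrow> real" where
  "decay_weight x = 1 / ((1 + norm x) ^ CARD('n) * sqrt (1 + norm x))"

lemma decay_weight_measurable [measurable]: "decay_weight \<in> borel_measurable borel"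
  unfolding decay_weight_def by measurable

lemma one_plus_norm_pos [simp]: "0 < 1 + norm x"
  by (intro add_pos_nonneg) auto

lemma decay_weight_nonneg [simp]: "decay_weight x \<ge> 0"
  by (simp add: decay_weight_def)

text \<open>On the shell where \<open>1 + norm x\<close> lies between \<open>2 ^ k\<close> and
  \<open>2 ^ (k + 1)\<close> the weight is at most \<open>c k\<close>, and the shell lies in a cube
  of side \<open>2 ^ (k + 2)\<close>. The products form a geometric series; its ratio
  \<open>q\<close> is what the half power in the weight leaves after the volume has been paid
  for.\<close>

lemma decay_weight_integrable: "(\<integral>\<^sup>+x. ennreal (decay_weight x) \<partial>(lborel :: (real ^ 'n) measure)) < \<infinity>"
proof -
  define q where "q = 1 / sqrt 2"
  have q: "0 < q" "q < 1" by (auto simp: q_def)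
  define D where "D k = cube (\<chi> i. - (2 ^ (k + 1)) :: real ^ 'n) (2 ^ (k + 2))" for k :: nat
  define c where "c k = q ^ k / (2 ^ k) ^ CARD('n)" for k :: nat
  have [measurable]: "D k \<in> sets borel" for k by (simp add: D_def)
  have c: "c k \<ge> 0" for k using q by (simp add: c_def)
  have pointwise: "ennreal (decay_weight x) \<le> (\<Sum>k. ennreal (c k) * indicator (D k) x)" for x :: "real ^ 'n"
  proof -
    have ex: "\<exists>m. 1 + norm x < 2 ^ m" using real_arch_pow[of 2 "1 + norm x"] by auto
    define m where "m = (LEAST m. 1 + norm x < 2 ^ m)"
    have m: "1 + norm x < 2 ^ m" using LeastI_ex[OF ex] by (simp add: m_def)
    have "m \<noteq> 0" using m norm_ge_zero[of x] by (metis add_increasing2 linorder_not_less order_refl power_0)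
    then obtain k where k: "m = Suc k" using not0_implies_Suc by blast
    have k2: "2 ^ k \<le> 1 + norm x"
      using not_less_Least[of k "\<lambda>m. 1 + norm x < 2 ^ m"] k by (simp add: m_def not_less)
    have "decay_weight x \<le> 1 / ((2 ^ k) ^ CARD('n) * sqrt (2 ^ k))"
      unfolding decay_weight_def using k2 by (intro divide_left_mono mult_mono power_mono mult_pos_pos zero_less_power) auto
    also have "\<dots> = c k"
      by (simp add: c_def q_def real_sqrt_power power_divide field_simps)
    finally have "ennreal (decay_weight x) \<le> ennreal (c k) * indicator (D k) x"
    proof -
      have "\<bar>x $ i\<bar> \<le> 2 ^ (k + 1)" for i using component_le_norm_cart[of x i] m k by simp
      then have "x \<in> D k" by (auto simp: D_def mem_cube abs_le_iff minus_le_iff)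
      then show ?thesis using \<open>decay_weight x \<le> 1 / _\<close> \<open>_ = c k\<close> by (simp add: ennreal_leI)
    qed
    also have "\<dots> \<le> (\<Sum>k. ennreal (c k) * indicator (D k) x)"
      using sum_le_suminf[of "\<lambda>k. ennreal (c k) * indicator (D k) x" "{k}"]
      by (simp del: sum_mult_indicator)
    finally show ?thesis .
  qed
  have "(\<integral>\<^sup>+x. ennreal (decay_weight x) \<partial>(lborel :: (real ^ 'n) measure)) \<le> (\<integral>\<^sup>+x. (\<Sum>k. ennreal (c k) * indicator (D k) x) \<partial>lborel)"
    by (intro nn_integral_mono pointwise)
  also have "\<dots> = (\<Sum>k. \<integral>\<^sup>+x. ennreal (c k) * indicator (D k) x \<partial>lborel)"
    by (rule nn_integral_suminf) auto
  also have "\<dots> = (\<Sum>k. ennreal (4 ^ CARD('n) * q ^ k))"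
  proof (intro suminf_cong)
    fix k
    have "(\<integral>\<^sup>+x. ennreal (c k) * indicator (D k) x \<partial>lborel) = ennreal (c k) * ennreal ((2 ^ (k + 2)) ^ CARD('n))"
      by (simp add: nn_integral_cmult_indicator) (simp add: D_def emeasure_cube)
    also have "\<dots> = ennreal (c k * (2 ^ (k + 2)) ^ CARD('n))" using c by (simp add: ennreal_mult)
    also have "c k * (2 ^ (k + 2)) ^ CARD('n) = 4 ^ CARD('n) * q ^ k"
      by (simp add: c_def power_add power_mult_distrib)
    finally show "(\<integral>\<^sup>+x. ennreal (c k) * indicator (D k) x \<partial>lborel) = ennreal (4 ^ CARD('n) * q ^ k)" .
  qed
  also have "\<dots> = ennreal (\<Sum>k. 4 ^ CARD('n) * q ^ k)"
    using q by (intro suminf_ennreal2 summable_mult summable_geometric) auto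
  also have "\<dots> < \<infinity>" by simp
  finally show ?thesis .
qed

text \<open>The \<open>itself\<close> argument carries the dimension, on which alone the constant
  depends. Finiteness has just been shown, so \<open>enn2real\<close> loses nothing.\<close>

definition decay_mass :: "'n::finite itself \<Rightarrow> real" where
  "decay_mass TYPE('n) = enn2real (\<integral>\<^sup>+x. ennreal (decay_weight x) \<partial>(lborel :: (real ^ 'n) measure))"

lemma nn_integral_decay_weight:
  "(\<integral>\<^sup>+x. ennreal (decay_weight x) \<partial>(lborel :: (real ^ 'n) measure)) = ennreal (decay_mass TYPE('n))"
  unfolding decay_mass_def by (rule ennreal_enn2real[symmetric]) (use decay_weight_integrable in \<open>simp add: less_top\<close>)

lemma decay_mass_nonneg: "decay_mass TYPE('n::finite) \<ge> 0"
  by (simp add: decay_mass_def)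

lemma decay_weight_ge:
  fixes x :: "real ^ 'n"
  assumes "p \<ge> CARD('n) + 1"
  shows "1 / (1 + norm x) ^ p \<le> decay_weight x"
proof -
  have "(1 + norm x) * 1 \<le> (1 + norm x) * (1 + norm x)" by (intro mult_left_mono) auto
  then have "sqrt (1 + norm x) \<le> 1 + norm x" by (intro real_le_lsqrt) (auto simp: power2_eq_square)
  then have "(1 + norm x) ^ CARD('n) * sqrt (1 + norm x) \<le> (1 + norm x) ^ CARD('n) * (1 + norm x) ^ 1"
    by (intro mult_left_mono) auto
  also have "\<dots> = (1 + norm x) ^ (CARD('n) + 1)" by simp
  also have "\<dots> \<le> (1 + norm x) ^ p" using assms by (intro power_increasing) auto
  finally show ?thesis unfolding decay_weight_def
    by (intro divide_left_mono mult_pos_pos zero_less_power) auto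
qed

text \<open>Split at \<open>s = t\<close>, where the two square roots cross. Below it an
  antiderivative is \<open>2 * sqrt s / sqrt t\<close>, above it
  \<open>- 2 * sqrt t / sqrt s\<close>; each side contributes at most 2, whatever the cutoffs
  are.\<close>

lemma nn_integral_scale_ratio_le:
  assumes "t > 0" "\<epsilon> > 0"
  shows "(\<integral>\<^sup>+s\<in>{\<epsilon>..l}. ennreal (min (sqrt (s / t)) (sqrt (t / s)) / s) \<partial>lborel) \<le> 4"
proof -
  let ?f = "\<lambda>s. 1 / (sqrt s * sqrt t)" and ?g = "\<lambda>s. sqrt t / (s * sqrt s)"
  let ?m = "\<lambda>s. min (sqrt (s / t)) (sqrt (t / s)) / s"
  have 1: "(\<integral>\<^sup>+s\<in>{\<epsilon>..t}. ennreal (?f s) \<partial>lborel) \<le> 2"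
  proof (cases "\<epsilon> \<le> t")
    case True
    have "(\<integral>\<^sup>+s\<in>{\<epsilon>..t}. ennreal (?f s) \<partial>lborel) = ennreal (2 * sqrt t / sqrt t - 2 * sqrt \<epsilon> / sqrt t)"
    proof (rule nn_integral_FTC_Icc)
      fix s assume "s \<in> {\<epsilon>..t}"
      then have "s > 0" using assms by auto
      then show "((\<lambda>s. 2 * sqrt s / sqrt t) has_real_derivative ?f s) (at s)"
        using assms by (auto intro!: derivative_eq_intros simp: field_simps)
    qed (use assms True in auto)
    also have "\<dots> \<le> ennreal 2" using assms by (intro ennreal_leI) auto
    finally show ?thesis by simp
  qed simp
  have 2: "(\<integral>\<^sup>+s\<in>{t..l}. ennreal (?g s) \<partial>lborel) \<le> 2"
  proof (cases "t \<le> l")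
    case True
    have "(\<integral>\<^sup>+s\<in>{t..l}. ennreal (?g s) \<partial>lborel) = ennreal ((- 2 * sqrt t / sqrt l) - (- 2 * sqrt t / sqrt t))"
    proof (rule nn_integral_FTC_Icc)
      fix s assume "s \<in> {t..l}"
      then have "s > 0" using assms by auto
      then show "((\<lambda>s. - 2 * sqrt t / sqrt s) has_real_derivative ?g s) (at s)"
        using assms by (auto intro!: derivative_eq_intros simp: field_simps)
    qed (use assms True in auto)
    also have "\<dots> \<le> ennreal 2" using assms True by (intro ennreal_leI) auto
    finally show ?thesis by simp
  qed simp
  have "(\<integral>\<^sup>+s\<in>{\<epsilon>..l}. ennreal (?m s) \<partial>lborel)
    \<le> (\<integral>\<^sup>+s. ennreal (?f s) * indicator {\<epsilon>..t} s + ennreal (?g s) * indicator {t..l} s \<partial>lborel)"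
  proof (rule nn_integral_mono)
    fix s
    show "ennreal (?m s) * indicator {\<epsilon>..l} s \<le> ennreal (?f s) * indicator {\<epsilon>..t} s + ennreal (?g s) * indicator {t..l} s"
    proof (cases "s \<in> {\<epsilon>..l}")
      case True
      then have s: "s > 0" using assms by auto
      have f: "?m s \<le> ?f s"
      proof -
        have "?m s \<le> sqrt (s / t) / s" using s by (intro divide_right_mono) auto
        also have "\<dots> = ?f s" using s assms by (simp add: real_sqrt_divide field_simps)
        finally show ?thesis .
      qed
      have g: "?m s \<le> ?g s"
      proof -
        have "?m s \<le> sqrt (t / s) / s" using s by (intro divide_right_mono) auto
        also have "\<dots> = ?g s" using s assms by (simp add: real_sqrt_divide field_simps)
        finally show ?thesis .
      qed
      show ?thesis
        using True f g by (cases "s \<le> t") (auto simp: indicator_def ennreal_leI intro: add_increasing2 add_increasing)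
    qed simp
  qed
  also have "\<dots> = (\<integral>\<^sup>+s\<in>{\<epsilon>..t}. ennreal (?f s) \<partial>lborel) + (\<integral>\<^sup>+s\<in>{t..l}. ennreal (?g s) \<partial>lborel)"
    by (rule nn_integral_add) auto
  also have "\<dots> \<le> 2 + 2" using 1 2 by (rule add_mono)
  finally show ?thesis by simp
qed

section \<open>Integral bounds for the kernel and its dilates\<close>

locale littlewood_paley_kernel =
  fixes \<psi> :: "real ^ 'n \<Rightarrow> complex" and C :: real
  assumes C1: "C1 \<psi>" and C_pos: "C > 0"
    and decay: "\<And>x. norm (\<psi> x) \<le> C / (1 + norm x) ^ (CARD('n) + 1)"
    and grad_decay: "\<And>x. norm (grad \<psi> x) \<le> C / (1 + norm x) ^ (CARD('n) + 2)"
    and mean_zero: "(LINT x|lebesgue. \<psi> x) = 0"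
begin

lemma psi_continuous: "continuous_on UNIV \<psi>"
  using C1 by (auto simp: C1_def intro!: differentiable_imp_continuous_on differentiable_at_imp_differentiable_on)

lemma psi_measurable [measurable]: "\<psi> \<in> borel_measurable borel"
  using psi_continuous by (rule borel_measurable_continuous_onI)

text \<open>Expansion in coordinates, each bounded by the full norm; hence the factor
  \<open>CARD('n)\<close>.\<close>

lemma norm_frechet_derivative_le:
  "norm (frechet_derivative \<psi> (at x) v) \<le> CARD('n) * norm (grad \<psi> x) * norm v"
proof -
  let ?D = "frechet_derivative \<psi> (at x)"
  have "linear ?D"
    using C1 by (intro linear_frechet_derivative) (auto simp: C1_def)
  then have "?D (\<Sum>i\<in>UNIV. (v $ i) *\<^sub>R axis i 1) = (\<Sum>i\<in>UNIV. (v $ i) *\<^sub>R ?D (axis i 1))"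
    by (simp add: linear_sum linear_scale)
  moreover have "(\<Sum>i\<in>UNIV. (v $ i) *\<^sub>R axis i 1) = v"
    using basis_expansion[of v] by (simp add: scalar_mult_eq_scaleR)
  ultimately have "norm (?D v) = norm (\<Sum>i\<in>UNIV. (v $ i) *\<^sub>R ?D (axis i 1))" by simp
  also have "\<dots> \<le> (\<Sum>i\<in>(UNIV :: 'n set). norm v * norm (grad \<psi> x))"
  proof (rule sum_norm_le)
    fix i
    have "norm (?D (axis i 1)) \<le> norm (grad \<psi> x)"
      using Finite_Cartesian_Product.norm_nth_le[of "grad \<psi> x" i] by (simp add: grad_def)
    then show "norm ((v $ i) *\<^sub>R ?D (axis i 1)) \<le> norm v * norm (grad \<psi> x)"
      using component_le_norm_cart[of v i] by (auto intro!: mult_mono)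
  qed
  finally show ?thesis by (simp add: algebra_simps)
qed

text \<open>The mean value inequality along the segment. A point \<open>z\<close> within distance 1
  of \<open>x\<close> satisfies \<open>1 + norm z \<ge> (1 + norm x) / 2\<close>, so the decay of
  the gradient at \<open>z\<close> transfers to \<open>x\<close> at the price of
  \<open>2 ^ (CARD('n) + 2)\<close>.\<close>

lemma norm_diff_near_le:
  assumes "norm w \<le> 1"
  shows "norm (\<psi> (x + w) - \<psi> x) \<le> CARD('n) * C * 2 ^ (CARD('n) + 2) * decay_weight x * norm w"
proof -
  let ?B = "CARD('n) * C * 2 ^ (CARD('n) + 2) * decay_weight x"
  have "norm (\<psi> (x + w) - \<psi> x) \<le> ?B * norm ((x + w) - x)"
  proof (rule differentiable_bound[OF convex_closed_segment[of x "x + w"]])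
    fix z assume z: "z \<in> closed_segment x (x + w)"
    show "(\<psi> has_derivative frechet_derivative \<psi> (at z)) (at z within closed_segment x (x + w))"
      using C1 by (auto simp: C1_def frechet_derivative_works[symmetric] intro: has_derivative_at_withinI)
    have "norm (z - x) \<le> 1"
      using segment_bound1[OF z] assms by (simp add: norm_minus_commute)
    then have "norm x \<le> norm z + 1"
      using norm_triangle_ineq2[of x z] norm_minus_commute[of x z] by linarith
    then have "1 + norm x \<le> 2 + norm z" by simp
    also have "\<dots> \<le> 2 * (1 + norm z)" by simp
    finally have "1 + norm z \<ge> (1 + norm x) / 2" by simp
    then have "norm (grad \<psi> z) \<le> C / ((1 + norm x) / 2) ^ (CARD('n) + 2)"
      by (intro order_trans[OF grad_decay] divide_left_mono power_mono mult_pos_pos zero_less_power)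
        (use C_pos in auto)
    also have "\<dots> = C * 2 ^ (CARD('n) + 2) * (1 / (1 + norm x) ^ (CARD('n) + 2))"
      by (simp add: power_divide)
    also have "\<dots> \<le> C * 2 ^ (CARD('n) + 2) * decay_weight x"
      using C_pos by (intro mult_left_mono decay_weight_ge) auto
    finally have g: "norm (grad \<psi> z) \<le> C * 2 ^ (CARD('n) + 2) * decay_weight x" .
    show "onorm (frechet_derivative \<psi> (at z)) \<le> ?B"
    proof (rule onorm_bound)
      show "?B \<ge> 0" using C_pos by simp
      fix v :: "real ^ 'n"
      have "CARD('n) * norm (grad \<psi> z) * norm v \<le> CARD('n) * (C * 2 ^ (CARD('n) + 2) * decay_weight x) * norm v"
        using g by (intro mult_right_mono mult_left_mono) auto
      then show "norm (frechet_derivative \<psi> (at z) v) \<le> ?B * norm v"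
        using norm_frechet_derivative_le[of z v] by (simp add: algebra_simps)
    qed
  qed auto
  then show ?thesis by simp
qed

lemma nn_integral_psi_sqrt: "(\<integral>\<^sup>+x. ennreal (norm (\<psi> x) * sqrt (norm x)) \<partial>lborel) \<le> ennreal (C * decay_mass TYPE('n))"
proof -
  have "norm (\<psi> x) * sqrt (norm x) \<le> C * decay_weight x" for x
  proof -
    define r where "r = sqrt (1 + norm x)"
    have r: "r > 0" "1 + norm x = r * r" using one_plus_norm_pos[of x] by (auto simp: r_def)
    have "norm (\<psi> x) * sqrt (norm x) \<le> C / (1 + norm x) ^ (CARD('n) + 1) * r"
      unfolding r_def by (intro mult_mono decay) (use C_pos in auto)
    also have "\<dots> = C * decay_weight x"
      unfolding decay_weight_def r_def[symmetric] unfolding r(2) using r(1) by (simp add: power_mult_distrib)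
    finally show ?thesis .
  qed
  then have "(\<integral>\<^sup>+x. ennreal (norm (\<psi> x) * sqrt (norm x)) \<partial>lborel) \<le> (\<integral>\<^sup>+x. ennreal C * ennreal (decay_weight x) \<partial>(lborel :: (real ^ 'n) measure))"
    using C_pos by (intro nn_integral_mono) (auto simp: ennreal_mult[symmetric] less_imp_le intro!: ennreal_leI)
  also have "\<dots> = ennreal (C * decay_mass TYPE('n))"
    using C_pos by (simp add: nn_integral_cmult nn_integral_decay_weight ennreal_mult decay_mass_nonneg)
  finally show ?thesis .
qed

lemma nn_integral_psi: "(\<integral>\<^sup>+x. ennreal (norm (\<psi> x)) \<partial>lborel) \<le> ennreal (C * decay_mass TYPE('n))"
proof -
  have "norm (\<psi> x) \<le> C * decay_weight x" for x
  proof -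
    have "norm (\<psi> x) \<le> C * (1 / (1 + norm x) ^ (CARD('n) + 1))" using decay[of x] by simp
    also have "\<dots> \<le> C * decay_weight x" using C_pos by (intro mult_left_mono decay_weight_ge) auto
    finally show ?thesis .
  qed
  then have "(\<integral>\<^sup>+x. ennreal (norm (\<psi> x)) \<partial>lborel) \<le> (\<integral>\<^sup>+x. ennreal C * ennreal (decay_weight x) \<partial>(lborel :: (real ^ 'n) measure))"
    using C_pos by (intro nn_integral_mono) (auto simp: ennreal_mult[symmetric] less_imp_le intro!: ennreal_leI)
  also have "\<dots> = ennreal (C * decay_mass TYPE('n))"
    using C_pos by (simp add: nn_integral_cmult nn_integral_decay_weight ennreal_mult decay_mass_nonneg)
  finally show ?thesis .
qed

definition "C_diff = CARD('n) * C * 2 ^ (CARD('n) + 2) * decay_mass TYPE('n) + 2 * C * decay_mass TYPE('n)"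

lemma C_diff_nonneg: "C_diff \<ge> 0"
  using C_pos decay_mass_nonneg[where 'n = 'n] by (simp add: C_diff_def)

text \<open>Hoelder continuity of order 1/2 in \<open>L^1\<close>. Short translations use the
  gradient and \<open>norm w \<le> sqrt (norm w)\<close>; long ones only the triangle inequality,
  since then \<open>sqrt (norm w) \<ge> 1\<close>. The two terms of \<open>C_diff\<close> belong to
  these two cases.\<close>

lemma nn_integral_psi_diff:
  "(\<integral>\<^sup>+x. ennreal (norm (\<psi> (x + w) - \<psi> x)) \<partial>lborel) \<le> ennreal (C_diff * sqrt (norm w))"
proof (cases "norm w \<le> 1")
  case True
  let ?B = "CARD('n) * C * 2 ^ (CARD('n) + 2)"
  have B: "?B \<ge> 0" using C_pos by simp
  have "(\<integral>\<^sup>+x. ennreal (norm (\<psi> (x + w) - \<psi> x)) \<partial>lborel) \<le> (\<integral>\<^sup>+x. ennreal (?B * norm w) * ennreal (decay_weight x) \<partial>(lborel :: (real ^ 'n) measure))"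
  proof (rule nn_integral_mono)
    fix x
    have "ennreal (norm (\<psi> (x + w) - \<psi> x)) \<le> ennreal (?B * norm w * decay_weight x)"
      using norm_diff_near_le[OF True, of x] by (intro ennreal_leI) (simp add: mult_ac)
    also have "\<dots> = ennreal (?B * norm w) * ennreal (decay_weight x)"
      using B by (intro ennreal_mult) auto
    finally show "ennreal (norm (\<psi> (x + w) - \<psi> x)) \<le> ennreal (?B * norm w) * ennreal (decay_weight x)" .
  qed
  also have "\<dots> = ennreal (?B * norm w * decay_mass TYPE('n))"
    using B decay_mass_nonneg[where 'n = 'n] by (simp add: nn_integral_cmult nn_integral_decay_weight ennreal_mult)
  also have "\<dots> \<le> ennreal (C_diff * sqrt (norm w))"
  proof (rule ennreal_leI)
    have "norm w \<le> sqrt (norm w)" using True by (simp add: real_le_rsqrt power2_eq_square mult_left_le)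
    moreover have "?B * decay_mass TYPE('n) \<le> C_diff" using C_pos decay_mass_nonneg[where 'n = 'n] by (simp add: C_diff_def)
    ultimately have "?B * decay_mass TYPE('n) * norm w \<le> C_diff * sqrt (norm w)"
      using C_diff_nonneg by (intro mult_mono) auto
    then show "?B * norm w * decay_mass TYPE('n) \<le> C_diff * sqrt (norm w)" by (simp add: algebra_simps)
  qed
  finally show ?thesis .
next
  case False
  have "(\<integral>\<^sup>+x. ennreal (norm (\<psi> (x + w) - \<psi> x)) \<partial>lborel)
      \<le> (\<integral>\<^sup>+x. ennreal (norm (\<psi> (w + x))) + ennreal (norm (\<psi> x)) \<partial>lborel)"
    by (intro nn_integral_mono) (simp add: ennreal_plus[symmetric] add.commute[of w] norm_triangle_ineq4 ennreal_leI del: ennreal_plus)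
  also have "\<dots> = (\<integral>\<^sup>+x. ennreal (norm (\<psi> (w + x))) \<partial>lborel) + (\<integral>\<^sup>+x. ennreal (norm (\<psi> x)) \<partial>lborel)"
    by (rule nn_integral_add) auto
  also have "(\<integral>\<^sup>+x. ennreal (norm (\<psi> (w + x))) \<partial>lborel) = (\<integral>\<^sup>+x. ennreal (norm (\<psi> x)) \<partial>lborel)"
    by (rule nn_integral_lborel_shift(1)[where f = "\<lambda>x. ennreal (norm (\<psi> x))"]) simp
  also have "\<dots> + \<dots> \<le> ennreal (C * decay_mass TYPE('n)) + ennreal (C * decay_mass TYPE('n))" by (intro add_mono nn_integral_psi)
  also have "\<dots> = ennreal (2 * C * decay_mass TYPE('n))" using C_pos decay_mass_nonneg[where 'n = 'n] by (simp add: ennreal_plus[symmetric] del: ennreal_plus)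
  also have "\<dots> \<le> ennreal (C_diff * sqrt (norm w))"
  proof (rule ennreal_leI)
    have "2 * C * decay_mass TYPE('n) \<le> C_diff * 1" using C_pos decay_mass_nonneg[where 'n = 'n] by (simp add: C_diff_def)
    also have "\<dots> \<le> C_diff * sqrt (norm w)"
      using False C_diff_nonneg by (intro mult_left_mono) auto
    finally show "2 * C * decay_mass TYPE('n) \<le> C_diff * sqrt (norm w)" .
  qed
  finally show ?thesis .
qed

lemma dilate_measurable [measurable]:
  assumes [measurable]: "f \<in> borel_measurable M" "g \<in> borel_measurable M"
  shows "(\<lambda>x. dilate \<psi> (f x) (g x)) \<in> borel_measurable M"
  unfolding dilate_def by measurable

lemma nn_integral_dilate_norm:
  assumes "t > 0"
  shows "(\<integral>\<^sup>+x. ennreal (norm (dilate \<psi> t x)) \<partial>lborel) \<le> ennreal (C * decay_mass TYPE('n))"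
proof -
  have "(\<integral>\<^sup>+x. ennreal (norm (dilate \<psi> t x)) \<partial>lborel) = ennreal (t ^ CARD('n)) * (\<integral>\<^sup>+x. ennreal (norm (dilate \<psi> t (t *\<^sub>R x))) \<partial>lborel)"
    using nn_integral_lborel_affine[of "\<lambda>x. ennreal (norm (dilate \<psi> t x))" t 0] assms by simp
  also have "\<dots> = (\<integral>\<^sup>+x. ennreal (norm (\<psi> x)) \<partial>lborel)"
    by (subst nn_integral_cmult[symmetric])
      (use assms in \<open>auto simp: dilate_def ennreal_mult[symmetric] intro!: nn_integral_cong\<close>)
  finally show ?thesis using nn_integral_psi by simp
qed

lemma nn_integral_dilate_sqrt:
  assumes "t > 0"
  shows "(\<integral>\<^sup>+x. ennreal (norm (dilate \<psi> t x) * sqrt (norm x)) \<partial>lborel) \<le> ennreal (C * decay_mass TYPE('n) * sqrt t)"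
proof -
  have "(\<integral>\<^sup>+x. ennreal (norm (dilate \<psi> t x) * sqrt (norm x)) \<partial>lborel)
    = ennreal (t ^ CARD('n)) * (\<integral>\<^sup>+x. ennreal (norm (dilate \<psi> t (t *\<^sub>R x)) * sqrt (norm (t *\<^sub>R x))) \<partial>lborel)"
    using nn_integral_lborel_affine[of "\<lambda>x. ennreal (norm (dilate \<psi> t x) * sqrt (norm x))" t 0] assms by simp
  also have "\<dots> = (\<integral>\<^sup>+x. ennreal (sqrt t) * ennreal (norm (\<psi> x) * sqrt (norm x)) \<partial>lborel)"
    by (subst nn_integral_cmult[symmetric])
      (use assms in \<open>auto simp: dilate_def ennreal_mult[symmetric] real_sqrt_mult intro!: nn_integral_cong\<close>)
  also have "\<dots> = ennreal (sqrt t) * (\<integral>\<^sup>+x. ennreal (norm (\<psi> x) * sqrt (norm x)) \<partial>lborel)"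
    by (rule nn_integral_cmult) auto
  also have "\<dots> \<le> ennreal (sqrt t) * ennreal (C * decay_mass TYPE('n))"
    by (intro mult_left_mono nn_integral_psi_sqrt) auto
  also have "\<dots> = ennreal (C * decay_mass TYPE('n) * sqrt t)"
    using assms C_pos decay_mass_nonneg[where 'n = 'n] by (subst ennreal_mult[symmetric]) (auto simp: mult.commute)
  finally show ?thesis .
qed

lemma nn_integral_dilate_diff:
  assumes "t > 0"
  shows "(\<integral>\<^sup>+x. ennreal (norm (dilate \<psi> t (x + u) - dilate \<psi> t x)) \<partial>lborel) \<le> ennreal (C_diff * sqrt (norm u / t))"
proof -
  have "(\<integral>\<^sup>+x. ennreal (norm (dilate \<psi> t (x + u) - dilate \<psi> t x)) \<partial>lborel)
    = ennreal (t ^ CARD('n)) * (\<integral>\<^sup>+x. ennreal (norm (dilate \<psi> t (t *\<^sub>R x + u) - dilate \<psi> t (t *\<^sub>R x))) \<partial>lborel)"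
    using nn_integral_lborel_affine[of "\<lambda>x. ennreal (norm (dilate \<psi> t (x + u) - dilate \<psi> t x))" t 0] assms by simp
  also have "\<dots> = (\<integral>\<^sup>+x. ennreal (norm (\<psi> (x + u /\<^sub>R t) - \<psi> x)) \<partial>lborel)"
    by (subst nn_integral_cmult[symmetric])
      (use assms in \<open>auto simp: dilate_def ennreal_mult[symmetric] scaleR_right_distrib scaleR_right_diff_distrib[symmetric] intro!: nn_integral_cong\<close>)
  also have "\<dots> \<le> ennreal (C_diff * sqrt (norm (u /\<^sub>R t)))" by (rule nn_integral_psi_diff)
  also have "norm (u /\<^sub>R t) = norm u / t" using assms by (simp add: divide_inverse mult.commute)
  finally show ?thesis .
qed

lemma dilate_integrable:
  assumes "t > 0"
  shows "integrable lborel (\<lambda>y. dilate \<psi> t (x - y))"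
proof (rule integrableI_bounded)
  have "(\<integral>\<^sup>+y. ennreal (norm (dilate \<psi> t (x - y))) \<partial>lborel) = (\<integral>\<^sup>+y. ennreal (norm (dilate \<psi> t y)) \<partial>lborel)"
    by (rule nn_integral_lborel_shift(2)[where f = "\<lambda>y. ennreal (norm (dilate \<psi> t y))"]) simp
  also have "\<dots> < \<infinity>" using nn_integral_dilate_norm[OF assms] by (rule order_le_less_trans) simp
  finally show "(\<integral>\<^sup>+y. ennreal (norm (dilate \<psi> t (x - y))) \<partial>lborel) < \<infinity>" .
qed simp

lemma integral_dilate:
  assumes t: "t > 0"
  shows "(\<integral>y. dilate \<psi> t (x - y) \<partial>lborel) = 0"
proof -
  have "(\<integral>y. \<psi> y \<partial>lborel) = 0"
    using mean_zero by (simp add: integral_completion)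
  moreover have "(\<integral>y. dilate \<psi> t y \<partial>lborel) = \<bar>t\<bar> ^ DIM(real ^ 'n) *\<^sub>R (\<integral>y. \<psi> y /\<^sub>R t ^ CARD('n) \<partial>lborel)"
    using integral_lborel_affine[of "dilate \<psi> t" t 0] t by (simp add: dilate_def)
  moreover have "(\<integral>y. dilate \<psi> t y \<partial>lborel) = (\<integral>y. dilate \<psi> t (x - y) \<partial>lborel)"
    using integral_lborel_affine[of "dilate \<psi> t" "-1" x] by simp
  ultimately show ?thesis by simp
qed

text \<open>The majorant of \<open>pair_kernel\<close> obtained from the vanishing mean at scale
  \<open>s\<close>. It will be evaluated at \<open>x - x'\<close>, so integrating over either point
  gives the same value.\<close>

definition kernel_modulus :: "real \<Rightarrow> real \<Rightarrow> real ^ 'n \<Rightarrow> ennreal" where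
  "kernel_modulus t s z = (\<integral>\<^sup>+v. ennreal (norm (dilate \<psi> s v)) * ennreal (norm (dilate \<psi> t (z + v) - dilate \<psi> t z)) \<partial>lborel)"

lemma kernel_modulus_measurable [measurable]: "kernel_modulus t s \<in> borel_measurable borel"
  unfolding kernel_modulus_def by measurable

text \<open>By Tonelli, translation at scale \<open>t\<close> yields
  \<open>sqrt (norm v / t)\<close>, and the half moment at scale \<open>s\<close> turns
  \<open>sqrt (norm v)\<close> into \<open>sqrt s\<close>. This is a gain when \<open>s\<close> is
  the smaller scale.\<close>

lemma nn_integral_kernel_modulus:
  assumes "t > 0" "s > 0"
  shows "(\<integral>\<^sup>+z. kernel_modulus t s z \<partial>lborel) \<le> ennreal (C_diff * (C * decay_mass TYPE('n)) * sqrt (s / t))"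
proof -
  have "(\<integral>\<^sup>+z. kernel_modulus t s z \<partial>lborel)
    = (\<integral>\<^sup>+v. (\<integral>\<^sup>+z. ennreal (norm (dilate \<psi> s v)) * ennreal (norm (dilate \<psi> t (z + v) - dilate \<psi> t z)) \<partial>lborel) \<partial>lborel)"
    unfolding kernel_modulus_def by (rule lborel_pair.Fubini') measurable
  also have "\<dots> = (\<integral>\<^sup>+v. ennreal (norm (dilate \<psi> s v)) * (\<integral>\<^sup>+z. ennreal (norm (dilate \<psi> t (z + v) - dilate \<psi> t z)) \<partial>lborel) \<partial>lborel)"
    by (intro nn_integral_cong nn_integral_cmult) measurable
  also have "\<dots> \<le> (\<integral>\<^sup>+v. ennreal (norm (dilate \<psi> s v)) * ennreal (C_diff * sqrt (norm v / t)) \<partial>lborel)"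
    by (intro nn_integral_mono mult_left_mono nn_integral_dilate_diff assms) auto
  also have "\<dots> = (\<integral>\<^sup>+v. ennreal (C_diff / sqrt t) * ennreal (norm (dilate \<psi> s v) * sqrt (norm v)) \<partial>lborel)"
    using assms C_diff_nonneg
    by (intro nn_integral_cong) (simp add: ennreal_mult[symmetric] real_sqrt_divide mult.commute)
  also have "\<dots> = ennreal (C_diff / sqrt t) * (\<integral>\<^sup>+v. ennreal (norm (dilate \<psi> s v) * sqrt (norm v)) \<partial>lborel)"
    by (rule nn_integral_cmult) auto
  also have "\<dots> \<le> ennreal (C_diff / sqrt t) * ennreal (C * decay_mass TYPE('n) * sqrt s)"
    by (intro mult_left_mono nn_integral_dilate_sqrt assms) auto
  also have "\<dots> = ennreal (C_diff * (C * decay_mass TYPE('n)) * sqrt (s / t))"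
    using assms C_diff_nonneg C_pos decay_mass_nonneg[where 'n = 'n]
    by (subst ennreal_mult[symmetric]) (auto simp: real_sqrt_divide)
  finally show ?thesis .
qed

text \<open>The kernel of T composed with its adjoint, between the points \<open>(x, t)\<close> and
  \<open>(x', s)\<close>.\<close>

definition pair_kernel :: "real ^ 'n \<Rightarrow> real \<Rightarrow> real ^ 'n \<Rightarrow> real \<Rightarrow> complex" where
  "pair_kernel x t x' s = (\<integral>y. dilate \<psi> t (x - y) * cnj (dilate \<psi> s (x' - y)) \<partial>lborel)"

lemma dilate_bound:
  assumes "t > 0"
  shows "norm (dilate \<psi> t x) \<le> C / t ^ CARD('n)"
proof -
  have "norm (\<psi> z) \<le> C" for z
  proof -
    have "C / (1 + norm z) ^ (CARD('n) + 1) \<le> C / 1"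
      using C_pos by (intro divide_left_mono one_le_power) auto
    then show ?thesis using decay[of z] by simp
  qed
  then show ?thesis using assms by (simp add: dilate_def divide_inverse mult.commute[of C])
qed

text \<open>As the dilate at scale \<open>s\<close> has mean zero, the value \<open>?c\<close> of
  the other factor at \<open>y = x'\<close> may be subtracted from that factor; then substitute
  \<open>y = x' - v\<close>.\<close>

lemma norm_pair_kernel_le:
  assumes t: "t > 0" and s: "s > 0"
  shows "ennreal (norm (pair_kernel x t x' s)) \<le> kernel_modulus t s (x - x')"
proof -
  let ?p = "\<lambda>y. dilate \<psi> t (x - y)" and ?q = "\<lambda>y. dilate \<psi> s (x' - y)"
  let ?c = "dilate \<psi> t (x - x')"
  have int: "integrable lborel (\<lambda>y. ?p y * cnj (?q y))"
  proof (rule Bochner_Integration.integrable_bound)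
    show "integrable lborel (\<lambda>y. of_real (C / s ^ CARD('n)) * ?p y)"
      by (intro integrable_mult_right dilate_integrable t)
    show "AE y in lborel. norm (?p y * cnj (?q y)) \<le> norm (of_real (C / s ^ CARD('n)) * ?p y)"
    proof (intro AE_I2)
      fix y
      have "norm (?p y) * norm (?q y) \<le> norm (?p y) * (C / s ^ CARD('n))"
        by (intro mult_left_mono dilate_bound s) auto
      then show "norm (?p y * cnj (?q y)) \<le> norm (of_real (C / s ^ CARD('n)) * ?p y)"
        using C_pos s by (simp add: norm_mult norm_divide norm_power mult.commute)
    qed
  qed simp
  have q: "integrable lborel (\<lambda>y. cnj (?q y))" using dilate_integrable[OF s] by simp
  have "pair_kernel x t x' s = (\<integral>y. ?p y * cnj (?q y) \<partial>lborel) - (\<integral>y. ?c * cnj (?q y) \<partial>lborel)"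
    using integral_dilate[OF s] by (simp add: pair_kernel_def)
  also have "\<dots> = (\<integral>y. ?p y * cnj (?q y) - ?c * cnj (?q y) \<partial>lborel)"
    by (rule Bochner_Integration.integral_diff[symmetric, OF int integrable_mult_right[OF q]])
  finally have "pair_kernel x t x' s = (\<integral>y. (?p y - ?c) * cnj (?q y) \<partial>lborel)"
    by (simp add: algebra_simps)
  then have "ennreal (norm (pair_kernel x t x' s)) \<le> (\<integral>\<^sup>+y. norm ((?p y - ?c) * cnj (?q y)) \<partial>lborel)"
    using norm_integral_le_nn_integral by simp
  also have "\<dots> = (\<integral>\<^sup>+v. norm ((?p (x' - v) - ?c) * cnj (?q (x' - v))) \<partial>lborel)"
    by (rule nn_integral_lborel_shift(2)[symmetric, where f = "\<lambda>y. ennreal (norm ((?p y - ?c) * cnj (?q y)))"]) simp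
  also have "\<dots> = kernel_modulus t s (x - x')"
    unfolding kernel_modulus_def
    by (intro nn_integral_cong)
      (simp add: norm_mult ennreal_mult[symmetric] mult.commute[of "norm (dilate \<psi> s _)"] diff_diff_eq2 diff_add_eq)
  finally show ?thesis .
qed

text \<open>Cancellation at scale \<open>s\<close> gives the factor \<open>sqrt (s / t)\<close>.
  Hermitian symmetry moves the cancellation to scale \<open>t\<close> and gives
  \<open>sqrt (t / s)\<close>.\<close>

lemma nn_integral_pair_kernel_le:
  assumes t: "t > 0" and s: "s > 0"
  shows "(\<integral>\<^sup>+x'. ennreal (norm (pair_kernel x t x' s)) \<partial>lborel)
    \<le> ennreal (C_diff * (C * decay_mass TYPE('n)) * min (sqrt (s / t)) (sqrt (t / s)))"
proof -
  have "(\<integral>\<^sup>+x'. ennreal (norm (pair_kernel x t x' s)) \<partial>lborel) \<le> (\<integral>\<^sup>+x'. kernel_modulus t s (x - x') \<partial>lborel)"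
    by (intro nn_integral_mono norm_pair_kernel_le t s)
  also have "\<dots> = (\<integral>\<^sup>+z. kernel_modulus t s z \<partial>lborel)"
    by (rule nn_integral_lborel_shift) simp
  also have "\<dots> \<le> ennreal (C_diff * (C * decay_mass TYPE('n)) * sqrt (s / t))"
    by (rule nn_integral_kernel_modulus[OF t s])
  finally have 1: "(\<integral>\<^sup>+x'. ennreal (norm (pair_kernel x t x' s)) \<partial>lborel) \<le> \<dots>" .
  have "norm (pair_kernel x t x' s) = norm (pair_kernel x' s x t)" for x'
    unfolding pair_kernel_def by (rule norm_cnj_kernel_commute)
  then have "(\<integral>\<^sup>+x'. ennreal (norm (pair_kernel x t x' s)) \<partial>lborel) \<le> (\<integral>\<^sup>+x'. kernel_modulus s t (- x + x') \<partial>lborel)"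
    using norm_pair_kernel_le[OF s t] by (intro nn_integral_mono) simp
  also have "\<dots> = (\<integral>\<^sup>+z. kernel_modulus s t z \<partial>lborel)"
    by (rule nn_integral_lborel_shift) simp
  also have "\<dots> \<le> ennreal (C_diff * (C * decay_mass TYPE('n)) * sqrt (t / s))"
    by (rule nn_integral_kernel_modulus[OF s t])
  finally show ?thesis using 1 by (auto simp: min_def)
qed

end

section \<open>The local part\<close>

text \<open>The measure \<open>dx dt / t\<close> with heights cut off at \<open>\<epsilon>\<close>,
  which makes it finite as Schur's test demands. The cutoff sits in the density, so the measurable
  space remains the whole Borel product.\<close>

definition strip_measure :: "real ^ 'n \<Rightarrow> real \<Rightarrow> real \<Rightarrow> ((real ^ 'n) \<times> real) measure" where
  "strip_measure a l \<epsilon> = density (lborel \<Otimes>\<^sub>M lborel) (\<lambda>X. indicator (cube a l \<times> {\<epsilon>..l}) X * ennreal (1 / snd X))"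

lemma sets_strip_measure [measurable_cong]: "sets (strip_measure a l \<epsilon>) = sets (borel \<Otimes>\<^sub>M borel)"
  unfolding strip_measure_def by (simp cong: sets_pair_measure_cong)

lemma strip_sets [measurable]: "cube a l \<times> {\<epsilon>..l} \<in> sets (borel \<Otimes>\<^sub>M borel)"
  by (intro pair_measureI) auto

lemma nn_integral_strip_measure:
  assumes [measurable]: "F \<in> borel_measurable (borel \<Otimes>\<^sub>M borel)"
  shows "(\<integral>\<^sup>+X. F X \<partial>strip_measure a l \<epsilon>)
    = (\<integral>\<^sup>+s\<in>{\<epsilon>..l}. (ennreal (1 / s) * (\<integral>\<^sup>+x\<in>cube a l. F (x, s) \<partial>lborel)) \<partial>lborel)"
proof -
  have "(\<integral>\<^sup>+X. F X \<partial>strip_measure a l \<epsilon>)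
    = (\<integral>\<^sup>+X. indicator (cube a l \<times> {\<epsilon>..l}) X * ennreal (1 / snd X) * F X \<partial>(lborel \<Otimes>\<^sub>M lborel))"
    unfolding strip_measure_def by (rule nn_integral_density) measurable
  also have "\<dots> = (\<integral>\<^sup>+s. (\<integral>\<^sup>+x. indicator (cube a l \<times> {\<epsilon>..l}) (x, s) * ennreal (1 / s) * F (x, s) \<partial>lborel) \<partial>lborel)"
    by (subst lborel_pair.nn_integral_snd[symmetric]) (simp_all cong: measurable_cong_sets)
  also have "\<dots> = (\<integral>\<^sup>+s\<in>{\<epsilon>..l}. (ennreal (1 / s) * (\<integral>\<^sup>+x\<in>cube a l. F (x, s) \<partial>lborel)) \<partial>lborel)"
  proof (rule nn_integral_cong)
    fix s :: real
    have "(\<integral>\<^sup>+x. indicator (cube a l \<times> {\<epsilon>..l}) (x, s) * ennreal (1 / s) * F (x, s) \<partial>lborel)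
      = (\<integral>\<^sup>+x. (ennreal (1 / s) * indicator {\<epsilon>..l} s) * (F (x, s) * indicator (cube a l) x) \<partial>lborel)"
      by (intro nn_integral_cong) (auto simp: indicator_def)
    also have "\<dots> = (ennreal (1 / s) * indicator {\<epsilon>..l} s) * (\<integral>\<^sup>+x\<in>cube a l. F (x, s) \<partial>lborel)"
      by (rule nn_integral_cmult) measurable
    finally show "(\<integral>\<^sup>+x. indicator (cube a l \<times> {\<epsilon>..l}) (x, s) * ennreal (1 / s) * F (x, s) \<partial>lborel)
      = ennreal (1 / s) * (\<integral>\<^sup>+x\<in>cube a l. F (x, s) \<partial>lborel) * indicator {\<epsilon>..l} s"
      by (simp add: mult_ac)
  qed
  finally show ?thesis .
qed

lemma finite_strip_measure:
  fixes a :: "real ^ 'n"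
  assumes "\<epsilon> > 0"
  shows "finite_measure (strip_measure a l \<epsilon>)"
proof
  let ?M = "strip_measure a l \<epsilon>"
  have "emeasure ?M (space ?M) = (\<integral>\<^sup>+X. 1 \<partial>?M)" by simp
  also have "\<dots> = (\<integral>\<^sup>+s\<in>{\<epsilon>..l}. (ennreal (1 / s) * emeasure lborel (cube a l)) \<partial>lborel)"
    by (subst nn_integral_strip_measure) auto
  also have "\<dots> \<le> (\<integral>\<^sup>+s. (ennreal (1 / \<epsilon>) * emeasure lborel (cube a l)) * indicator {\<epsilon>..l} s \<partial>lborel)"
    using assms by (intro nn_integral_mono)
      (auto simp: indicator_def intro!: mult_right_mono ennreal_leI divide_left_mono)
  also have "\<dots> = (ennreal (1 / \<epsilon>) * emeasure lborel (cube a l)) * emeasure lborel {\<epsilon>..l}"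
    by (rule nn_integral_cmult_indicator) auto
  also have "\<dots> < \<infinity>"
    using emeasure_cube_finite[of a l] by (auto simp: ennreal_mult_less_top emeasure_lborel_Icc_eq)
  finally show "emeasure ?M (space ?M) \<noteq> \<infinity>" by simp
qed

text \<open>Dominated convergence along sequences. It supplies the continuous test function that
  \<open>john_nirenberg_dual\<close> asks for.\<close>

lemma continuous_on_integral_kernel:
  fixes k :: "'a \<Rightarrow> 'b::metric_space \<Rightarrow> complex"
  assumes "finite_measure M"
    and [measurable]: "\<And>y. (\<lambda>X. k X y) \<in> borel_measurable M" "g \<in> borel_measurable M"
    and k: "\<And>X. continuous_on UNIV (k X)" and kb: "\<And>X y. norm (k X y) \<le> B" and gb: "\<And>X. norm (g X) \<le> G"
  shows "continuous_on UNIV (\<lambda>y. \<integral>X. k X y * g X \<partial>M)"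
  unfolding continuous_on_sequentially comp_def
proof safe
  interpret finite_measure M by fact
  fix y :: "nat \<Rightarrow> 'b" and y0 assume y: "y \<longlonglongrightarrow> y0"
  show "(\<lambda>n. \<integral>X. k X (y n) * g X \<partial>M) \<longlonglongrightarrow> (\<integral>X. k X y0 * g X \<partial>M)"
  proof (rule integral_dominated_convergence[where w = "\<lambda>_. B * G"])
    have B: "B \<ge> 0" using kb norm_ge_zero order_trans by blast
    show "AE X in M. norm (k X (y n) * g X) \<le> B * G" for n
      using kb gb B by (auto simp: norm_mult intro!: mult_mono)
    show "AE X in M. (\<lambda>n. k X (y n) * g X) \<longlonglongrightarrow> k X y0 * g X"
    proof (intro AE_I2 tendsto_mult tendsto_const)
      fix X
      show "(\<lambda>n. k X (y n)) \<longlonglongrightarrow> k X y0"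
        using k[of X] y unfolding continuous_on_sequentially comp_def by blast
    qed
  qed auto
qed

context littlewood_paley_kernel
begin

text \<open>The 4 is the bound of \<open>nn_integral_scale_ratio_le\<close>. The summand 1 makes the
  constant strictly positive, since it later appears as a divisor.\<close>

definition "C_schur = 4 * (C_diff * (C * decay_mass TYPE('n))) + 1"

lemma C_schur_pos: "C_schur > 0"
  using C_diff_nonneg C_pos decay_mass_nonneg[where 'n = 'n] by (simp add: C_schur_def add_nonneg_pos)

lemma pair_kernel_measurable [measurable]: "(\<lambda>X. pair_kernel x t (fst X) (snd X)) \<in> borel_measurable (borel \<Otimes>\<^sub>M borel)"
proof -
  have "(\<lambda>X. \<integral>y. dilate \<psi> t (x - y) * cnj (dilate \<psi> (snd X) (fst X - y)) \<partial>lborel) \<in> borel_measurable ((borel :: (real ^ 'n) measure) \<Otimes>\<^sub>M borel)"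
    by (rule lborel.borel_measurable_lebesgue_integral) measurable
  then show ?thesis by (simp add: pair_kernel_def)
qed

text \<open>At each height the spatial integral is extended to the whole space, where almost
  orthogonality applies; the remaining integral over \<open>ds / s\<close> is bounded independently
  of \<open>\<epsilon>\<close> and \<open>l\<close>.\<close>

lemma schur_strip:
  assumes t: "t > 0" and "\<epsilon> > 0"
  shows "(\<integral>\<^sup>+X. ennreal (norm (pair_kernel x t (fst X) (snd X))) \<partial>strip_measure a l \<epsilon>) \<le> ennreal C_schur"
proof -
  let ?K = "C_diff * (C * decay_mass TYPE('n))"
  let ?m = "\<lambda>s. min (sqrt (s / t)) (sqrt (t / s))"
  have K: "?K \<ge> 0" using C_diff_nonneg C_pos decay_mass_nonneg[where 'n = 'n] by simp
  have "(\<integral>\<^sup>+X. ennreal (norm (pair_kernel x t (fst X) (snd X))) \<partial>strip_measure a l \<epsilon>)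
    = (\<integral>\<^sup>+s\<in>{\<epsilon>..l}. (ennreal (1 / s) * (\<integral>\<^sup>+x'\<in>cube a l. ennreal (norm (pair_kernel x t x' s)) \<partial>lborel)) \<partial>lborel)"
    by (subst nn_integral_strip_measure) auto
  also have "\<dots> \<le> (\<integral>\<^sup>+s. ennreal ?K * (ennreal (?m s / s) * indicator {\<epsilon>..l} s) \<partial>lborel)"
  proof (rule nn_integral_mono)
    fix s
    show "ennreal (1 / s) * (\<integral>\<^sup>+x'\<in>cube a l. ennreal (norm (pair_kernel x t x' s)) \<partial>lborel) * indicator {\<epsilon>..l} s
      \<le> ennreal ?K * (ennreal (?m s / s) * indicator {\<epsilon>..l} s)"
    proof (cases "s \<in> {\<epsilon>..l}")
      case True
      then have s: "s > 0" using \<open>\<epsilon> > 0\<close> by auto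
      have "(\<integral>\<^sup>+x'\<in>cube a l. ennreal (norm (pair_kernel x t x' s)) \<partial>lborel)
          \<le> (\<integral>\<^sup>+x'. ennreal (norm (pair_kernel x t x' s)) \<partial>lborel)"
        by (intro nn_integral_mono) (auto simp: indicator_def)
      also have "\<dots> \<le> ennreal (?K * ?m s)" by (rule nn_integral_pair_kernel_le[OF t s])
      finally have "ennreal (1 / s) * (\<integral>\<^sup>+x'\<in>cube a l. ennreal (norm (pair_kernel x t x' s)) \<partial>lborel) \<le> ennreal (1 / s) * ennreal (?K * ?m s)"
        by (intro mult_left_mono) auto
      also have "\<dots> = ennreal ?K * ennreal (?m s / s)"
      proof -
        have "?m s \<ge> 0" using s t by simp
        then show ?thesis using s K by (simp add: ennreal_mult[symmetric] del: min_less_iff_conj)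
      qed
      finally show ?thesis using True by simp
    qed simp
  qed
  also have "\<dots> = ennreal ?K * (\<integral>\<^sup>+s\<in>{\<epsilon>..l}. ennreal (?m s / s) \<partial>lborel)"
    by (rule nn_integral_cmult) auto
  also have "\<dots> \<le> ennreal ?K * 4"
    by (intro mult_left_mono nn_integral_scale_ratio_le t \<open>\<epsilon> > 0\<close>) auto
  also have "\<dots> = ennreal (?K * 4)" using K by (simp add: ennreal_mult)
  also have "\<dots> \<le> ennreal C_schur" using K by (intro ennreal_leI) (simp add: C_schur_def)
  finally show ?thesis .
qed

definition local_convolution :: "(real ^ 'n \<Rightarrow> complex) \<Rightarrow> real ^ 'n \<Rightarrow> real \<Rightarrow> real ^ 'n \<Rightarrow> real \<Rightarrow> complex" where
  "local_convolution f b r x t = (\<integral>y. dilate \<psi> t (x - y) * (indicator (cube b r) y *\<^sub>R (f y - cube_average f b r)) \<partial>lborel)"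

lemma local_convolution_measurable [measurable]:
  assumes [measurable]: "f \<in> borel_measurable borel"
  shows "(\<lambda>X. local_convolution f b r (fst X) (snd X)) \<in> borel_measurable (borel \<Otimes>\<^sub>M borel)"
proof -
  have "(\<lambda>X. \<integral>y. dilate \<psi> (snd X) (fst X - y) * (indicator (cube b r) y *\<^sub>R (f y - cube_average f b r)) \<partial>lborel)
      \<in> borel_measurable ((borel :: (real ^ 'n) measure) \<Otimes>\<^sub>M borel)"
    by (rule lborel.borel_measurable_lebesgue_integral) measurable
  then show ?thesis by (simp add: local_convolution_def)
qed

lemma local_convolution_slice_measurable [measurable]:
  assumes "f \<in> borel_measurable borel"
  shows "(\<lambda>x. local_convolution f b r x t) \<in> borel_measurable borel"
  using measurable_compose[OF measurable_Pair2'[of t borel borel] local_convolution_measurable[OF assms]] by simp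

lemma dilate_continuous: "continuous_on UNIV (dilate \<psi> t)"
proof -
  have "continuous_on UNIV (\<lambda>x. \<psi> (x /\<^sub>R t))"
    by (rule continuous_on_compose2[OF psi_continuous]) (auto intro!: continuous_intros)
  then show ?thesis unfolding dilate_def by (intro continuous_intros)
qed

text \<open>With \<open>g\<close> the conjugate of the local convolution on the strip and
  \<open>h\<close> its image under the transposed kernel, the square integral \<open>I\<close>
  equals the integral of \<open>F * h\<close>. The dual John--Nirenberg inequality bounds this by an
  oscillation term and the square integral of \<open>h\<close>, and Schur's test returns the latter
  to \<open>I\<close>.\<close>

lemma local_square_estimate:
  assumes f [measurable]: "f \<in> borel_measurable borel" and int: "cube_integrable f"
    and \<Omega>: "\<Omega> > 0" and osc: "\<And>a' l'. 0 < l' \<Longrightarrow> l' \<le> r \<Longrightarrow> cube_oscillation f a' l' \<le> \<Omega>"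
    and r: "r > 0" and \<epsilon>: "\<epsilon> > 0"
  shows "(\<integral>\<^sup>+X. ennreal ((norm (local_convolution f b r (fst X) (snd X)))\<^sup>2) \<partial>strip_measure a l \<epsilon>)
    \<le> ennreal (C_schur * (jn_const CARD('n) * \<Omega>\<^sup>2) * r ^ CARD('n))"
proof -
  define M where "M = strip_measure a l \<epsilon>"
  have sets_M [measurable_cong]: "sets M = sets (borel \<Otimes>\<^sub>M borel)" by (simp add: M_def sets_strip_measure)
  interpret M: finite_measure M unfolding M_def by (rule finite_strip_measure[OF \<epsilon>])
  interpret P: pair_sigma_finite M lborel ..
  define S where "S = cube a l \<times> {\<epsilon>..l}"
  have [measurable]: "S \<in> sets (borel \<Otimes>\<^sub>M borel)" by (simp add: S_def)
  define F where "F y = indicator (cube b r) y *\<^sub>R (f y - cube_average f b r)" for y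
  have F [measurable]: "F \<in> borel_measurable borel" unfolding F_def by measurable
  have intF: "integrable lborel F"
  proof -
    have "set_integrable lborel (cube b r) (\<lambda>y. f y - cube_average f b r)"
      using cube_integrable_diff[OF int cube_integrable_const] unfolding cube_integrable_def by blast
    then show ?thesis by (simp add: set_integrable_def F_def[abs_def])
  qed
  define u where "u X = local_convolution f b r (fst X) (snd X)" for X
  have u [measurable]: "u \<in> borel_measurable (borel \<Otimes>\<^sub>M borel)" unfolding u_def by measurable
  define k where "k X y = indicator S X *\<^sub>R dilate \<psi> (snd X) (fst X - y)" for X y
  have k [measurable]: "case_prod k \<in> borel_measurable (M \<Otimes>\<^sub>M lborel)"
    unfolding k_def case_prod_unfold by measurable
  \<comment> \<open>The first summand bounds \<open>k\<close> pointwise, the second its integral in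
    \<open>y\<close>. The bound deteriorates as \<open>\<epsilon>\<close> decreases, but it only
    serves the exchange of integrals.\<close>
  define B where "B = C / \<epsilon> ^ CARD('n) + C * decay_mass TYPE('n)"
  have B_nonneg: "C / \<epsilon> ^ CARD('n) \<ge> 0" "C * decay_mass TYPE('n) \<ge> 0"
    using C_pos \<epsilon> decay_mass_nonneg[where 'n = 'n] by auto
  have kb: "norm (k X y) \<le> B" for X y
  proof (cases "X \<in> S")
    case True
    then have t: "snd X \<ge> \<epsilon>" by (auto simp: S_def)
    have "norm (dilate \<psi> (snd X) (fst X - y)) \<le> C / snd X ^ CARD('n)"
      using t \<epsilon> by (intro dilate_bound) auto
    also have "\<dots> \<le> C / \<epsilon> ^ CARD('n)"
      using t \<epsilon> C_pos by (intro divide_left_mono power_mono mult_pos_pos zero_less_power) auto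
    finally show ?thesis using True B_nonneg by (simp add: k_def B_def)
  qed (use B_nonneg in \<open>simp add: k_def B_def\<close>)
  have k1: "(\<integral>\<^sup>+y. norm (k X y) \<partial>lborel) \<le> ennreal B" for X
  proof (cases "X \<in> S")
    case True
    then have t: "snd X > 0" using \<epsilon> by (auto simp: S_def)
    have "(\<integral>\<^sup>+y. norm (k X y) \<partial>lborel) = (\<integral>\<^sup>+y. ennreal (norm (dilate \<psi> (snd X) (fst X - y))) \<partial>lborel)"
      using True by (simp add: k_def)
    also have "\<dots> = (\<integral>\<^sup>+y. ennreal (norm (dilate \<psi> (snd X) y)) \<partial>lborel)"
      by (rule nn_integral_lborel_shift(2)[where f = "\<lambda>y. ennreal (norm (dilate \<psi> (snd X) y))"]) simp
    also have "\<dots> \<le> ennreal (C * decay_mass TYPE('n))" by (rule nn_integral_dilate_norm[OF t])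
    also have "\<dots> \<le> ennreal B" using B_nonneg by (intro ennreal_leI) (simp add: B_def)
    finally show ?thesis .
  qed (simp add: k_def)
  have schur: "(\<integral>\<^sup>+X'. norm (\<integral>y. k X y * cnj (k X' y) \<partial>lborel) \<partial>M) \<le> ennreal C_schur" for X
  proof (cases "X \<in> S")
    case True
    then have t: "snd X > 0" using \<epsilon> by (auto simp: S_def)
    have "(\<integral>\<^sup>+X'. norm (\<integral>y. k X y * cnj (k X' y) \<partial>lborel) \<partial>M)
      \<le> (\<integral>\<^sup>+X'. ennreal (norm (pair_kernel (fst X) (snd X) (fst X') (snd X'))) \<partial>M)"
      using True by (intro nn_integral_mono) (auto simp: k_def pair_kernel_def indicator_def)
    also have "\<dots> \<le> ennreal C_schur" unfolding M_def by (rule schur_strip[OF t \<epsilon>])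
    finally show ?thesis .
  qed (simp add: k_def)
  define g where "g X = indicator S X *\<^sub>R cnj (u X)" for X
  have g [measurable]: "g \<in> borel_measurable M" unfolding g_def by measurable
  define G where "G = B * (\<integral>y. norm (F y) \<partial>lborel)"
  have u_eq: "indicator S X *\<^sub>R u X = (\<integral>y. k X y * F y \<partial>lborel)" for X
    by (cases "X \<in> S") (auto simp: u_def local_convolution_def k_def F_def)
  have gb: "norm (g X) \<le> G" for X
  proof -
    have "norm (g X) = norm (indicator S X *\<^sub>R u X)" by (simp add: g_def)
    also have "\<dots> \<le> (\<integral>y. B * norm (F y) \<partial>lborel)"
      unfolding u_eq
    proof (rule order_trans[OF integral_norm_bound integral_mono'])
      show "0 \<le> B * norm (F y)" for y using B_nonneg by (simp add: B_def)
    qed (use intF in \<open>auto simp: norm_mult mult_right_mono[OF kb]\<close>)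
    finally show ?thesis by (simp add: G_def)
  qed
  define h where "h y = (\<integral>X. k X y * g X \<partial>M)" for y
  define I where "I = (\<integral>X. (norm (g X))\<^sup>2 \<partial>M)"
  note schur' = schur_test_square[OF M.finite_measure_axioms lborel.sigma_finite_measure_axioms k g kb k1 gb
      less_imp_le[OF C_schur_pos] schur]
  have h2: "integrable lborel (\<lambda>y. (norm (h y))\<^sup>2)" "(\<integral>y. (norm (h y))\<^sup>2 \<partial>lborel) \<le> C_schur * I"
    using schur' by (simp_all add: h_def I_def)
  have h_cont: "continuous_on UNIV h"
    unfolding h_def
  proof (rule continuous_on_integral_kernel[OF M.finite_measure_axioms _ g _ kb gb])
    show "continuous_on UNIV (k X)" for X
      unfolding k_def
      by (intro continuous_intros continuous_on_compose2[OF dilate_continuous]) auto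
  qed measurable
  \<comment> \<open>Since \<open>g\<close> is bounded and \<open>M\<close> finite, the square
    integral is finite and really equals \<open>I\<close>, so that half of it may be
    subtracted.\<close>
  have g2: "integrable M (\<lambda>X. (norm (g X))\<^sup>2)"
    using gb by (intro M.integrable_const_bound[where B = "G\<^sup>2"]) (auto intro!: power_mono)
  have "complex_of_real I = (\<integral>X. complex_of_real ((norm (g X))\<^sup>2) \<partial>M)"
    unfolding I_def by (rule integral_complex_of_real[symmetric])
  also have "\<dots> = (\<integral>X. (\<integral>y. k X y * F y * g X \<partial>lborel) \<partial>M)"
  proof (intro Bochner_Integration.integral_cong refl)
    fix X
    have "complex_of_real ((norm (g X))\<^sup>2) = (indicator S X *\<^sub>R u X) * g X"
      by (auto simp: g_def indicator_def complex_norm_square simp del: of_real_power)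
    also have "\<dots> = (\<integral>y. k X y * F y * g X \<partial>lborel)" unfolding u_eq by simp
    finally show "complex_of_real ((norm (g X))\<^sup>2) = (\<integral>y. k X y * F y * g X \<partial>lborel)" .
  qed
  also have "\<dots> = (\<integral>y. (\<integral>X. k X y * F y * g X \<partial>M) \<partial>lborel)"
  proof (rule P.Fubini_integral[symmetric], rule Bochner_Integration.integrable_bound)
    show "integrable (M \<Otimes>\<^sub>M lborel) (\<lambda>(X, y). of_real (B * G) * F y)"
    proof (rule P.Fubini_integrable)
      show "(\<lambda>(X, y). of_real (B * G) * F y) \<in> borel_measurable (M \<Otimes>\<^sub>M lborel)" by measurable
    qed (use intF in auto)
    show "AE z in M \<Otimes>\<^sub>M lborel. norm (case z of (X, y) \<Rightarrow> k X y * F y * g X) \<le> norm (case z of (X, y) \<Rightarrow> complex_of_real (B * G) * F y)"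
    proof (intro AE_I2, clarify)
      fix X y
      have "norm (k X y) * norm (F y) * norm (g X) \<le> B * norm (F y) * G"
        using kb gb B_nonneg by (intro mult_mono mult_nonneg_nonneg) (auto simp: B_def)
      also have "\<dots> = (B * G) * norm (F y)" by simp
      also have "\<dots> \<le> \<bar>B * G\<bar> * norm (F y)" by (rule mult_right_mono) auto
      finally show "norm (k X y * F y * g X) \<le> norm (complex_of_real (B * G) * F y)"
        by (simp only: norm_mult norm_of_real)
    qed
  qed measurable
  also have "\<dots> = (\<integral>y. F y * h y \<partial>lborel)"
    unfolding h_def
    by (intro Bochner_Integration.integral_cong refl, subst integral_mult_right_zero[symmetric])
      (simp add: mult_ac)
  also have "\<dots> = r ^ CARD('n) *\<^sub>R cube_average (\<lambda>x. (f x - cube_average f b r) * h x) b r"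
    using r by (simp add: cube_average_def set_lebesgue_integral_def F_def)
  finally have "norm (complex_of_real I) = r ^ CARD('n) * norm (cube_average (\<lambda>x. (f x - cube_average f b r) * h x) b r)"
    using r by simp
  moreover have "I \<ge> 0" by (simp add: I_def)
  ultimately have "I = r ^ CARD('n) * norm (cube_average (\<lambda>x. (f x - cube_average f b r) * h x) b r)" by simp
  \<comment> \<open>The weight \<open>C_schur\<close> is chosen so that the term with \<open>h\<close> becomes \<open>I / 2\<close> and can be absorbed.\<close>
  also have "\<dots> \<le> r ^ CARD('n) * ((C_schur * (jn_const CARD('n) * \<Omega>\<^sup>2) + cube_average (\<lambda>x. (norm (h x))\<^sup>2) b r / C_schur) / 2)"
    using r by (intro mult_left_mono john_nirenberg_dual[OF int \<Omega> osc r h_cont C_schur_pos]) auto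
  also have "cube_average (\<lambda>x. (norm (h x))\<^sup>2) b r \<le> C_schur * I / r ^ CARD('n)"
  proof -
    have "(LINT x:cube b r|lborel. (norm (h x))\<^sup>2) \<le> (\<integral>y. (norm (h y))\<^sup>2 \<partial>lborel)"
      unfolding set_lebesgue_integral_def using h2
      by (intro integral_mono integrable_mult_indicator) (auto simp: indicator_def)
    then have "(LINT x:cube b r|lborel. (norm (h x))\<^sup>2) \<le> C_schur * I" using h2 by simp
    then show ?thesis using r by (simp add: cube_average_def divide_simps mult_ac)
  qed
  also have "r ^ CARD('n) * ((C_schur * (jn_const CARD('n) * \<Omega>\<^sup>2) + C_schur * I / r ^ CARD('n) / C_schur) / 2)
      = (C_schur * (jn_const CARD('n) * \<Omega>\<^sup>2) * r ^ CARD('n) + I) / 2"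
    using r C_schur_pos by (simp add: field_simps)
  finally have I: "I \<le> C_schur * (jn_const CARD('n) * \<Omega>\<^sup>2) * r ^ CARD('n)"
    using r C_schur_pos by (simp add: divide_right_mono)
  \<comment> \<open>Off \<open>S\<close> the function \<open>g\<close> is 0 while \<open>u\<close>
    need not be, but \<open>M\<close> does not charge that set.\<close>
  have "AE X in M. X \<in> S"
    unfolding M_def strip_measure_def S_def
    by (subst AE_density) (auto simp: indicator_def)
  then have "(\<integral>\<^sup>+X. ennreal ((norm (u X))\<^sup>2) \<partial>M) = (\<integral>\<^sup>+X. ennreal ((norm (g X))\<^sup>2) \<partial>M)"
    by (intro nn_integral_cong_AE) (auto simp: g_def)
  also have "\<dots> = ennreal I"
    unfolding I_def using g2 by (intro nn_integral_eq_integral) auto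
  finally show ?thesis using I by (simp add: u_def M_def ennreal_leI)
qed

end

section \<open>The far part\<close>

text \<open>The corner of the dilate about the centre by the factor \<open>3 * 2 ^ k\<close>. The 3
  leaves a margin of \<open>(3 * 2 ^ k - 1) / 2 * l\<close>, at least \<open>2 ^ k * l\<close>,
  around \<open>cube a l\<close>.\<close>

definition concentric_corner :: "real ^ 'n \<Rightarrow> real \<Rightarrow> nat \<Rightarrow> real ^ 'n" where
  "concentric_corner a l k = (\<chi> i. a $ i - (3 * 2 ^ k - 1) / 2 * l)"

abbreviation concentric_side :: "real \<Rightarrow> nat \<Rightarrow> real" where
  "concentric_side l k \<equiv> 3 * 2 ^ k * l"

abbreviation concentric_cube :: "real ^ 'n \<Rightarrow> real \<Rightarrow> nat \<Rightarrow> (real ^ 'n) set" where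
  "concentric_cube a l k \<equiv> cube (concentric_corner a l k) (concentric_side l k)"

lemma mem_concentric_cube:
  "x \<in> concentric_cube a l k \<longleftrightarrow>
    (\<forall>i. a $ i - (3 * 2 ^ k - 1) / 2 * l \<le> x $ i \<and> x $ i \<le> a $ i + (3 * 2 ^ k + 1) / 2 * l)"
  by (simp add: mem_cube concentric_corner_def field_simps)

lemma concentric_cube_Suc_subset:
  assumes "l > 0"
  shows "concentric_cube a l k \<subseteq> concentric_cube a l (Suc k)"
proof
  fix x assume x: "x \<in> concentric_cube a l k"
  have "(3 * 2 ^ k - 1) / 2 * l \<le> (3 * 2 ^ Suc k - 1) / 2 * l" "(3 * 2 ^ k + 1) / 2 * l \<le> (3 * 2 ^ Suc k + 1) / 2 * l"
    using assms by (auto intro!: mult_right_mono)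
  then show "x \<in> concentric_cube a l (Suc k)"
    using x unfolding mem_concentric_cube by (meson add_left_mono diff_left_mono order_trans)
qed

lemma concentric_cubes_exhaust:
  assumes "l > 0"
  shows "\<exists>k. y \<in> concentric_cube a l k"
proof -
  obtain k where k: "norm (y - a) / l < 2 ^ k"
    using real_arch_pow[of 2 "norm (y - a) / l"] by auto
  have "\<bar>y $ i - a $ i\<bar> \<le> 2 ^ k * l" for i
    using component_le_norm_cart[of "y - a" i] k assms by (simp add: field_simps)
  moreover have "2 ^ k * l \<le> (3 * 2 ^ k - 1) / 2 * l" "2 ^ k * l \<le> (3 * 2 ^ k + 1) / 2 * l"
    using assms by (auto intro!: mult_right_mono)
  ultimately have "y \<in> concentric_cube a l k"
    unfolding mem_concentric_cube by (smt (verit))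
  then show ?thesis by blast
qed

lemma norm_diff_ge_outside_concentric_cube:
  fixes x y :: "real ^ 'n"
  assumes "l > 0" "x \<in> cube a l" "y \<notin> concentric_cube a l k"
  shows "2 ^ k * l \<le> norm (x - y)"
proof -
  obtain i where i: "y $ i < a $ i - (3 * 2 ^ k - 1) / 2 * l \<or> a $ i + (3 * 2 ^ k + 1) / 2 * l < y $ i"
    using assms(3) unfolding mem_concentric_cube by (auto simp: not_le)
  have "2 ^ k * l \<le> (3 * 2 ^ k - 1) / 2 * l" using assms by (auto intro!: mult_right_mono)
  moreover have "(3 * 2 ^ k + 1) / 2 * l = (3 * 2 ^ k - 1) / 2 * l + l" by (simp add: field_simps)
  moreover have "a $ i \<le> x $ i" "x $ i \<le> a $ i + l" using assms(2) by (auto simp: mem_cube)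
  ultimately have "2 ^ k * l \<le> \<bar>x $ i - y $ i\<bar>" using i by linarith
  also have "\<dots> \<le> norm (x - y)" using component_le_norm_cart[of "x - y" i] by simp
  finally show ?thesis .
qed

lemma outside_concentric_cube_shell:
  assumes l: "l > 0" and y: "y \<notin> concentric_cube a l 0"
  shows "\<exists>k. y \<notin> concentric_cube a l k \<and> y \<in> concentric_cube a l (Suc k)"
proof -
  define m where "m = (LEAST m. y \<in> concentric_cube a l m)"
  have m: "y \<in> concentric_cube a l m"
    unfolding m_def using concentric_cubes_exhaust[OF l, of y a] by (rule LeastI_ex)
  then have "m \<noteq> 0" using y by metis
  then obtain k where k: "m = Suc k" using not0_implies_Suc by blast
  have "y \<notin> concentric_cube a l k" using not_less_Least[of k "\<lambda>m. y \<in> concentric_cube a l m"] k by (simp add: m_def)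
  then show ?thesis using m k by blast
qed

text \<open>Telescoping through the dilates: each doubling moves the average by at most
  \<open>2 ^ CARD('n) * R\<close>, and one oscillation at the last scale is added. The growth is
  linear in \<open>k\<close>, harmless against the geometric decay of the kernel.\<close>

lemma concentric_average_bound:
  fixes f :: "real ^ 'n \<Rightarrow> complex"
  assumes f: "cube_integrable f" and l: "l > 0"
    and osc: "\<And>j. j \<le> k \<Longrightarrow> cube_oscillation f (concentric_corner a l j) (concentric_side l j) \<le> R"
  defines "c \<equiv> cube_average f (concentric_corner a l 0) (concentric_side l 0)"
  shows "cube_average (\<lambda>y. norm (f y - c)) (concentric_corner a l k) (concentric_side l k) \<le> (1 + real k * 2 ^ CARD('n)) * R"
proof -
  let ?A = "\<lambda>j. cube_average f (concentric_corner a l j) (concentric_side l j)"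
  have drift: "norm (?A j - c) \<le> j * (2 ^ CARD('n) * R)" if "j \<le> k" for j
    using that
  proof (induction j)
    case (Suc j)
    have "norm (?A j - ?A (Suc j)) \<le> (concentric_side l (Suc j) / concentric_side l j) ^ CARD('n)
        * cube_oscillation f (concentric_corner a l (Suc j)) (concentric_side l (Suc j))"
      by (rule norm_subcube_average_diff_le[OF f _ _ concentric_cube_Suc_subset]) (use l in auto)
    also have "\<dots> \<le> 2 ^ CARD('n) * R"
      using osc[of "Suc j"] Suc.prems l by (auto intro!: mult_left_mono)
    finally have "norm (?A (Suc j) - ?A j) \<le> 2 ^ CARD('n) * R" by (simp add: norm_minus_commute)
    moreover have "norm (?A (Suc j) - c) \<le> norm (?A (Suc j) - ?A j) + norm (?A j - c)"
      using norm_triangle_ineq[of "?A (Suc j) - ?A j" "?A j - c"] by simp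
    ultimately show ?case using Suc by (simp add: algebra_simps)
  qed (simp add: c_def)
  let ?a = "concentric_corner a l k" and ?r = "concentric_side l k"
  have r: "?r > 0" using l by simp
  have int: "cube_integrable (\<lambda>y. norm (f y - d))" for d
    by (intro cube_integrable_norm cube_integrable_diff f cube_integrable_const)
  have "cube_average (\<lambda>y. norm (f y - c)) ?a ?r \<le> cube_average (\<lambda>y. norm (f y - ?A k) + norm (?A k - c)) ?a ?r"
  proof (rule cube_average_mono[OF int cube_integrable_add[OF int cube_integrable_const] r])
    show "norm (f x - c) \<le> norm (f x - ?A k) + norm (?A k - c)" for x
      using norm_triangle_ineq[of "f x - ?A k" "?A k - c"] by simp
  qed
  also have "\<dots> = cube_oscillation f ?a ?r + norm (?A k - c)"
    using r by (simp add: cube_average_add[OF int cube_integrable_const] cube_oscillation_def)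
  also have "\<dots> \<le> R + k * (2 ^ CARD('n) * R)" by (intro add_mono osc drift) auto
  finally show ?thesis by (simp add: algebra_simps)
qed

text \<open>The share of the shell between dilates \<open>k\<close> and \<open>k + 1\<close>. The
  numerator is the growth of averages at dilate \<open>k + 1\<close>; the divisor
  \<open>2 ^ k\<close> is the one power of kernel decay left after the volume has cancelled the
  others.\<close>

definition far_weight :: "nat \<Rightarrow> nat \<Rightarrow> real" where
  "far_weight n k = (1 + real (k + 1) * 2 ^ n) / 2 ^ k"

lemma summable_far_weight: "summable (far_weight n)"
proof -
  have "summable (\<lambda>k. (1 / 2) ^ k + 2 ^ n * (of_nat (Suc k) * (1 / 2 :: real) ^ k))"
    by (intro summable_add summable_mult sums_summable[OF geometric_deriv_sums] summable_geometric) auto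
  moreover have "far_weight n = (\<lambda>k. (1 / 2) ^ k + 2 ^ n * (of_nat (Suc k) * (1 / 2) ^ k))"
    by (rule ext) (simp add: far_weight_def power_divide field_simps)
  ultimately show ?thesis by simp
qed

lemma far_weight_nonneg: "far_weight n k \<ge> 0"
  by (simp add: far_weight_def)

definition far_tail :: "nat \<Rightarrow> nat \<Rightarrow> real" where
  "far_tail n m = (\<Sum>k. far_weight n (k + m))"

lemma far_tail_nonneg: "far_tail n m \<ge> 0"
  unfolding far_tail_def by (intro suminf_nonneg summable_ignore_initial_segment summable_far_weight far_weight_nonneg)

lemma far_tail_tendsto_0: "far_tail n \<longlonglongrightarrow> 0"
proof -
  have "(\<lambda>m. suminf (far_weight n) - (\<Sum>k<m. far_weight n k)) \<longlonglongrightarrow> suminf (far_weight n) - suminf (far_weight n)"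
    by (intro tendsto_intros summable_LIMSEQ summable_far_weight)
  then show ?thesis
    unfolding far_tail_def[abs_def] by (simp add: suminf_minus_initial_segment summable_far_weight)
qed

text \<open>\<open>X\<close> is charged on every shell, \<open>Y\<close> only from shell
  \<open>m\<close> on. Adding the two, rather than choosing between them, keeps the series
  separate.\<close>

lemma far_weight_split_sums:
  assumes "X \<ge> 0" "Y \<ge> 0"
  shows "(\<lambda>k. far_weight n k * (X + (if k < m then 0 else Y))) sums (far_tail n 0 * X + far_tail n m * Y)"
proof -
  have 1: "(\<lambda>k. far_weight n k * X) sums (far_tail n 0 * X)"
    unfolding far_tail_def using summable_far_weight by (simp add: sums_mult2 summable_sums)
  have "(\<lambda>k. far_weight n (k + m) * Y) sums (far_tail n m * Y)"
    unfolding far_tail_def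
    by (intro sums_mult2 summable_sums summable_ignore_initial_segment summable_far_weight)
  then have "(\<lambda>k. (\<lambda>k. far_weight n k * (if k < m then 0 else Y)) (k + m)) sums (far_tail n m * Y)" by simp
  then have "(\<lambda>k. far_weight n k * (if k < m then 0 else Y)) sums (far_tail n m * Y)"
    by (subst (asm) sums_iff_shift) simp
  from sums_add[OF 1 this] show ?thesis by (simp add: algebra_simps)
qed

section \<open>Decay of the kernel against the shells\<close>

context littlewood_paley_kernel
begin

text \<open>The decay exceeds the normalisation of the dilate by one power, which leaves a factor
  \<open>t\<close>. It later tames the singular weight \<open>dt / t\<close>.\<close>

lemma dilate_far_bound:
  assumes "t > 0" "d > 0" "d \<le> norm z"
  shows "norm (dilate \<psi> t z) \<le> C * t / d ^ (CARD('n) + 1)"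
proof -
  have "norm (\<psi> (z /\<^sub>R t)) \<le> C / (1 + norm (z /\<^sub>R t)) ^ (CARD('n) + 1)" by (rule decay)
  also have "\<dots> \<le> C / (d / t) ^ (CARD('n) + 1)"
  proof (intro divide_left_mono power_mono mult_pos_pos zero_less_power one_plus_norm_pos)
    have "d / t \<le> norm z / t" using assms by (intro divide_right_mono) auto
    also have "\<dots> = norm (z /\<^sub>R t)" using assms by (simp add: divide_inverse mult.commute)
    finally show "d / t \<le> 1 + norm (z /\<^sub>R t)" by simp
  qed (use assms C_pos in auto)
  also have "\<dots> = C * t ^ (CARD('n) + 1) / d ^ (CARD('n) + 1)"
    using assms by (simp add: power_divide)
  finally have "norm (\<psi> (z /\<^sub>R t)) / t ^ CARD('n) \<le> C * t ^ (CARD('n) + 1) / d ^ (CARD('n) + 1) / t ^ CARD('n)"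
    using assms by (intro divide_right_mono) auto
  also have "\<dots> = C * t / d ^ (CARD('n) + 1)" using assms by simp
  finally show ?thesis using assms by (simp add: dilate_def divide_inverse mult.commute)
qed

text \<open>On shell \<open>k\<close> the kernel is at most \<open>w k\<close>, and the enclosing
  dilate has side \<open>6 * 2 ^ k * l\<close>, hence the power of 6. Shells with
  \<open>k < m\<close> involve only dilates small enough for the bound \<open>X\<close>; beyond them
  the global bound \<open>Y\<close> is paid, with the weight of the tail.\<close>

lemma far_part_bound:
  fixes m :: nat
  assumes f [measurable]: "f \<in> borel_measurable borel" and int: "cube_integrable f"
    and X: "X \<ge> 0" and Y: "Y \<ge> 0" and l: "l > 0" and t: "t > 0" and x: "x \<in> cube a l"
    and oscX: "\<And>a' l'. 0 < l' \<Longrightarrow> l' \<le> concentric_side l m \<Longrightarrow> cube_oscillation f a' l' \<le> X"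
    and oscY: "\<And>a' l'. 0 < l' \<Longrightarrow> cube_oscillation f a' l' \<le> Y"
  defines "c \<equiv> cube_average f (concentric_corner a l 0) (concentric_side l 0)"
  shows "(\<integral>\<^sup>+y. ennreal (norm (indicator (- concentric_cube a l 0) y *\<^sub>R (dilate \<psi> t (x - y) * (f y - c)))) \<partial>lborel)
    \<le> ennreal (C * 6 ^ CARD('n) * (t / l) * (far_tail CARD('n) 0 * X + far_tail CARD('n) m * Y))"
proof -
  define w where "w k = C * t / (2 ^ k * l) ^ (CARD('n) + 1)" for k :: nat
  have w: "w k \<ge> 0" for k using C_pos t l by (simp add: w_def)
  let ?Q = "concentric_cube a l"
  let ?R = "\<lambda>k. X + (if k < m then 0 else Y)"
  have "(\<integral>\<^sup>+y. ennreal (norm (indicator (- ?Q 0) y *\<^sub>R (dilate \<psi> t (x - y) * (f y - c)))) \<partial>lborel)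
    \<le> (\<integral>\<^sup>+y. (\<Sum>k. ennreal (w k) * (ennreal (norm (f y - c)) * indicator (?Q (Suc k)) y)) \<partial>lborel)"
  proof (rule nn_integral_mono)
    fix y
    show "ennreal (norm (indicator (- ?Q 0) y *\<^sub>R (dilate \<psi> t (x - y) * (f y - c))))
      \<le> (\<Sum>k. ennreal (w k) * (ennreal (norm (f y - c)) * indicator (?Q (Suc k)) y))"
    proof (cases "y \<in> ?Q 0")
      case False
      then obtain k where k: "y \<notin> ?Q k" "y \<in> ?Q (Suc k)"
        using outside_concentric_cube_shell[OF l] by blast
      have "norm (dilate \<psi> t (x - y)) \<le> w k"
        unfolding w_def
        by (intro dilate_far_bound norm_diff_ge_outside_concentric_cube[OF l x k(1)] t) (use l in auto)
      then have "ennreal (norm (indicator (- ?Q 0) y *\<^sub>R (dilate \<psi> t (x - y) * (f y - c)))) \<le> ennreal (w k * norm (f y - c))"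
        using False by (intro ennreal_leI) (auto simp: norm_mult intro!: mult_right_mono)
      also have "\<dots> = ennreal (w k) * (ennreal (norm (f y - c)) * indicator (?Q (Suc k)) y)"
        using k w by (simp add: ennreal_mult)
      also have "\<dots> \<le> (\<Sum>k. ennreal (w k) * (ennreal (norm (f y - c)) * indicator (?Q (Suc k)) y))"
        using sum_le_suminf[of "\<lambda>k. ennreal (w k) * (ennreal (norm (f y - c)) * indicator (?Q (Suc k)) y)" "{k}"]
        by (simp del: sum_mult_indicator)
      finally show ?thesis .
    qed simp
  qed
  also have "\<dots> = (\<Sum>k. \<integral>\<^sup>+y. ennreal (w k) * (ennreal (norm (f y - c)) * indicator (?Q (Suc k)) y) \<partial>lborel)"
    by (rule nn_integral_suminf) measurable
  also have "\<dots> \<le> (\<Sum>k. ennreal (C * 6 ^ CARD('n) * (t / l) * (far_weight CARD('n) k * ?R k)))"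
  proof (rule suminf_le)
    fix k
    let ?s = "concentric_side l (Suc k)" and ?b = "concentric_corner a l (Suc k)"
    have int_c: "cube_integrable (\<lambda>y. norm (f y - c))"
      by (intro cube_integrable_norm cube_integrable_diff int cube_integrable_const)
    have s: "?s > 0" using l by simp
    have avg: "cube_average (\<lambda>y. norm (f y - c)) ?b ?s \<le> (1 + real (Suc k) * 2 ^ CARD('n)) * ?R k"
      unfolding c_def
    proof (rule concentric_average_bound[OF int l])
      fix j assume j: "j \<le> Suc k"
      show "cube_oscillation f (concentric_corner a l j) (concentric_side l j) \<le> ?R k"
      proof (cases "k < m")
        case True
        \<comment> \<open>Here \<open>j \<le> Suc k \<le> m\<close>: shell \<open>k\<close> needs
          the dilate \<open>k + 1\<close>, which is why \<open>k < m\<close> is the right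
          threshold.\<close>
        then have "(2::real) ^ j \<le> 2 ^ m" using j by (intro power_increasing) auto
        then show ?thesis using oscX[of "concentric_side l j"] True l by simp
      qed (use oscY[of "concentric_side l j"] l X in \<open>auto intro: add_increasing\<close>)
    qed
    have "(\<integral>\<^sup>+y. ennreal (w k) * (ennreal (norm (f y - c)) * indicator (?Q (Suc k)) y) \<partial>lborel)
      = ennreal (w k) * (\<integral>\<^sup>+y. ennreal (norm (f y - c)) * indicator (?Q (Suc k)) y \<partial>lborel)"
      by (rule nn_integral_cmult) measurable
    also have "(\<integral>\<^sup>+y. ennreal (norm (f y - c)) * indicator (?Q (Suc k)) y \<partial>lborel)
      = (\<integral>\<^sup>+y. ennreal (indicator (?Q (Suc k)) y *\<^sub>R norm (f y - c)) \<partial>lborel)"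
      by (intro nn_integral_cong) (auto simp: indicator_def)
    also have "\<dots> = ennreal (LINT y:?Q (Suc k)|lborel. norm (f y - c))"
      unfolding set_lebesgue_integral_def using int_c
      by (intro nn_integral_eq_integral) (auto simp: cube_integrable_def set_integrable_def)
    also have "(LINT y:?Q (Suc k)|lborel. norm (f y - c)) = ?s ^ CARD('n) * cube_average (\<lambda>y. norm (f y - c)) ?b ?s"
    proof -
      have ne: "?s ^ CARD('n) \<noteq> 0" using l by simp
      show ?thesis
        unfolding cube_average_def real_scaleR_def mult.assoc[symmetric] by (simp only: right_inverse[OF ne] mult_1)
    qed
    also have "ennreal (w k) * ennreal \<dots> = ennreal (w k * (?s ^ CARD('n) * cube_average (\<lambda>y. norm (f y - c)) ?b ?s))"
      using w by (subst ennreal_mult') auto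
    also have "\<dots> \<le> ennreal (w k * (?s ^ CARD('n) * ((1 + real (Suc k) * 2 ^ CARD('n)) * ?R k)))"
      using w s avg by (intro ennreal_leI mult_left_mono) auto
    also have "w k * (?s ^ CARD('n) * ((1 + real (Suc k) * 2 ^ CARD('n)) * ?R k))
      = C * 6 ^ CARD('n) * (t / l) * (far_weight CARD('n) k * ?R k)"
    proof -
      define q where "q = 2 ^ k * l"
      define p where "p = q ^ CARD('n)"
      have q: "q > 0" "p > 0" using l by (auto simp: q_def p_def)
      have "?s = 6 * q" by (simp add: q_def)
      then have "?s ^ CARD('n) = 6 ^ CARD('n) * p" by (simp only: power_mult_distrib p_def)
      moreover have "w k = C * t / (q * p)" by (simp add: w_def q_def p_def)
      ultimately have "w k * ?s ^ CARD('n) = C * 6 ^ CARD('n) * (t / q)"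
        using q by simp
      also have "\<dots> = C * 6 ^ CARD('n) * (t / l) / 2 ^ k" by (simp add: q_def)
      finally have "w k * ?s ^ CARD('n) = C * 6 ^ CARD('n) * (t / l) / 2 ^ k" .
      then show ?thesis unfolding mult.assoc[symmetric] by (simp add: far_weight_def)
    qed
    finally show "(\<integral>\<^sup>+y. ennreal (w k) * (ennreal (norm (f y - c)) * indicator (?Q (Suc k)) y) \<partial>lborel)
      \<le> ennreal (C * 6 ^ CARD('n) * (t / l) * (far_weight CARD('n) k * ?R k))" .
  qed auto
  also have "\<dots> = ennreal (C * 6 ^ CARD('n) * (t / l) * (far_tail CARD('n) 0 * X + far_tail CARD('n) m * Y))"
  proof (rule sums_unique[symmetric], subst sums_ennreal)
    show "(\<lambda>k. C * 6 ^ CARD('n) * (t / l) * (far_weight CARD('n) k * ?R k)) sums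
        (C * 6 ^ CARD('n) * (t / l) * (far_tail CARD('n) 0 * X + far_tail CARD('n) m * Y))"
      by (intro sums_mult far_weight_split_sums X Y)
  qed (use C_pos t l X Y far_weight_nonneg far_tail_nonneg in auto)
  finally show ?thesis .
qed

text \<open>The mean of the dilate annihilates the constant \<open>?c\<close>. The far piece is
  integrable by \<open>far_part_bound\<close>, the near piece because the dilate is bounded, so
  absolute convergence of the convolution comes out together with the error bound.\<close>

lemma convolution_decomposition:
  fixes m :: nat
  assumes f [measurable]: "f \<in> borel_measurable borel" and int: "cube_integrable f"
    and X: "X \<ge> 0" and Y: "Y \<ge> 0" and l: "l > 0" and t: "t > 0" and x: "x \<in> cube a l"
    and oscX: "\<And>a' l'. 0 < l' \<Longrightarrow> l' \<le> concentric_side l m \<Longrightarrow> cube_oscillation f a' l' \<le> X"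
    and oscY: "\<And>a' l'. 0 < l' \<Longrightarrow> cube_oscillation f a' l' \<le> Y"
  shows "integrable lborel (\<lambda>y. dilate \<psi> t (x - y) * f y)"
    and "norm ((\<integral>y. dilate \<psi> t (x - y) * f y \<partial>lborel) -
        local_convolution f (concentric_corner a l 0) (concentric_side l 0) x t)
      \<le> C * 6 ^ CARD('n) * (t / l) * (far_tail CARD('n) 0 * X + far_tail CARD('n) m * Y)"
proof -
  let ?Q = "concentric_cube a l 0"
  let ?c = "cube_average f (concentric_corner a l 0) (concentric_side l 0)"
  let ?T = "C * 6 ^ CARD('n) * (t / l) * (far_tail CARD('n) 0 * X + far_tail CARD('n) m * Y)"
  have T: "?T \<ge> 0" using C_pos t l X Y far_tail_nonneg by simp
  let ?far = "\<lambda>y. indicator (- ?Q) y *\<^sub>R (dilate \<psi> t (x - y) * (f y - ?c))"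
  let ?near = "\<lambda>y. dilate \<psi> t (x - y) * (indicator ?Q y *\<^sub>R (f y - ?c))"
  note far = far_part_bound[OF f int X Y l t x oscX oscY]
  have [measurable]: "- ?Q \<in> sets borel" by auto
  have far_int: "integrable lborel ?far"
  proof (rule integrableI_bounded)
    show "?far \<in> borel_measurable lborel" by measurable
    have "ennreal ?T < \<infinity>" by simp
    with far show "(\<integral>\<^sup>+y. ennreal (norm (?far y)) \<partial>lborel) < \<infinity>" by (rule order_le_less_trans)
  qed
  have near_int: "integrable lborel ?near"
  proof (rule Bochner_Integration.integrable_bound)
    have "set_integrable lborel ?Q (\<lambda>y. f y - ?c)"
      using cube_integrable_diff[OF int cube_integrable_const] unfolding cube_integrable_def by blast
    then show "integrable lborel (\<lambda>y. of_real (C / t ^ CARD('n)) * (indicator ?Q y *\<^sub>R (f y - ?c)))"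
      unfolding set_integrable_def by (rule integrable_mult_right)
    show "AE y in lborel. norm (?near y) \<le> norm (complex_of_real (C / t ^ CARD('n)) * (indicator ?Q y *\<^sub>R (f y - ?c)))"
    proof (intro AE_I2)
      fix y
      have "norm (dilate \<psi> t (x - y)) \<le> norm (complex_of_real (C / t ^ CARD('n)))"
        using dilate_bound[OF t, of "x - y"] C_pos t by (simp add: norm_divide norm_power)
      then show "norm (?near y) \<le> norm (complex_of_real (C / t ^ CARD('n)) * (indicator ?Q y *\<^sub>R (f y - ?c)))"
        unfolding norm_mult by (rule mult_right_mono) simp
    qed
  qed measurable
  have split: "dilate \<psi> t (x - y) * f y = ?near y + ?far y + dilate \<psi> t (x - y) * ?c" for y
    by (auto simp: indicator_def algebra_simps)
  have const_int: "integrable lborel (\<lambda>y. dilate \<psi> t (x - y) * ?c)"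
    by (intro integrable_mult_left dilate_integrable t)
  show "integrable lborel (\<lambda>y. dilate \<psi> t (x - y) * f y)"
    unfolding split by (intro Bochner_Integration.integrable_add near_int far_int const_int)
  have "(\<integral>y. dilate \<psi> t (x - y) * f y \<partial>lborel)
    = (\<integral>y. ?near y \<partial>lborel) + (\<integral>y. ?far y \<partial>lborel) + (\<integral>y. dilate \<psi> t (x - y) * ?c \<partial>lborel)"
    unfolding split using near_int far_int const_int by (simp add: Bochner_Integration.integrable_add)
  also have "(\<integral>y. dilate \<psi> t (x - y) * ?c \<partial>lborel) = 0" using integral_dilate[OF t] by simp
  finally have "(\<integral>y. dilate \<psi> t (x - y) * f y \<partial>lborel) -
      local_convolution f (concentric_corner a l 0) (concentric_side l 0) x t = (\<integral>y. ?far y \<partial>lborel)"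
    by (simp add: local_convolution_def)
  moreover have "ennreal (norm (\<integral>y. ?far y \<partial>lborel)) \<le> ennreal ?T"
    using norm_integral_le_nn_integral far by (rule order_trans)
  ultimately show "norm ((\<integral>y. dilate \<psi> t (x - y) * f y \<partial>lborel) -
        local_convolution f (concentric_corner a l 0) (concentric_side l 0) x t) \<le> ?T"
    using T by simp
qed

end

section \<open>The Carleson estimate\<close>

text \<open>Monotone convergence along the cutoffs \<open>1 / Suc k\<close> removes the truncation,
  as the bound does not depend on it.\<close>

lemma nn_integral_Ioo_le:
  fixes G :: "real \<Rightarrow> ennreal"
  assumes [measurable]: "G \<in> borel_measurable borel"
    and bound: "\<And>\<epsilon>. \<epsilon> > 0 \<Longrightarrow> (\<integral>\<^sup>+t\<in>{\<epsilon>..l}. G t \<partial>lborel) \<le> B"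
  shows "(\<integral>\<^sup>+t\<in>{0<..<l}. G t \<partial>lborel) \<le> B"
proof -
  define F where "F k t = G t * indicator {1 / real (Suc k)..l} t" for k t
  have "(\<integral>\<^sup>+t\<in>{0<..<l}. G t \<partial>lborel) \<le> (\<integral>\<^sup>+t. (SUP k. F k t) \<partial>lborel)"
  proof (rule nn_integral_mono)
    fix t
    show "G t * indicator {0<..<l} t \<le> (SUP k. F k t)"
    proof (cases "t \<in> {0<..<l}")
      case True
      then obtain k where "inverse (real (Suc k)) < t" using reals_Archimedean[of t] by auto
      then have "G t * indicator {0<..<l} t \<le> F k t" using True by (simp add: F_def inverse_eq_divide)
      also have "\<dots> \<le> (SUP k. F k t)" by (rule SUP_upper) simp
      finally show ?thesis .
    qed simp
  qed
  also have "\<dots> = (SUP k. \<integral>\<^sup>+t. F k t \<partial>lborel)"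
  proof (rule nn_integral_monotone_convergence_SUP)
    show "incseq F"
    proof (rule incseq_SucI, rule le_funI)
      fix k t
      have "1 / real (Suc (Suc k)) \<le> 1 / real (Suc k)" by (intro divide_left_mono) auto
      then show "F k t \<le> F (Suc k) t" by (auto simp: F_def indicator_def)
    qed
  qed (simp add: F_def)
  also have "\<dots> \<le> B"
    unfolding F_def by (intro SUP_least bound) simp
  finally show ?thesis .
qed

context littlewood_paley_kernel
begin

text \<open>The factors 2 come from squaring a sum of two parts. The first term is the local
  estimate on \<open>3Q\<close>, whose volume gives \<open>3 ^ CARD('n)\<close>; the second is the
  far constant squared, where the 1 pays for the tail term.\<close>

definition "C_carleson = 2 * C_schur * jn_const CARD('n) * 3 ^ CARD('n)
    + 2 * (C * 6 ^ CARD('n) * (1 + far_tail CARD('n) 0))\<^sup>2"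

lemma C_carleson_pos: "C_carleson > 0"
proof -
  have "0 < 2 * C_schur * jn_const CARD('n) * 3 ^ CARD('n)"
    using C_schur_pos by (auto simp: jn_const_def intro!: mult_pos_pos add_pos_nonneg)
  then show ?thesis unfolding C_carleson_def by (intro add_pos_nonneg) auto
qed

lemma lborel_convolution_measurable [measurable]:
  assumes [measurable]: "f \<in> borel_measurable borel"
  shows "(\<lambda>X. \<integral>y. dilate \<psi> (snd X) (fst X - y) * f y \<partial>lborel) \<in> borel_measurable (borel \<Otimes>\<^sub>M borel)"
  by (rule lborel.borel_measurable_lebesgue_integral) measurable

text \<open>The local part is the square estimate on \<open>3Q\<close>. The far error carries a
  factor \<open>t / l\<close>, whose square compensates \<open>1 / t\<close> down to height 0, so
  the bound on \<open>{\<epsilon>..l}\<close> is free of \<open>\<epsilon>\<close>.\<close>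

lemma carleson_estimate:
  fixes m :: nat
  assumes f [measurable]: "f \<in> borel_measurable borel" and int: "cube_integrable f"
    and X: "X > 0" and Y: "Y \<ge> 0" and l: "l > 0"
    and oscX: "\<And>a' l'. 0 < l' \<Longrightarrow> l' \<le> concentric_side l m \<Longrightarrow> cube_oscillation f a' l' \<le> X"
    and oscY: "\<And>a' l'. 0 < l' \<Longrightarrow> cube_oscillation f a' l' \<le> Y"
  shows "(\<integral>\<^sup>+t\<in>{0<..<l}. (\<integral>\<^sup>+x\<in>cube a l. ennreal ((norm (\<integral>y. dilate \<psi> t (x - y) * f y \<partial>lborel))\<^sup>2 / t) \<partial>lborel) \<partial>lborel)
    \<le> ennreal (C_carleson * (X + far_tail CARD('n) m * Y)\<^sup>2 * l ^ CARD('n))"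
proof (rule nn_integral_Ioo_le)
  let ?conv = "\<lambda>x t. \<integral>y. dilate \<psi> t (x - y) * f y \<partial>lborel"
  let ?u = "local_convolution f (concentric_corner a l 0) (concentric_side l 0)"
  have [measurable]: "(\<lambda>z. ?conv (snd z) (fst z)) \<in> borel_measurable (borel \<Otimes>\<^sub>M borel)"
    using measurable_compose[OF measurable_Pair[OF measurable_snd measurable_fst] lborel_convolution_measurable[OF f]]
    by simp
  show "(\<lambda>t. \<integral>\<^sup>+x\<in>cube a l. ennreal ((norm (?conv x t))\<^sup>2 / t) \<partial>lborel) \<in> borel_measurable borel"
    by (rule lborel.borel_measurable_nn_integral) (unfold case_prod_unfold, measurable)
  fix \<epsilon> :: real assume \<epsilon>: "\<epsilon> > 0"
  \<comment> \<open>\<open>Z\<close> dominates both \<open>X\<close> and the tail term, so that both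
    parts become multiples of \<open>Z\<^sup>2\<close>.\<close>
  define Z where "Z = X + far_tail CARD('n) m * Y"
  have Z: "X \<le> Z" "Z > 0" using X Y far_tail_nonneg by (auto simp: Z_def intro!: add_pos_nonneg)
  define E where "E = C * 6 ^ CARD('n) * ((1 + far_tail CARD('n) 0) * Z)"
  have E: "E \<ge> 0" using C_pos Z far_tail_nonneg by (simp add: E_def)
  have pointwise: "ennreal ((norm (?conv x t))\<^sup>2 / t) \<le> ennreal (1 / t) * ennreal (2 * (norm (?u x t))\<^sup>2) + ennreal (2 * E\<^sup>2 / l)"
    if x: "x \<in> cube a l" and t: "0 < t" "t \<le> l" for x t
  proof -
    have "norm (?conv x t - ?u x t) \<le> C * 6 ^ CARD('n) * (t / l) * (far_tail CARD('n) 0 * X + far_tail CARD('n) m * Y)"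
      by (rule convolution_decomposition(2)[OF f int less_imp_le[OF X] Y l t(1) x oscX oscY])
    also have "\<dots> \<le> C * 6 ^ CARD('n) * (t / l) * ((1 + far_tail CARD('n) 0) * Z)"
    proof (rule mult_left_mono)
      have "far_tail CARD('n) 0 * X \<le> far_tail CARD('n) 0 * Z"
        using Z far_tail_nonneg by (intro mult_left_mono) auto
      moreover have "far_tail CARD('n) m * Y \<le> Z" using X by (simp add: Z_def)
      ultimately show "far_tail CARD('n) 0 * X + far_tail CARD('n) m * Y \<le> (1 + far_tail CARD('n) 0) * Z"
        by (simp add: algebra_simps)
    qed (use C_pos t l in auto)
    also have "\<dots> = E * (t / l)" by (simp add: E_def)
    finally have d: "norm (?conv x t - ?u x t) \<le> E * (t / l)" .
    have "(norm (?conv x t))\<^sup>2 \<le> 2 * (norm (?conv x t - ?u x t))\<^sup>2 + 2 * (norm (?u x t))\<^sup>2"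
      using norm_diff_square_le[of "?conv x t" 0 "?u x t"] by simp
    also have "\<dots> \<le> 2 * (E * (t / l))\<^sup>2 + 2 * (norm (?u x t))\<^sup>2"
      using d by (intro add_right_mono mult_left_mono power_mono) auto
    finally have "(norm (?conv x t))\<^sup>2 / t \<le> (2 * (E * (t / l))\<^sup>2 + 2 * (norm (?u x t))\<^sup>2) / t"
      using t by (intro divide_right_mono) auto
    \<comment> \<open>Of the two factors \<open>t / l\<close> in the square, one turns
      \<open>1 / t\<close> into \<open>1 / l\<close> and the other is then bounded by 1.\<close>
    also have "\<dots> = 1 / t * (2 * (norm (?u x t))\<^sup>2) + 2 * E\<^sup>2 / l * (t / l)"
      using t l by (simp add: field_simps power2_eq_square)
    also have "\<dots> \<le> 1 / t * (2 * (norm (?u x t))\<^sup>2) + 2 * E\<^sup>2 / l * 1"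
      using t l by (intro add_left_mono mult_left_mono) auto
    finally have "ennreal ((norm (?conv x t))\<^sup>2 / t) \<le> ennreal (1 / t * (2 * (norm (?u x t))\<^sup>2) + 2 * E\<^sup>2 / l)"
      by (intro ennreal_leI) simp
    also have "\<dots> = ennreal (1 / t) * ennreal (2 * (norm (?u x t))\<^sup>2) + ennreal (2 * E\<^sup>2 / l)"
      using t l by (subst ennreal_plus) (auto simp: ennreal_mult[symmetric])
    finally show ?thesis .
  qed
  have u [measurable]: "(\<lambda>z. ?u (fst z) (snd z)) \<in> borel_measurable (borel \<Otimes>\<^sub>M borel)" by measurable

  have [measurable]: "(\<lambda>t. \<integral>\<^sup>+x\<in>cube a l. ennreal (2 * (norm (?u x t))\<^sup>2) \<partial>lborel) \<in> borel_measurable borel"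
  proof (rule lborel.borel_measurable_nn_integral)
    have [measurable]: "(\<lambda>z. ?u (snd z) (fst z)) \<in> borel_measurable (borel \<Otimes>\<^sub>M borel)"
      using measurable_compose[OF measurable_Pair[OF measurable_snd measurable_fst] u] by simp
    show "(\<lambda>(t, x). ennreal (2 * (norm (?u x t))\<^sup>2) * indicator (cube a l) x) \<in> borel_measurable (borel \<Otimes>\<^sub>M lborel)"
      unfolding case_prod_unfold by measurable
  qed
  have "(\<integral>\<^sup>+t\<in>{\<epsilon>..l}. (\<integral>\<^sup>+x\<in>cube a l. ennreal ((norm (?conv x t))\<^sup>2 / t) \<partial>lborel) \<partial>lborel)
    \<le> (\<integral>\<^sup>+t. (ennreal (1 / t) * (\<integral>\<^sup>+x\<in>cube a l. ennreal (2 * (norm (?u x t))\<^sup>2) \<partial>lborel)) * indicator {\<epsilon>..l} t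
        + ennreal (2 * E\<^sup>2 / l) * emeasure lborel (cube a l) * indicator {\<epsilon>..l} t \<partial>lborel)"
  proof (rule nn_integral_mono)
    fix t
    show "(\<integral>\<^sup>+x\<in>cube a l. ennreal ((norm (?conv x t))\<^sup>2 / t) \<partial>lborel) * indicator {\<epsilon>..l} t
      \<le> (ennreal (1 / t) * (\<integral>\<^sup>+x\<in>cube a l. ennreal (2 * (norm (?u x t))\<^sup>2) \<partial>lborel)) * indicator {\<epsilon>..l} t
        + ennreal (2 * E\<^sup>2 / l) * emeasure lborel (cube a l) * indicator {\<epsilon>..l} t"
    proof (cases "t \<in> {\<epsilon>..l}")
      case True
      then have t: "0 < t" "t \<le> l" using \<epsilon> by auto
      have "(\<integral>\<^sup>+x\<in>cube a l. ennreal ((norm (?conv x t))\<^sup>2 / t) \<partial>lborel)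
        \<le> (\<integral>\<^sup>+x. ennreal (1 / t) * (ennreal (2 * (norm (?u x t))\<^sup>2) * indicator (cube a l) x)
            + ennreal (2 * E\<^sup>2 / l) * indicator (cube a l) x \<partial>lborel)"
        using pointwise[OF _ t] by (intro nn_integral_mono) (auto simp: indicator_def)
      also have "\<dots> = ennreal (1 / t) * (\<integral>\<^sup>+x\<in>cube a l. ennreal (2 * (norm (?u x t))\<^sup>2) \<partial>lborel)
            + ennreal (2 * E\<^sup>2 / l) * emeasure lborel (cube a l)"
        by (simp add: nn_integral_add nn_integral_cmult)
      finally show ?thesis using True by simp
    qed simp
  qed
  also have "\<dots> = (\<integral>\<^sup>+t\<in>{\<epsilon>..l}. (ennreal (1 / t) * (\<integral>\<^sup>+x\<in>cube a l. ennreal (2 * (norm (?u x t))\<^sup>2) \<partial>lborel)) \<partial>lborel)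
      + (\<integral>\<^sup>+t. ennreal (2 * E\<^sup>2 / l) * emeasure lborel (cube a l) * indicator {\<epsilon>..l} t \<partial>lborel)"
    by (intro nn_integral_add) measurable
  also have "(\<integral>\<^sup>+t\<in>{\<epsilon>..l}. (ennreal (1 / t) * (\<integral>\<^sup>+x\<in>cube a l. ennreal (2 * (norm (?u x t))\<^sup>2) \<partial>lborel)) \<partial>lborel)
      = (\<integral>\<^sup>+z. ennreal 2 * ennreal ((norm (?u (fst z) (snd z)))\<^sup>2) \<partial>strip_measure a l \<epsilon>)"
    by (subst nn_integral_strip_measure) (auto simp: ennreal_mult)
  also have "\<dots> = ennreal 2 * (\<integral>\<^sup>+z. ennreal ((norm (?u (fst z) (snd z)))\<^sup>2) \<partial>strip_measure a l \<epsilon>)"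
    by (rule nn_integral_cmult) measurable
  also have "\<dots> \<le> ennreal 2 * ennreal (C_schur * (jn_const CARD('n) * X\<^sup>2) * (concentric_side l 0) ^ CARD('n))"
  proof (intro mult_left_mono local_square_estimate[OF f int X _ _ \<epsilon>])
    show "cube_oscillation f a' l' \<le> X" if "0 < l'" "l' \<le> concentric_side l 0" for a' l'
    proof (rule oscX[OF that(1)])
      have "(1::real) \<le> 2 ^ m" by simp
      then have "concentric_side l 0 \<le> concentric_side l m" using l by simp
      then show "l' \<le> concentric_side l m" using that(2) by linarith
    qed
  qed (use l in auto)
  also have "(\<integral>\<^sup>+t. ennreal (2 * E\<^sup>2 / l) * emeasure lborel (cube a l) * indicator {\<epsilon>..l} t \<partial>lborel)
    = ennreal (2 * E\<^sup>2 / l) * emeasure lborel (cube a l) * emeasure lborel {\<epsilon>..l}"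
    by (rule nn_integral_cmult_indicator) auto
  also have "\<dots> \<le> ennreal (2 * E\<^sup>2 / l) * ennreal (l ^ CARD('n)) * ennreal l"
    using l \<epsilon> by (intro mult_mono) (auto simp: emeasure_cube emeasure_lborel_Icc_eq intro!: ennreal_leI)
  also have "\<dots> = ennreal (2 * E\<^sup>2 * l ^ CARD('n))"
    using l by (simp add: ennreal_mult[symmetric])
  also have "ennreal 2 * ennreal (C_schur * (jn_const CARD('n) * X\<^sup>2) * (concentric_side l 0) ^ CARD('n)) + \<dots>
     = ennreal (2 * (C_schur * (jn_const CARD('n) * X\<^sup>2) * (concentric_side l 0) ^ CARD('n)) + 2 * E\<^sup>2 * l ^ CARD('n))"
  proof -
    define J where "J = C_schur * (jn_const CARD('n) * X\<^sup>2) * (concentric_side l 0) ^ CARD('n)"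
    have "J \<ge> 0" using l C_schur_pos by (simp add: J_def jn_const_def)
    moreover have "2 * E\<^sup>2 * l ^ CARD('n) \<ge> 0" using l by simp
    ultimately show ?thesis
      unfolding J_def[symmetric] by (simp only: ennreal_mult[symmetric] ennreal_plus[symmetric] mult_nonneg_nonneg zero_le_numeral)
  qed
  also have "\<dots> \<le> ennreal (C_carleson * Z\<^sup>2 * l ^ CARD('n))"
  proof (rule ennreal_leI)
    have "X\<^sup>2 \<le> Z\<^sup>2" using Z X by (intro power_mono) auto
    then have "C_schur * (jn_const CARD('n) * X\<^sup>2) * (3 * l) ^ CARD('n) \<le> C_schur * (jn_const CARD('n) * Z\<^sup>2) * (3 * l) ^ CARD('n)"
      using l C_schur_pos by (intro mult_right_mono mult_left_mono) (auto simp: jn_const_def)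
    also have "2 * (C_schur * (jn_const CARD('n) * Z\<^sup>2) * (3 * l) ^ CARD('n)) + 2 * E\<^sup>2 * l ^ CARD('n) = C_carleson * Z\<^sup>2 * l ^ CARD('n)"
    proof -
      have E2: "E\<^sup>2 = (C * 6 ^ CARD('n) * (1 + far_tail CARD('n) 0))\<^sup>2 * Z\<^sup>2"
        by (simp add: E_def power_mult_distrib)
      show ?thesis unfolding C_carleson_def E2 by (simp add: power_mult_distrib[of 3 l] algebra_simps)
    qed
    finally show "2 * (C_schur * (jn_const CARD('n) * X\<^sup>2) * (concentric_side l 0) ^ CARD('n)) + 2 * E\<^sup>2 * l ^ CARD('n)
      \<le> C_carleson * Z\<^sup>2 * l ^ CARD('n)" by simp
  qed
  finally show "(\<integral>\<^sup>+t\<in>{\<epsilon>..l}. (\<integral>\<^sup>+x\<in>cube a l. ennreal ((norm (?conv x t))\<^sup>2 / t) \<partial>lborel) \<partial>lborel)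
    \<le> ennreal (C_carleson * (X + far_tail CARD('n) m * Y)\<^sup>2 * l ^ CARD('n))"
    by (simp add: Z_def add_mono)
qed

end

section \<open>Oscillation at small scales and distance to VMO\<close>

text \<open>Membership in \<open>BMO\<close> and convolution concern Lebesgue measurable functions
  and \<open>lebesgue\<close>, whereas Fubini and product measurability are applied to Borel
  functions and \<open>lborel\<close>. A representative carries integrals from one side to the
  other.\<close>

definition borel_representative :: "(real ^ 'n \<Rightarrow> complex) \<Rightarrow> (real ^ 'n \<Rightarrow> complex) \<Rightarrow> bool" where
  "borel_representative f f' \<longleftrightarrow> f \<in> borel_measurable lebesgue \<and>
    f' \<in> borel_measurable borel \<and> cube_integrable f' \<and> (AE x in lebesgue. f x = f' x)"

text \<open>Pointwise limit of the restrictions to growing balls.\<close>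

lemma locally_integrable_measurable:
  fixes f :: "real ^ 'n \<Rightarrow> complex"
  assumes "locally_integrable f"
  shows "f \<in> borel_measurable lebesgue"
proof (rule borel_measurable_LIMSEQ_metric)
  show "(\<lambda>x. indicator (cball 0 (real k)) x *\<^sub>R f x) \<in> borel_measurable lebesgue" for k
    using assms unfolding locally_integrable_def set_integrable_def
    by (intro borel_measurable_integrable) auto
  show "(\<lambda>k. indicator (cball 0 (real k)) x *\<^sub>R f x) \<longlonglongrightarrow> f x" for x
  proof (rule tendsto_eventually)
    obtain N where N: "norm x \<le> real N" using real_arch_simple by blast
    show "\<forall>\<^sub>F k in sequentially. indicator (cball 0 (real k)) x *\<^sub>R f x = f x"
      using eventually_ge_at_top[of N]
    proof eventually_elim
      case (elim k)
      then have "real N \<le> real k" by simp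
      then have "x \<in> cball 0 (real k)" using N by simp
      then show ?case by simp
    qed
  qed
qed

lemma borel_representative_exists:
  fixes f :: "real ^ 'n \<Rightarrow> complex"
  assumes f: "locally_integrable f"
  shows "\<exists>f'. borel_representative f f'"
proof -
  have meas: "f \<in> borel_measurable lebesgue" by (rule locally_integrable_measurable[OF f])
  obtain u where u [measurable]: "u \<in> borel_measurable lborel" "AE x in lborel. Re (f x) = u x"
    using completion_ex_borel_measurable_real[of "\<lambda>x. Re (f x)" lborel] meas by auto
  obtain v where v [measurable]: "v \<in> borel_measurable lborel" "AE x in lborel. Im (f x) = v x"
    using completion_ex_borel_measurable_real[of "\<lambda>x. Im (f x)" lborel] meas by auto
  define f' where "f' x = Complex (u x) (v x)" for x
  have f' [measurable]: "f' \<in> borel_measurable borel"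
    unfolding f'_def borel_measurable_complex_iff using u(1) v(1) by simp
  have "AE x in lborel. f x = f' x"
    using u(2) v(2) by eventually_elim (simp add: f'_def complex_eq_iff)
  then have eq: "AE x in lebesgue. f x = f' x" by (rule AE_completion)
  have "integrable lborel (\<lambda>x. indicator (cube a l) x *\<^sub>R f' x)" for a l
  proof -
    have "integrable lebesgue (\<lambda>x. indicator (cube a l) x *\<^sub>R f x)"
      using f compact_cube[of a l] unfolding locally_integrable_def set_integrable_def by blast
    then have "integrable lebesgue (\<lambda>x. indicator (cube a l) x *\<^sub>R f' x)"
    proof (rule integrable_cong_AE_imp)
      show "AE x in lebesgue. indicator (cube a l) x *\<^sub>R f x = indicator (cube a l) x *\<^sub>R f' x"
        using eq by eventually_elim simp
      show "(\<lambda>x. indicator (cube a l) x *\<^sub>R f' x) \<in> borel_measurable lebesgue"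
        by (intro measurable_completion) measurable
    qed
    then show ?thesis by (subst (asm) integrable_completion) measurable
  qed
  then show ?thesis
    using eq f' meas unfolding borel_representative_def cube_integrable_def set_integrable_def by blast
qed

text \<open>The parameter \<open>\<phi>\<close> covers both cube averages, with an indicator as
  factor, and convolutions, with a dilate as factor.\<close>

lemma representative_integral:
  fixes \<phi> :: "real ^ 'n \<Rightarrow> complex \<Rightarrow> 'b::{banach, second_countable_topology}"
  assumes rep: "borel_representative f f'"
    and [measurable]: "(\<lambda>x. \<phi> x (f' x)) \<in> borel_measurable borel"
    and "(\<lambda>x. \<phi> x (f x)) \<in> borel_measurable lebesgue"
  shows "integrable lebesgue (\<lambda>x. \<phi> x (f x)) \<longleftrightarrow> integrable lborel (\<lambda>x. \<phi> x (f' x))"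
    and "(\<integral>x. \<phi> x (f x) \<partial>lebesgue) = (\<integral>x. \<phi> x (f' x) \<partial>lborel)"
proof -
  have eq: "AE x in lebesgue. \<phi> x (f x) = \<phi> x (f' x)"
    using rep unfolding borel_representative_def by (auto elim: eventually_mono)
  have m: "(\<lambda>x. \<phi> x (f' x)) \<in> borel_measurable lebesgue"
    by (intro measurable_completion) measurable
  show "integrable lebesgue (\<lambda>x. \<phi> x (f x)) \<longleftrightarrow> integrable lborel (\<lambda>x. \<phi> x (f' x))"
    by (subst integrable_cong_AE[OF assms(3) m eq], rule integrable_completion) simp
  show "(\<integral>x. \<phi> x (f x) \<partial>lebesgue) = (\<integral>x. \<phi> x (f' x) \<partial>lborel)"
    by (subst integral_cong_AE[OF assms(3) m eq], rule integral_completion) simp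
qed

lemma borel_representative_diff:
  assumes "borel_representative f f'" "borel_representative g g'"
  shows "borel_representative (\<lambda>x. f x - g x) (\<lambda>x. f' x - g' x)"
  using assms unfolding borel_representative_def by (auto intro: cube_integrable_diff)

lemma lebesgue_borel_measurable: "u \<in> borel_measurable borel \<Longrightarrow> u \<in> borel_measurable lebesgue"
  by (intro measurable_completion) simp

lemma average_cube:
  assumes rep: "borel_representative f f'" and l: "l > 0"
  shows "average (cube a l) f = cube_average f' a l"
proof -
  have [measurable]: "f' \<in> borel_measurable borel" "f \<in> borel_measurable lebesgue"
    using rep by (auto simp: borel_representative_def)
  have ind: "indicat_real (cube a l) \<in> borel_measurable lebesgue"
    by (rule lebesgue_borel_measurable) simp
  have "(LINT x:cube a l|lebesgue. f x) = (LINT x:cube a l|lborel. f' x)"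
    unfolding set_lebesgue_integral_def
    by (rule representative_integral(2)[OF rep, where \<phi> = "\<lambda>x z. indicator (cube a l) x *\<^sub>R z"])
      (use ind in \<open>auto intro: borel_measurable_scaleR\<close>)
  then show ?thesis using l by (simp add: average_def cube_average_def measure_cube)
qed

lemma mean_osc_cube:
  fixes f :: "real ^ 'n \<Rightarrow> complex"
  assumes rep: "borel_representative f f'" and l: "l > 0"
  shows "mean_osc (cube a l) f = ennreal (cube_oscillation f' a l)"
proof -
  let ?c = "cube_average f' a l"
  have int: "cube_integrable (\<lambda>x. norm (f' x - ?c))"
    using rep unfolding borel_representative_def
    by (intro cube_integrable_norm cube_integrable_diff cube_integrable_const) auto
  have "(\<integral>\<^sup>+x\<in>cube a l. ennreal (norm (f x - ?c)) \<partial>lebesgue) = (\<integral>\<^sup>+x\<in>cube a l. ennreal (norm (f' x - ?c)) \<partial>lebesgue)"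
    using rep unfolding borel_representative_def
    by (intro nn_integral_cong_AE) (auto elim: eventually_mono)
  also have "\<dots> = (\<integral>\<^sup>+x. ennreal (indicator (cube a l) x *\<^sub>R norm (f' x - ?c)) \<partial>lborel)"
    unfolding nn_integral_completion by (intro nn_integral_cong) (auto simp: indicator_def)
  also have "\<dots> = ennreal (LINT x:cube a l|lborel. norm (f' x - ?c))"
    unfolding set_lebesgue_integral_def using int
    by (intro nn_integral_eq_integral) (auto simp: cube_integrable_def set_integrable_def)
  also have "\<dots> / emeasure lebesgue (cube a l) = ennreal ((LINT x:cube a l|lborel. norm (f' x - ?c)) / l ^ CARD('n))"
    using l by (simp add: emeasure_cube divide_ennreal set_lebesgue_integral_def)
  also have "\<dots> = ennreal (cube_oscillation f' a l)"
    by (simp add: cube_oscillation_def cube_average_def divide_inverse mult.commute)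
  finally show ?thesis using average_cube[OF rep l] by (simp add: mean_osc_def)
qed

section \<open>Oscillation of differences and its small-scale modulus\<close>

lemma cube_oscillation_nonneg:
  assumes "cube_integrable f" "l > 0"
  shows "cube_oscillation f a l \<ge> 0"
  unfolding cube_oscillation_def
  using cube_average_mono[of "\<lambda>_. 0" "\<lambda>x. norm (f x - cube_average f a l)" l a] assms
    cube_integrable_norm[OF cube_integrable_diff[OF assms(1) cube_integrable_const]] by simp

lemma cube_oscillation_triangle:
  assumes f: "cube_integrable f" and g: "cube_integrable g" and l: "l > 0"
  shows "cube_oscillation f a l \<le> cube_oscillation (\<lambda>x. f x - g x) a l + cube_oscillation g a l"
proof -
  let ?d = "\<lambda>x. f x - g x"
  have int: "cube_integrable (\<lambda>x. norm (u x - c))" if "cube_integrable u" for u :: "real ^ 'a \<Rightarrow> complex" and c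
    by (intro cube_integrable_norm cube_integrable_diff that cube_integrable_const)
  have d: "cube_integrable ?d" by (rule cube_integrable_diff[OF f g])
  have "cube_oscillation f a l
    \<le> cube_average (\<lambda>x. norm (?d x - cube_average ?d a l) + norm (g x - cube_average g a l)) a l"
    unfolding cube_oscillation_def
  proof (rule cube_average_mono[OF int[OF f] cube_integrable_add[OF int[OF d] int[OF g]] l])
    fix x
    show "norm (f x - cube_average f a l) \<le> norm (?d x - cube_average ?d a l) + norm (g x - cube_average g a l)"
      using norm_triangle_ineq[of "?d x - cube_average ?d a l" "g x - cube_average g a l"]
      by (simp add: cube_average_diff[OF f g] algebra_simps)
  qed
  also have "\<dots> = cube_oscillation ?d a l + cube_oscillation g a l"
    unfolding cube_oscillation_def by (rule cube_average_add[OF int[OF d] int[OF g]])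
  finally show ?thesis .
qed

text \<open>This is the \<omega> of the overview. For \<open>f\<close> in \<open>BMO\<close>,
  membership in \<open>VMO\<close> says that it tends to 0 at 0.\<close>

definition oscillation_modulus :: "(real ^ 'n \<Rightarrow> complex) \<Rightarrow> real \<Rightarrow> ennreal" where
  "oscillation_modulus f r = (SUP (a, l) \<in> UNIV \<times> {0<..r}. mean_osc (cube a l) f)"

lemma mean_osc_le_modulus: "0 < l \<Longrightarrow> l \<le> r \<Longrightarrow> mean_osc (cube a l) f \<le> oscillation_modulus f r"
  unfolding oscillation_modulus_def by (rule SUP_upper2[of "(a, l)"]) auto

lemma mean_osc_le_bmo_norm: "0 < l \<Longrightarrow> mean_osc (cube a l) f \<le> bmo_norm f"
  unfolding bmo_norm_def by (rule SUP_upper2[of "(a, l)"]) auto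

text \<open>Subadditivity of the oscillation. For \<open>g\<close> in \<open>VMO\<close> the second
  term disappears as \<open>r\<close> tends to 0, which is how the distance enters.\<close>

lemma oscillation_modulus_le:
  fixes f g :: "real ^ 'n \<Rightarrow> complex"
  assumes "locally_integrable f" "locally_integrable g"
  shows "oscillation_modulus f r \<le> bmo_norm (\<lambda>x. f x - g x) + oscillation_modulus g r"
  unfolding oscillation_modulus_def[of f]
proof (rule SUP_least, clarify)
  fix a :: "real ^ 'n" and l :: real assume "l \<in> {0<..r}"
  then have l: "0 < l" "l \<le> r" by auto
  obtain f' g' where rep: "borel_representative f f'" "borel_representative g g'"
    using borel_representative_exists assms by blast
  then have int: "cube_integrable f'" "cube_integrable g'" by (auto simp: borel_representative_def)
  have "mean_osc (cube a l) f = ennreal (cube_oscillation f' a l)" by (rule mean_osc_cube[OF rep(1) l(1)])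
  also have "\<dots> \<le> ennreal (cube_oscillation (\<lambda>x. f' x - g' x) a l + cube_oscillation g' a l)"
    by (intro ennreal_leI cube_oscillation_triangle int l)
  also have "\<dots> = mean_osc (cube a l) (\<lambda>x. f x - g x) + mean_osc (cube a l) g"
    using int l mean_osc_cube[OF rep(2) l(1)] mean_osc_cube[OF borel_representative_diff[OF rep] l(1)]
    by (simp add: ennreal_plus cube_oscillation_nonneg cube_integrable_diff)
  also have "\<dots> \<le> bmo_norm (\<lambda>x. f x - g x) + oscillation_modulus g r"
    by (intro add_mono mean_osc_le_bmo_norm mean_osc_le_modulus l)
  finally show "mean_osc (cube a l) f \<le> bmo_norm (\<lambda>x. f x - g x) + oscillation_modulus g r" .
qed

text \<open>Monotonicity gives the existence of the limit in the theorem and identifies it with an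
  infimum, which an estimate at a single radius already bounds from above.\<close>

lemma tendsto_INF_at_right_0:
  fixes E :: "real \<Rightarrow> ennreal"
  assumes mono: "\<And>r s. 0 < r \<Longrightarrow> r \<le> s \<Longrightarrow> E r \<le> E s"
  shows "(E \<longlongrightarrow> (INF r\<in>{0<..}. E r)) (at_right 0)"
proof (rule order_tendstoI)
  fix x assume "x < (INF r\<in>{0<..}. E r)"
  then have "x < E r" if "r > 0" for r
    using that by (meson INF_lower greaterThan_iff order_less_le_trans)
  then show "\<forall>\<^sub>F r in at_right 0. x < E r"
    by (auto simp: eventually_at_right_field intro: exI[of _ 1])
next
  fix x assume "(INF r\<in>{0<..}. E r) < x"
  then obtain r0 where r0: "r0 > 0" "E r0 < x" by (auto simp: INF_less_iff)
  then have "E r < x" if "0 < r" "r < r0" for r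
    using mono[of r r0] that by (simp add: order_le_less_trans)
  then show "\<forall>\<^sub>F r in at_right 0. E r < x"
    using r0(1) by (auto simp: eventually_at_right_field)
qed

text \<open>Kept as the iterated integral of the limit statement;
  \<open>carleson_ratio_square_measure\<close> shows that it agrees with the ratio for
  \<open>square_measure\<close>.\<close>

definition carleson_ratio :: "(real ^ 'n \<Rightarrow> complex) \<Rightarrow> (real ^ 'n \<Rightarrow> complex) \<Rightarrow> real ^ 'n \<Rightarrow> real \<Rightarrow> ennreal" where
  "carleson_ratio \<psi> f a l =
    (\<integral>\<^sup>+t\<in>{0<..<l}. (\<integral>\<^sup>+x\<in>cube a l. square_density \<psi> f x t \<partial>lebesgue) \<partial>lebesgue) / emeasure lebesgue (cube a l)"

definition carleson_modulus :: "(real ^ 'n \<Rightarrow> complex) \<Rightarrow> (real ^ 'n \<Rightarrow> complex) \<Rightarrow> real \<Rightarrow> ennreal" where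
  "carleson_modulus \<psi> f r = (SUP (a, l) \<in> UNIV \<times> {0<..r}. carleson_ratio \<psi> f a l)"

lemma carleson_modulus_mono: "0 < r \<Longrightarrow> r \<le> s \<Longrightarrow> carleson_modulus \<psi> f r \<le> carleson_modulus \<psi> f s"
  unfolding carleson_modulus_def by (rule SUP_subset_mono) auto

lemma bmo_norm_zero: "bmo_norm (\<lambda>x :: real ^ 'n. 0) = 0"
proof -
  have "mean_osc (cube a l) (\<lambda>x. 0) = 0" for a :: "real ^ 'n" and l
    by (simp add: mean_osc_def average_def)
  then show ?thesis unfolding bmo_norm_def by (simp add: case_prod_unfold)
qed

lemma dist_VMO_eq_0:
  assumes "f \<in> VMO"
  shows "dist_VMO f = 0"
proof -
  have "dist_VMO f \<le> bmo_norm (\<lambda>x. f x - f x)"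
    unfolding dist_VMO_def using assms by (rule INF_lower)
  then show ?thesis by (simp add: bmo_norm_zero)
qed

text \<open>Continuity in \<open>\<delta>\<close>. It is used with \<open>k = 2\<close> to discard
  the tail and the oscillation of \<open>g\<close>, and with \<open>k = 1\<close> to approach the
  infimum defining the distance.\<close>

lemma ennreal_le_limit_square:
  fixes c d k :: real and L :: ennreal
  assumes "\<And>\<delta>. \<delta> > 0 \<Longrightarrow> L \<le> ennreal (c * (d + k * \<delta>)\<^sup>2)"
  shows "L \<le> ennreal (c * d\<^sup>2)"
proof (rule tendsto_lowerbound)
  have "((\<lambda>\<delta>. ennreal (c * (d + k * \<delta>)\<^sup>2)) \<longlongrightarrow> ennreal (c * (d + k * 0)\<^sup>2)) (at_right 0)"
    by (intro tendsto_ennrealI tendsto_intros)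
  then show "((\<lambda>\<delta>. ennreal (c * (d + k * \<delta>)\<^sup>2)) \<longlongrightarrow> ennreal (c * d\<^sup>2)) (at_right 0)" by simp
  show "\<forall>\<^sub>F \<delta> in at_right 0. L \<le> ennreal (c * (d + k * \<delta>)\<^sup>2)"
    using assms by (auto simp: eventually_at_right_field intro: exI[of _ 1])
qed simp

section \<open>Carleson ratios and the distance to \<open>VMO\<close>\<close>

context littlewood_paley_kernel
begin

lemma representative_convolution:
  assumes rep: "borel_representative f f'"
  shows "convolution (dilate \<psi> t) f x = (\<integral>y. dilate \<psi> t (x - y) * f' y \<partial>lborel)"
    and "integrable lebesgue (\<lambda>y. dilate \<psi> t (x - y) * f y) \<longleftrightarrow> integrable lborel (\<lambda>y. dilate \<psi> t (x - y) * f' y)"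
proof -
  have [measurable]: "f' \<in> borel_measurable borel" using rep by (simp add: borel_representative_def)
  have "(\<lambda>y. dilate \<psi> t (x - y)) \<in> borel_measurable lebesgue" by (rule lebesgue_borel_measurable) measurable
  then have m: "(\<lambda>y. dilate \<psi> t (x - y) * f y) \<in> borel_measurable lebesgue"
    using rep by (auto simp: borel_representative_def)
  show "convolution (dilate \<psi> t) f x = (\<integral>y. dilate \<psi> t (x - y) * f' y \<partial>lborel)"
    unfolding convolution_def by (rule representative_integral(2)[where \<phi> = "\<lambda>y z. dilate \<psi> t (x - y) * z", OF rep _ m]) measurable
  show "integrable lebesgue (\<lambda>y. dilate \<psi> t (x - y) * f y) \<longleftrightarrow> integrable lborel (\<lambda>y. dilate \<psi> t (x - y) * f' y)"
    by (rule representative_integral(1)[where \<phi> = "\<lambda>y z. dilate \<psi> t (x - y) * z", OF rep _ m]) measurable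
qed

lemma representative_bounds:
  fixes f f' :: "real ^ 'n \<Rightarrow> complex"
  assumes rep: "borel_representative f f'" and l: "l > 0"
  shows "oscillation_modulus f r \<le> ennreal X \<Longrightarrow> X \<ge> 0 \<Longrightarrow> l \<le> r \<Longrightarrow> cube_oscillation f' a l \<le> X"
    and "bmo_norm f \<le> ennreal Y \<Longrightarrow> Y \<ge> 0 \<Longrightarrow> cube_oscillation f' a l \<le> Y"
proof -
  assume "oscillation_modulus f r \<le> ennreal X" "X \<ge> 0" "l \<le> r"
  then have "mean_osc (cube a l) f \<le> ennreal X"
    using mean_osc_le_modulus[OF l, of r a f] by simp
  then show "cube_oscillation f' a l \<le> X" using \<open>X \<ge> 0\<close> by (simp add: mean_osc_cube[OF rep l])
next
  assume "bmo_norm f \<le> ennreal Y" "Y \<ge> 0"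
  then have "mean_osc (cube a l) f \<le> ennreal Y"
    using mean_osc_le_bmo_norm[OF l, of a f] by simp
  then show "cube_oscillation f' a l \<le> Y" using \<open>Y \<ge> 0\<close> by (simp add: mean_osc_cube[OF rep l])
qed

lemma carleson_ratio_le:
  fixes m :: nat
  assumes f: "locally_integrable f" and X: "X > 0" "oscillation_modulus f (concentric_side l m) \<le> ennreal X"
    and Y: "Y \<ge> 0" "bmo_norm f \<le> ennreal Y" and l: "l > 0"
  shows "carleson_ratio \<psi> f a l \<le> ennreal (C_carleson * (X + far_tail CARD('n) m * Y)\<^sup>2)"
proof -
  obtain f' where rep: "borel_representative f f'" using borel_representative_exists[OF f] by blast
  then have f': "f' \<in> borel_measurable borel" "cube_integrable f'" by (auto simp: borel_representative_def)
  let ?B = "C_carleson * (X + far_tail CARD('n) m * Y)\<^sup>2"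
  have "(\<integral>\<^sup>+t\<in>{0<..<l}. (\<integral>\<^sup>+x\<in>cube a l. square_density \<psi> f x t \<partial>lebesgue) \<partial>lebesgue) \<le> ennreal (?B * l ^ CARD('n))"
    unfolding nn_integral_completion square_density_def representative_convolution(1)[OF rep]
    by (rule carleson_estimate[OF f' X(1) Y(1) l])
      (use representative_bounds[OF rep] X Y in \<open>auto simp: less_imp_le\<close>)
  then have "carleson_ratio \<psi> f a l \<le> ennreal (?B * l ^ CARD('n)) / emeasure lebesgue (cube a l)"
    unfolding carleson_ratio_def by (rule divide_right_mono_ennreal)
  also have "\<dots> = ennreal ?B"
    using l C_carleson_pos by (simp add: emeasure_cube divide_ennreal)
  finally show ?thesis .
qed

lemma square_density_measurable:
  assumes "locally_integrable f"
  shows "(\<lambda>(x, t). square_density \<psi> f x t) \<in> borel_measurable (borel \<Otimes>\<^sub>M borel)"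
proof -
  obtain f' where rep: "borel_representative f f'" using borel_representative_exists[OF assms] by blast
  then have [measurable]: "f' \<in> borel_measurable borel" by (simp add: borel_representative_def)
  show ?thesis
    unfolding square_density_def representative_convolution(1)[OF rep] case_prod_unfold by measurable
qed

text \<open>Tonelli on the Borel product, after joint measurability of the density has been secured
  through a Borel representative.\<close>

lemma carleson_ratio_square_measure:
  assumes f: "locally_integrable f"
  shows "emeasure (square_measure \<psi> f) (cube a l \<times> {0<..<l}) / emeasure lebesgue (cube a l) = carleson_ratio \<psi> f a l"
proof -
  let ?H = "upper_half_space :: ((real ^ 'n) \<times> real) set"
  let ?A = "cube a l \<times> {0<..<l}"
  let ?D = "\<lambda>(x, t). square_density \<psi> f x t"
  have H: "?H \<in> sets (borel \<Otimes>\<^sub>M borel)" unfolding upper_half_space_def by (intro pair_measureI) auto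
  have A: "?A \<in> sets (borel \<Otimes>\<^sub>M borel)" by (intro pair_measureI) auto
  have sub: "?A \<subseteq> ?H" by (auto simp: upper_half_space_def)
  have prod: "(lborel :: ((real ^ 'n) \<times> real) measure) = lborel \<Otimes>\<^sub>M lborel" by (rule lborel_prod[symmetric])
  note D [measurable] = square_density_measurable[OF f]
  have "emeasure (square_measure \<psi> f) ?A = (\<integral>\<^sup>+z. ?D z * indicator ?A z \<partial>restrict_space lborel ?H)"
    unfolding square_measure_def
  proof (rule emeasure_density)
    show "?D \<in> borel_measurable (restrict_space lborel ?H)"
      using D by (intro measurable_restrict_space1) (simp add: borel_prod)
    show "?A \<in> sets (restrict_space lborel ?H)"
    proof (subst sets_restrict_space_iff)
      show "?H \<inter> space lborel \<in> sets lborel" using H[unfolded borel_prod] by simp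
      show "?A \<subseteq> ?H \<and> ?A \<in> sets lborel" using A[unfolded borel_prod] sub by simp
    qed
  qed
  also have "\<dots> = (\<integral>\<^sup>+z. ?D z * indicator ?A z * indicator ?H z \<partial>lborel)"
    by (rule nn_integral_restrict_space) (use H[unfolded borel_prod] in simp)
  also have "\<dots> = (\<integral>\<^sup>+z. ?D z * indicator ?A z \<partial>(lborel \<Otimes>\<^sub>M lborel))"
    unfolding prod using sub by (intro nn_integral_cong) (auto simp: indicator_def)
  also have "\<dots> = (\<integral>\<^sup>+t. (\<integral>\<^sup>+x. ?D (x, t) * indicator ?A (x, t) \<partial>lborel) \<partial>lborel)"
  proof (rule lborel_pair.nn_integral_snd[symmetric])
    have [measurable]: "?A \<in> sets (borel \<Otimes>\<^sub>M borel)" by (rule A)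
    show "(\<lambda>z. ?D z * indicator ?A z) \<in> borel_measurable (lborel \<Otimes>\<^sub>M lborel)" by measurable
  qed
  also have "\<dots> = (\<integral>\<^sup>+t\<in>{0<..<l}. (\<integral>\<^sup>+x\<in>cube a l. square_density \<psi> f x t \<partial>lborel) \<partial>lborel)"
    by (intro nn_integral_cong) (auto simp: indicator_def)
  finally show ?thesis by (simp add: carleson_ratio_def nn_integral_completion)
qed

text \<open>For \<open>g\<close> in \<open>VMO\<close>, first \<open>m\<close> is fixed so that the
  tail beyond dilate \<open>m\<close> costs less than \<open>\<delta>\<close>; only then is
  \<open>r\<close> taken so small that on all cubes up to the size of that dilate \<open>g\<close>
  oscillates by less than \<open>\<delta>\<close>. What remains is the norm of
  \<open>f - g\<close>.\<close>

lemma carleson_modulus_limit_le: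
  assumes f: "f \<in> BMO"
  shows "(INF r\<in>{0<..}. carleson_modulus \<psi> f r) \<le> ennreal C_carleson * (dist_VMO f)\<^sup>2"
proof -
  let ?L = "INF r\<in>{0<..}. carleson_modulus \<psi> f r"
  have f_int: "locally_integrable f" and f_norm: "bmo_norm f < \<infinity>" using f by (auto simp: BMO_def)
  define Y where "Y = enn2real (bmo_norm f)"
  have Y: "Y \<ge> 0" "bmo_norm f \<le> ennreal Y" using f_norm by (auto simp: Y_def)
  have near: "?L \<le> ennreal (C_carleson * e\<^sup>2)"
    if g: "g \<in> VMO" and e: "e \<ge> 0" "bmo_norm (\<lambda>x. f x - g x) \<le> ennreal e" for g e
  proof (rule ennreal_le_limit_square[where k = 2])
    fix \<delta> :: real assume \<delta>: "\<delta> > 0"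
    have g_int: "locally_integrable g" using g by (auto simp: VMO_def BMO_def)
    have "(\<lambda>m. far_tail CARD('n) m * Y) \<longlonglongrightarrow> 0 * Y" by (intro tendsto_intros far_tail_tendsto_0)
    then have "\<forall>\<^sub>F m in sequentially. far_tail CARD('n) m * Y < \<delta>"
      using \<delta> by (intro order_tendstoD) auto
    then obtain m where m: "far_tail CARD('n) m * Y < \<delta>" by (auto simp: eventually_sequentially)
    have "(oscillation_modulus g \<longlongrightarrow> 0) (at_right 0)"
      using g unfolding VMO_def oscillation_modulus_def[abs_def] by simp
    then have "\<forall>\<^sub>F r in at_right 0. oscillation_modulus g r < ennreal \<delta>"
      using \<delta> by (intro order_tendstoD) auto
    then obtain b where b: "b > 0" "\<And>r. 0 < r \<Longrightarrow> r < b \<Longrightarrow> oscillation_modulus g r < ennreal \<delta>"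
      unfolding eventually_at_right_field by auto
    \<comment> \<open>With this radius \<open>concentric_side r m\<close> is
      \<open>b / 2\<close>.\<close>
    define r where "r = b / (2 * (3 * 2 ^ m))"
    have r: "r > 0" "concentric_side r m < b" using b(1) by (auto simp: r_def)
    have "carleson_ratio \<psi> f a l \<le> ennreal (C_carleson * (e + 2 * \<delta>)\<^sup>2)" if l: "0 < l" "l \<le> r" for a l
    proof -
      have "concentric_side l m \<le> concentric_side r m" using l by simp
      then have "concentric_side l m < b" using r(2) by linarith
      then have "oscillation_modulus g (concentric_side l m) < ennreal \<delta>" using l by (intro b(2)) auto
      then have "oscillation_modulus f (concentric_side l m) \<le> ennreal e + ennreal \<delta>"
        using oscillation_modulus_le[OF f_int g_int] e(2) by (meson add_mono less_imp_le order_trans)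
      then have "carleson_ratio \<psi> f a l \<le> ennreal (C_carleson * ((e + \<delta>) + far_tail CARD('n) m * Y)\<^sup>2)"
        using e(1) \<delta> l by (intro carleson_ratio_le f_int Y) (auto simp: ennreal_plus[symmetric] simp del: ennreal_plus)
      also have "\<dots> \<le> ennreal (C_carleson * (e + 2 * \<delta>)\<^sup>2)"
        using m e(1) \<delta> Y(1) far_tail_nonneg[of "CARD('n)" m] C_carleson_pos
        by (intro ennreal_leI mult_left_mono power_mono) auto
      finally show ?thesis .
    qed
    then have "carleson_modulus \<psi> f r \<le> ennreal (C_carleson * (e + 2 * \<delta>)\<^sup>2)"
      unfolding carleson_modulus_def by (intro SUP_least) auto
    then show "?L \<le> ennreal (C_carleson * (e + 2 * \<delta>)\<^sup>2)"
      using r(1) by (meson INF_lower2 greaterThan_iff)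
  qed
  show ?thesis
  proof (cases "dist_VMO f")
    case (real d)
    have "?L \<le> ennreal (C_carleson * d\<^sup>2)"
    proof (rule ennreal_le_limit_square[where k = 1])
      fix \<delta> :: real assume \<delta>: "\<delta> > 0"
      have "dist_VMO f < ennreal (d + 1 * \<delta>)" using real \<delta> by (simp add: ennreal_less_iff)
      then obtain g where "g \<in> VMO" "bmo_norm (\<lambda>x. f x - g x) < ennreal (d + 1 * \<delta>)"
        unfolding dist_VMO_def by (auto simp: INF_less_iff)
      then show "?L \<le> ennreal (C_carleson * (d + 1 * \<delta>)\<^sup>2)"
        using real \<delta> by (intro near) auto
    qed
    then show ?thesis using real C_carleson_pos by (simp add: ennreal_mult ennreal_power)
  next
    \<comment> \<open>The right-hand side is infinite, since \<open>C_carleson\<close> is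
      positive.\<close>
    case top
    then show ?thesis using C_carleson_pos by (simp add: ennreal_mult_top power2_eq_square)
  qed
qed

lemma carleson_measure_square_measure:
  assumes f: "f \<in> BMO"
  shows "carleson_measure (square_measure \<psi> f)"
proof -
  have f_int: "locally_integrable f" and f_norm: "bmo_norm f < \<infinity>" using f by (auto simp: BMO_def)
  \<comment> \<open>The added 1 makes \<open>Y\<close> positive, as \<open>carleson_ratio_le\<close>
    requires of \<open>X\<close>; here \<open>Y\<close> takes both parts, with
    \<open>m = 0\<close>.\<close>
  define Y where "Y = enn2real (bmo_norm f) + 1"
  have Y: "Y > 0" "bmo_norm f \<le> ennreal Y"
  proof -
    have "bmo_norm f = ennreal (enn2real (bmo_norm f))" using f_norm by simp
    also have "\<dots> \<le> ennreal Y" by (intro ennreal_leI) (simp add: Y_def)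
    finally show "bmo_norm f \<le> ennreal Y" .
  qed (simp add: Y_def add_nonneg_pos)
  have "carleson_ratio \<psi> f a l \<le> ennreal (C_carleson * (Y + far_tail CARD('n) 0 * Y)\<^sup>2)" if l: "l > 0" for a l
  proof (rule carleson_ratio_le[OF f_int Y(1) _ less_imp_le[OF Y(1)] Y(2) l])
    have "oscillation_modulus f (concentric_side l 0) \<le> bmo_norm f"
      unfolding oscillation_modulus_def by (intro SUP_least) (auto intro: mean_osc_le_bmo_norm)
    then show "oscillation_modulus f (concentric_side l 0) \<le> ennreal Y" using Y(2) by (rule order_trans)
  qed
  then have "(SUP (a, l) \<in> UNIV \<times> {0<..}. emeasure (square_measure \<psi> f) (cube a l \<times> {0<..<l}) / emeasure lebesgue (cube a l))
      \<le> ennreal (C_carleson * (Y + far_tail CARD('n) 0 * Y)\<^sup>2)"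
    unfolding carleson_ratio_square_measure[OF f_int] by (intro SUP_least) auto
  also have "\<dots> < \<infinity>" by simp
  finally show ?thesis
    unfolding carleson_measure_def square_measure_def
    by (auto intro!: sets_restrict_space_cong)
qed

lemma vanishing_carleson_measure_square_measure:
  assumes f: "f \<in> VMO"
  shows "vanishing_carleson_measure (square_measure \<psi> f)"
proof -
  have bmo: "f \<in> BMO" using f by (simp add: VMO_def)
  then have f_int: "locally_integrable f" by (simp add: BMO_def)
  have "(INF r\<in>{0<..}. carleson_modulus \<psi> f r) = 0"
    using carleson_modulus_limit_le[OF bmo] dist_VMO_eq_0[OF f] by simp
  then have "(carleson_modulus \<psi> f \<longlongrightarrow> 0) (at_right 0)"
    using tendsto_INF_at_right_0[of "carleson_modulus \<psi> f", OF carleson_modulus_mono] by simp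
  then show ?thesis
    unfolding vanishing_carleson_measure_def carleson_ratio_square_measure[OF f_int]
      carleson_modulus_def[abs_def]
    using carleson_measure_square_measure[OF bmo] by simp
qed

lemma convolution_integrable:
  assumes f: "f \<in> BMO" and t: "t > 0"
  shows "integrable lebesgue (\<lambda>y. dilate \<psi> t (x - y) * f y)"
proof -
  have f_int: "locally_integrable f" and f_norm: "bmo_norm f < \<infinity>" using f by (auto simp: BMO_def)
  define Y where "Y = enn2real (bmo_norm f)"
  have Y: "Y \<ge> 0" "bmo_norm f \<le> ennreal Y" using f_norm by (auto simp: Y_def)
  obtain f' where rep: "borel_representative f f'" using borel_representative_exists[OF f_int] by blast
  then have f': "f' \<in> borel_measurable borel" "cube_integrable f'" by (auto simp: borel_representative_def)
  have osc: "cube_oscillation f' a l \<le> Y" if "0 < l" for a l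
    using representative_bounds(2)[OF rep that] Y by blast
  \<comment> \<open>Any cube containing \<open>x\<close> serves: only integrability is drawn from
    the decomposition.\<close>
  have "x \<in> cube x t" using t by (simp add: mem_cube)
  then have "integrable lborel (\<lambda>y. dilate \<psi> t (x - y) * f' y)"
    using osc by (intro convolution_decomposition(1)[OF f' Y(1) Y(1) t t, where m = 0]) auto
  then show ?thesis using representative_convolution(2)[OF rep] by simp
qed

end

theorem theorem1p9:
  fixes \<psi> :: "real ^ 'n \<Rightarrow> complex" and C :: real
  assumes "C1 \<psi>"
    and "C > 0"
    and "\<And>x. norm (\<psi> x) \<le> C / (1 + norm x) ^ (CARD('n) + 1)"
    and "\<And>x. norm (grad \<psi> x) \<le> C / (1 + norm x) ^ (CARD('n) + 2)"
    and "(LINT x|lebesgue. \<psi> x) = 0"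
  shows "(\<forall>f \<in> BMO.
            (\<forall>t>0. \<forall>x. integrable lebesgue (\<lambda>y. dilate \<psi> t (x - y) * f y)) \<and>
            (\<lambda>(x, t). square_density \<psi> f x t)
              \<in> borel_measurable (restrict_space borel upper_half_space) \<and>
            carleson_measure (square_measure \<psi> f)) \<and>
         (\<exists>C'::real. C' > 0 \<and>
            (\<forall>f \<in> BMO. \<exists>L.
               ((\<lambda>r. SUP (a, l) \<in> UNIV \<times> {0<..r}.
                   (\<integral>\<^sup>+t\<in>{0<..<l}. (\<integral>\<^sup>+x\<in>cube a l. square_density \<psi> f x t \<partial>lebesgue) \<partial>lebesgue)
                     / emeasure lebesgue (cube a l)) \<longlongrightarrow> L) (at_right 0) \<and>
               L \<le> ennreal C' * (dist_VMO f)\<^sup>2)) \<and>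
         (\<forall>f \<in> VMO. vanishing_carleson_measure (square_measure \<psi> f))"
proof -
  interpret littlewood_paley_kernel \<psi> C by unfold_locales (fact assms)+
  show ?thesis
  proof (intro conjI ballI allI impI exI[of _ C_carleson])
    fix f :: "real ^ 'n \<Rightarrow> complex" assume f: "f \<in> BMO"
    show "integrable lebesgue (\<lambda>y. dilate \<psi> t (x - y) * f y)" if "t > 0" for t x
      by (rule convolution_integrable[OF f that])
    show "(\<lambda>(x, t). square_density \<psi> f x t) \<in> borel_measurable (restrict_space borel upper_half_space)"
      using square_density_measurable[of f] f by (intro measurable_restrict_space1) (simp add: borel_prod BMO_def)
    show "carleson_measure (square_measure \<psi> f)" by (rule carleson_measure_square_measure[OF f])
    show "\<exists>L. ((\<lambda>r. SUP (a, l) \<in> UNIV \<times> {0<..r}.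
          (\<integral>\<^sup>+t\<in>{0<..<l}. (\<integral>\<^sup>+x\<in>cube a l. square_density \<psi> f x t \<partial>lebesgue) \<partial>lebesgue)
            / emeasure lebesgue (cube a l)) \<longlongrightarrow> L) (at_right 0) \<and>
        L \<le> ennreal C_carleson * (dist_VMO f)\<^sup>2"
      \<comment> \<open>The limit \<open>L\<close> is the infimum over all radii.\<close>
      using tendsto_INF_at_right_0[of "carleson_modulus \<psi> f", OF carleson_modulus_mono] carleson_modulus_limit_le[OF f]
      unfolding carleson_modulus_def[abs_def] carleson_ratio_def by blast
  qed (auto intro: C_carleson_pos vanishing_carleson_measure_square_measure)
qed

end
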